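(* Consider the metric on $\mathbb H^2\times\mathbb H^3$ given by $d=\sqrt{d_{\mathbb H^2}^2+d_{\mathbb H^3}^2}$. For any non-elementary convex cocompact subgroup $\Gamma_0<\operatorname{PSL}(2,\mathbb R)$ and any non-elementary faithful convex cocompact Zariski dense representation $\rho_0:\Gamma_0\to\operatorname{PSL}(2,\mathbb C)$, the critical exponent of the group $\{(\gamma_0,\rho_0(\gamma_0)):\gamma_0\in\Gamma_0\}$ with respect to $d$ is strictly less than $\frac{2}{\sqrt5}$.
   Context: $\mathbb H^2$ and $\mathbb H^3$ are the hyperbolic plane and hyperbolic 3-space of constant curvature $-1$ with metrics $d_{\mathbb H^2}$, $d_{\mathbb H^3}$; $\operatorname{PSL}(2,\mathbb R)\simeq\operatorname{SO}^\circ(2,1)$ and $\operatorname{PSL}(2,\mathbb C)\simeq\operatorname{SO}^\circ(3,1)$ act on them as groups of orientation-preserving isometries. Zariski density in $\operatorname{PSL}(2,\mathbb C)$ is meant as a real algebraic group, i.e. as $\operatorname{SO}^\circ(3,1)$. A representation is convex cocompact (resp. Zariski dense, non-elementary) if its image is a convex cocompact discrete subgroup (resp. Zariski dense, non-elementary). The critical exponent of a discrete subgroup $\Gamma<\operatorname{PSL}(2,\mathbb R)\times\operatorname{PSL}(2,\mathbb C)$ with respect to $d$ is the abscissa of convergence (infimum of all $s$ for which the series converges) of $\sum_{\gamma\in\Gamma}e^{-s\,d(\gamma o,o)}$, for any $o\in\mathbb H^2\times\mathbb H^3$ (it is independent of $o$). *)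

theory Defs
  imports "HOL-Analysis.Analysis" "HOL-Algebra.Coset"
begin

section \<open>The groups PSL(2,R) and PSL(2,C)\<close>

definition SL2 :: "('a::field ^ 2 ^ 2) monoid" where
  "SL2 = \<lparr>carrier = {A. det A = 1}, mult = (**), one = mat 1\<rparr>"

definition PSL2 :: "('a::field ^ 2 ^ 2) set monoid" where
  "PSL2 = SL2 Mod {mat 1, - mat 1}"

abbreviation PSL2R :: "(real ^ 2 ^ 2) set monoid" where "PSL2R \<equiv> PSL2"
abbreviation PSL2C :: "(complex ^ 2 ^ 2) set monoid" where "PSL2C \<equiv> PSL2"

text \<open>An element of PSL(2,K) is a coset \<open>{A, - A}\<close>, so the preimage in SL(2,K) of a set
  \<open>U\<close> of elements of PSL(2,K) is \<open>\<Union>U\<close>. The following is therefore the quotient topology.\<close>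

definition PSL2_topology :: "('a::real_normed_field ^ 2 ^ 2) set topology" where
  "PSL2_topology = topology (\<lambda>U. U \<subseteq> carrier PSL2 \<and> openin (top_of_set (carrier SL2)) (\<Union>U))"

definition discrete_subgroup :: "('a::real_normed_field ^ 2 ^ 2) set set \<Rightarrow> bool" where
  "discrete_subgroup \<Gamma> \<longleftrightarrow>
     subgroup \<Gamma> PSL2 \<and> subtopology PSL2_topology \<Gamma> = discrete_topology \<Gamma>"

text \<open>The real algebraic group PSL(2,C) = SO\<open>\<^sup>\<circ>\<close>(3,1) is the quotient of SL(2,C), viewed as a
  real algebraic subset of \<open>\<real>\<^sup>8\<close>, by the group of order two generated by \<open>- 1\<close>. Its regular
  functions are the real polynomials in the real and imaginary parts of the matrix entries
  that are invariant under \<open>A \<mapsto> - A\<close>.\<close>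

definition zariski_dense :: "(complex ^ 2 ^ 2) set set \<Rightarrow> bool" where
  "zariski_dense \<Gamma> \<longleftrightarrow>
     (\<forall>p :: complex ^ 2 ^ 2 \<Rightarrow> real.
        real_polynomial_function p \<and> (\<forall>A. p (- A) = p A) \<and> (\<forall>A\<in>\<Union>\<Gamma>. p A = 0)
        \<longrightarrow> (\<forall>A\<in>carrier SL2. p A = 0))"


section \<open>Hyperbolic plane and hyperbolic 3-space\<close>

text \<open>Upper half-space model: \<open>(z, t)\<close> with \<open>z\<close> in \<open>K\<close> and \<open>t > 0\<close>, where \<open>K = \<real>\<close> gives the
  hyperbolic plane (\<open>(x, t)\<close> is the point \<open>x + i t\<close> of the upper half-plane) and \<open>K = \<complex>\<close> gives
  hyperbolic 3-space.\<close>

definition hyp_space :: "('a::real_normed_field \<times> real) set" where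
  "hyp_space = UNIV \<times> {0<..}"

abbreviation H2 :: "(real \<times> real) set" where "H2 \<equiv> hyp_space"
abbreviation H3 :: "(complex \<times> real) set" where "H3 \<equiv> hyp_space"

definition hyp_dist :: "'a::real_normed_field \<times> real \<Rightarrow> 'a \<times> real \<Rightarrow> real" where
  "hyp_dist p q = arcosh (1 + (dist p q)\<^sup>2 / (2 * snd p * snd q))"

text \<open>Conjugation, uniformly for \<open>\<real>\<close> (where it is the identity) and \<open>\<complex>\<close>.\<close>

definition conjug :: "'a::real_normed_field \<Rightarrow> 'a" where
  "conjug w = of_real ((norm w)\<^sup>2) / w"

lemma conjug_real [simp]: "conjug (x::real) = x"
  by (simp add: conjug_def power2_eq_square)

lemma conjug_complex [simp]: "conjug (z::complex) = cnj z"
  by (cases "z = 0") (simp_all add: conjug_def complex_norm_square[symmetric] divide_eq_eq mult.commute)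

text \<open>The Poincare extension of \<open>z \<mapsto> (a z + b) / (c z + d)\<close>; for \<open>K = \<real>\<close> it is the usual
  Moebius action on the upper half-plane (see below).\<close>

definition mat_act :: "'a::real_normed_field ^ 2 ^ 2 \<Rightarrow> 'a \<times> real \<Rightarrow> 'a \<times> real" where
  "mat_act A = (\<lambda>(z, t).
     let a = A $ 1 $ 1; b = A $ 1 $ 2; c = A $ 2 $ 1; d = A $ 2 $ 2;
         N = (norm (c * z + d))\<^sup>2 + (norm c)\<^sup>2 * t\<^sup>2
     in (((a * z + b) * conjug (c * z + d) + a * conjug c * of_real (t\<^sup>2)) / of_real N, t / N))"

definition act :: "('a::real_normed_field ^ 2 ^ 2) set \<Rightarrow> 'a \<times> real \<Rightarrow> 'a \<times> real" where
  "act g p = the_elem ((\<lambda>A. mat_act A p) ` g)"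


section \<open>Limit sets and convex cocompact subgroups\<close>

text \<open>The boundary at infinity is \<open>K \<union> {\<infinity>}\<close>, with \<open>None\<close> for \<open>\<infinity>\<close>, and
  the closure of \<open>S\<close> is taken in the one-point compactification of \<open>K \<times> [0,\<infinity>)\<close>.\<close>

definition ideal_boundary :: "('a::real_normed_field \<times> real) set \<Rightarrow> 'a option set" where
  "ideal_boundary S = Some ` {x. (x, 0) \<in> closure S} \<union> (if bounded S then {} else {None})"

definition limit_set :: "('a::real_normed_field ^ 2 ^ 2) set set \<Rightarrow> 'a option set" where
  "limit_set \<Gamma> = ideal_boundary ((\<lambda>g. act g (0, 1)) ` \<Gamma>)"

definition non_elementary :: "('a::real_normed_field ^ 2 ^ 2) set set \<Rightarrow> bool" where
  "non_elementary \<Gamma> \<longleftrightarrow> infinite (limit_set \<Gamma>) \<or> card (limit_set \<Gamma>) \<ge> 3"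

definition geodesic_segment ::
    "'a::real_normed_field \<times> real \<Rightarrow> 'a \<times> real \<Rightarrow> ('a \<times> real) set" where
  "geodesic_segment p q = {r \<in> hyp_space. hyp_dist p r + hyp_dist r q = hyp_dist p q}"

definition hyp_convex :: "('a::real_normed_field \<times> real) set \<Rightarrow> bool" where
  "hyp_convex C \<longleftrightarrow> C \<subseteq> hyp_space \<and> (\<forall>p\<in>C. \<forall>q\<in>C. geodesic_segment p q \<subseteq> C)"

definition limit_hull :: "('a::real_normed_field ^ 2 ^ 2) set set \<Rightarrow> ('a \<times> real) set" where
  "limit_hull \<Gamma> = \<Inter>{C. hyp_convex C \<and> closedin (top_of_set hyp_space) C
                       \<and> limit_set \<Gamma> \<subseteq> ideal_boundary C}"

definition convex_cocompact :: "('a::real_normed_field ^ 2 ^ 2) set set \<Rightarrow> bool" where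
  "convex_cocompact \<Gamma> \<longleftrightarrow> discrete_subgroup \<Gamma> \<and>
     (\<exists>K. compact K \<and> K \<subseteq> limit_hull \<Gamma> \<and> limit_hull \<Gamma> = (\<Union>g\<in>\<Gamma>. act g ` K))"


section \<open>Critical exponents on the product of the hyperbolic plane and 3-space\<close>

definition prod_dist ::
    "(real \<times> real) \<times> (complex \<times> real) \<Rightarrow> (real \<times> real) \<times> (complex \<times> real) \<Rightarrow> real" where
  "prod_dist p q = sqrt ((hyp_dist (fst p) (fst q))\<^sup>2 + (hyp_dist (snd p) (snd q))\<^sup>2)"

definition prod_act ::
    "(real ^ 2 ^ 2) set \<times> (complex ^ 2 ^ 2) set
      \<Rightarrow> (real \<times> real) \<times> (complex \<times> real) \<Rightarrow> (real \<times> real) \<times> (complex \<times> real)" where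
  "prod_act \<gamma> p = (act (fst \<gamma>) (fst p), act (snd \<gamma>) (snd p))"

text \<open>The value is extended real: it is \<open>\<infinity>\<close> if the series converges for no \<open>s\<close>.\<close>

definition critical_exponent ::
    "(real \<times> real) \<times> (complex \<times> real)
      \<Rightarrow> ((real ^ 2 ^ 2) set \<times> (complex ^ 2 ^ 2) set) set \<Rightarrow> ereal" where
  "critical_exponent p \<Gamma> =
     Inf (ereal ` {s. (\<lambda>\<gamma>. exp (- s * prod_dist (prod_act \<gamma> p) p)) summable_on \<Gamma>})"


section \<open>Basic facts confirming the definitions\<close>

lemma det_uminus_2: "det (- A) = det (A :: 'a::comm_ring_1 ^ 2 ^ 2)"
  by (simp add: det_2)

lemma uminus_mat_mul:
  fixes A B :: "'a::comm_ring_1 ^ 2 ^ 2"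
  shows "(- A) ** B = - (A ** B)" "A ** (- B) = - (A ** B)"
  by (simp_all add: matrix_matrix_mult_def vec_eq_iff sum_negf)

lemma group_SL2: "group (SL2 :: ('a::field ^ 2 ^ 2) monoid)"
proof (rule groupI)
  fix A :: "'a ^ 2 ^ 2" assume A: "A \<in> carrier SL2"
  then obtain B where B: "B ** A = mat 1"
    using invertible_det_nz[of A] by (auto simp: SL2_def invertible_def)
  then have "det B * det A = 1" by (metis det_mul det_I)
  with A B show "\<exists>B\<in>carrier SL2. B \<otimes>\<^bsub>SL2\<^esub> A = \<one>\<^bsub>SL2\<^esub>" by (auto simp: SL2_def)
qed (auto simp: SL2_def det_mul matrix_mul_assoc)

lemma normal_pm1: "{mat 1, - mat 1} \<lhd> (SL2 :: ('a::field ^ 2 ^ 2) monoid)"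
proof -
  interpret group "SL2 :: ('a ^ 2 ^ 2) monoid" by (rule group_SL2)
  let ?N = "{mat 1, - mat 1} :: ('a ^ 2 ^ 2) set"
  have neg: "(- mat 1 :: 'a ^ 2 ^ 2) \<otimes>\<^bsub>SL2\<^esub> - mat 1 = \<one>\<^bsub>SL2\<^esub>"
    by (simp add: SL2_def uminus_mat_mul)
  have car: "?N \<subseteq> carrier SL2" by (auto simp: SL2_def det_uminus_2)
  have "inv\<^bsub>SL2\<^esub> (- mat 1 :: 'a ^ 2 ^ 2) = - mat 1"
    using neg car by (intro inv_equality) auto
  moreover have "inv\<^bsub>SL2\<^esub> (mat 1 :: 'a ^ 2 ^ 2) = mat 1"
    using inv_one by (simp add: SL2_def)
  ultimately have "subgroup ?N SL2"
    using car by (intro subgroupI) (auto simp: SL2_def uminus_mat_mul)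
  moreover have "A \<otimes>\<^bsub>SL2\<^esub> h \<otimes>\<^bsub>SL2\<^esub> inv\<^bsub>SL2\<^esub> A \<in> ?N"
    if "A \<in> carrier SL2" "h \<in> ?N" for A h :: "'a ^ 2 ^ 2"
  proof -
    have "A \<otimes>\<^bsub>SL2\<^esub> inv\<^bsub>SL2\<^esub> A = \<one>\<^bsub>SL2\<^esub>" using that by simp
    then have "A ** inv\<^bsub>SL2\<^esub> A = mat 1" by (simp add: SL2_def)
    then show ?thesis using that(2) by (auto simp: SL2_def uminus_mat_mul)
  qed
  ultimately show ?thesis by (subst normal_inv_iff) blast
qed

lemma group_PSL2: "group (PSL2 :: ('a::field ^ 2 ^ 2) set monoid)"
  unfolding PSL2_def by (rule normal.factorgroup_is_group[OF normal_pm1])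

lemma carrier_PSL2:
  "carrier (PSL2 :: ('a::field ^ 2 ^ 2) set monoid) = {{A, - A} |A. det A = 1}"
  by (auto simp: PSL2_def FactGroup_def RCOSETS_def r_coset_def SL2_def uminus_mat_mul)

lemma istopology_PSL2:
  "istopology (\<lambda>U. U \<subseteq> carrier PSL2 \<and>
     openin (top_of_set (carrier SL2)) (\<Union>U :: ('a::real_normed_field ^ 2 ^ 2) set))"
proof -
  have *: "\<Union>(U \<inter> V) = \<Union>U \<inter> \<Union>V" if "U \<subseteq> carrier PSL2" "V \<subseteq> carrier PSL2"
    for U V :: "('a ^ 2 ^ 2) set set"
  proof (intro equalityI subsetI)
    fix A assume "A \<in> \<Union>U \<inter> \<Union>V"
    then obtain u v where uv: "u \<in> U" "v \<in> V" "A \<in> u" "A \<in> v" by blast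
    with that have "u \<in> carrier PSL2" "v \<in> carrier PSL2" by auto
    with uv have "u = {A, - A}" "v = {A, - A}" by (auto simp: carrier_PSL2)
    with uv show "A \<in> \<Union>(U \<inter> V)" by blast
  qed auto
  have **: "openin T (\<Union>(\<Union>\<K>))" if "\<forall>U\<in>\<K>. openin T (\<Union>U)"
    for T and \<K> :: "('a ^ 2 ^ 2) set set set"
  proof -
    have "\<Union>(\<Union>\<K>) = \<Union>(Union ` \<K>)" by blast
    with that show ?thesis by (metis (no_types, lifting) image_iff openin_Union)
  qed
  show ?thesis
    unfolding istopology_def by (auto simp: * intro!: ** openin_Int)
qed

lemma openin_PSL2_topology:
  "openin PSL2_topology U \<longleftrightarrow> U \<subseteq> carrier PSL2 \<and> openin (top_of_set (carrier SL2)) (\<Union>U)"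
  unfolding PSL2_topology_def by (simp add: istopology_PSL2 topology_inverse')

lemma conjug_uminus: "conjug (- w) = - conjug w"
  by (simp add: conjug_def)

lemma mat_act_uminus: "mat_act (- A) p = mat_act A p"
proof -
  obtain z t where p: "p = (z, t)" by force
  have n: "- (c * z) - d = - (c * z + d)" for c d :: 'a by simp
  show ?thesis
    unfolding p mat_act_def Let_def
    by (simp add: n conjug_uminus norm_minus_cancel del: minus_add_distrib)
qed

lemma act_coset: "act {A, - A} p = mat_act A p"
  by (simp add: act_def mat_act_uminus)

lemma mat_act_moebius:
  fixes A :: "real ^ 2 ^ 2"
  assumes "det A = 1" "t > 0" and "mat_act A (x, t) = (x', t')"
  shows "Complex x' t' =
    (of_real (A $ 1 $ 1) * Complex x t + of_real (A $ 1 $ 2)) /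
    (of_real (A $ 2 $ 1) * Complex x t + of_real (A $ 2 $ 2))"
proof -
  define a b c d where abcd: "a = A$1$1" "b = A$1$2" "c = A$2$1" "d = A$2$2"
  have det: "a * d - b * c = 1" using assms(1) by (simp add: det_2 abcd)
  define N where "N = (c * x + d)\<^sup>2 + c\<^sup>2 * t\<^sup>2"
  have x': "x' = ((a * x + b) * (c * x + d) + a * c * t\<^sup>2) / N" and t': "t' = t / N"
    using assms(3) by (simp_all add: mat_act_def Let_def abcd N_def)
  have "(c * x + d)\<^sup>2 + (c * t)\<^sup>2 = N" by (simp add: N_def power_mult_distrib)
  moreover have "(c * t * (a * t) + (a * x + b) * (c * x + d)) = (a * x + b) * (c * x + d) + a * c * t\<^sup>2"
    by (simp add: power2_eq_square)
  moreover have "a * t * (c * x + d) - (a * x + b) * (c * t) = t"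
  proof -
    have "a * t * (c * x + d) - (a * x + b) * (c * t) = (a * d - b * c) * t"
      by (simp add: algebra_simps)
    with det show ?thesis by simp
  qed
  ultimately show ?thesis
    unfolding abcd[symmetric] x' t'
    by (simp add: complex_eq_iff Re_divide Im_divide add.commute power2_eq_square[of t, symmetric])
qed

end

(*
  Write d1, d2 for the displacements of the base points under gamma and rho(gamma). The
  exponents of discrete groups on H^2 and H^3 are at most 1 and 2, and the Cauchy-Schwarz inequality bounds s * sqrt(d1^2 + d2^2), for 1/s^2 = 1/s1^2 + 1/s2^2, from below by
  a convex combination of s1 * d1 and s2 * d2. With (s1, s2) = (1, 2) this is the bound 2 / sqrt 5, and
  it is strict as soon as one of the two exponents is not maximal.

  If the limit set of a convex cocompact group is not the whole boundary, its exponent is not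
  maximal: a disc in the complement has images with bounded overlap, so the series converges at the
  dimension, and submultiplicativity of the orbit counting function (geodesics between orbit points
  stay in the hull, which is covered by translates of a compact set) then gives exponential growth
  of strictly smaller rate.

  Both limit sets cannot be the whole boundary, for the group would then act cocompactly on H^2 and on
  H^3: the axis of a hyperbolic element coarsely separates H^2, but a geodesic does not separate H^3.
*)

theory Submission
  imports Defs
begin

section \<open>The isometric action on hyperbolic space\<close>

text \<open>The plane and space are treated at once, over a type that is both a
  \<open>real_normed_field\<close> and a \<open>euclidean_space\<close>; \<open>DIM('a)\<close> is
  the dimension of the boundary. Groups are replaced by their preimages in SL(2), where discreteness
  becomes finiteness of norm balls.

  No measure on the limit set is constructed. Discs on the boundary are compared by Lebesgue volume,
  and convergence of the series at an exponent a yields one scale T with fewer than exp (a * T)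
  orbit points; submultiplicativity then spreads this strict inequality to all scales.

  The two cocompact actions are compared through pairs (A, B) of matrices, with only finitely many
  pairs when either entry is bounded in norm. This replaces an extension of the isomorphism to a
  boundary map: closeness to an axis in one space is shown to bound closeness to the partner axis in
  the other. The obstacle is that the partner of a hyperbolic element must have an axis at all, so
  an eigenvalue of modulus one has to be excluded first.\<close>

lemma inner_mult_left:
  fixes x y z :: "'a::{real_normed_field,euclidean_space}"
  shows "inner (x * y) (x * z) = (norm x)\<^sup>2 * inner y z"
proof -
  have "x * y + x * z = x * (y + z)" by (simp add: algebra_simps)
  then show ?thesis
    unfolding dot_norm by (simp add: norm_mult power_mult_distrib right_diff_distrib)
qed

text \<open>Polarization of \<open>inner_mult_left\<close> in the common factor.\<close>

lemma inner_mult_swap: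
  fixes x y z w :: "'a::{real_normed_field,euclidean_space}"
  shows "inner (x * y) (w * z) + inner (w * y) (x * z) = 2 * inner x w * inner y z"
proof -
  have "inner ((x + w) * y) ((x + w) * z) = (norm (x + w))\<^sup>2 * inner y z"
    by (rule inner_mult_left)
  moreover have "(norm (x + w))\<^sup>2 = (norm x)\<^sup>2 + (norm w)\<^sup>2 + 2 * inner x w"
    unfolding dot_norm[of x w] by (simp add: field_simps)
  ultimately show ?thesis
    by (simp add: distrib_right inner_add_left inner_add_right inner_mult_left)
qed

text \<open>Defined through the norm, \<open>conjug\<close> is visibly multiplicative but not
  additive. Additivity follows because every v satisfies the quadratic equation with trace
  \<open>2 * inner v 1\<close> and norm |v|^2, as testing against all vectors u shows.\<close>

lemma conjug_eq:
  fixes v :: "'a::{real_normed_field,euclidean_space}"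
  shows "conjug v = of_real (2 * inner v 1) - v"
proof (cases "v = 0")
  case False
  have "inner (v * v - of_real (2 * inner v 1) * v + of_real ((norm v)\<^sup>2)) u = 0" for u
  proof -
    have "inner (v * v) u + inner v (v * u) = 2 * inner v 1 * inner v u"
      using inner_mult_swap[of v v 1 u] by simp
    moreover have "inner v (v * u) = (norm v)\<^sup>2 * inner 1 u"
      using inner_mult_left[of v 1 u] by simp
    ultimately show ?thesis
      by (simp add: inner_add_left inner_diff_left of_real_def scaleR_conv_of_real[symmetric])
  qed
  then have "v * v - of_real (2 * inner v 1) * v + of_real ((norm v)\<^sup>2) = 0"
    using inner_eq_zero_iff by blast
  then have "of_real ((norm v)\<^sup>2) = (of_real (2 * inner v 1) - v) * v"
    by (simp add: algebra_simps add_eq_0_iff)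
  with False show ?thesis by (simp add: conjug_def)
qed (simp add: conjug_def)

lemma conjug_add:
  fixes v w :: "'a::{real_normed_field,euclidean_space}"
  shows "conjug (v + w) = conjug v + conjug w"
  by (simp add: conjug_eq inner_add_left algebra_simps)

lemma conjug_diff:
  fixes v w :: "'a::{real_normed_field,euclidean_space}"
  shows "conjug (v - w) = conjug v - conjug w"
  by (simp add: conjug_eq inner_diff_left algebra_simps)

lemma conjug_mult: "conjug (v * w) = conjug v * conjug w"
  by (simp add: conjug_def norm_mult power_mult_distrib)

lemma conjug_of_real [simp]: "conjug (of_real r) = of_real r"
  by (simp add: conjug_def power2_eq_square)

lemma conjug_0 [simp]: "conjug 0 = 0"
  by (simp add: conjug_def)

lemma conjug_1 [simp]: "conjug 1 = 1"
  by (simp add: conjug_def)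

lemma conjug_divide: "conjug (v / w) = conjug v / conjug w"
  by (simp add: conjug_def norm_divide power_divide)

lemma mult_conjug: "v * conjug v = of_real ((norm v)\<^sup>2)"
  by (simp add: conjug_def)

lemma norm_conjug [simp]: "norm (conjug v) = norm v"
  by (simp add: conjug_def norm_divide norm_mult power2_eq_square)

lemma conjug_conjug [simp]: "conjug (conjug v) = v"
  unfolding conjug_def[of "conjug v"] norm_conjug mult_conjug[symmetric]
  by (simp add: conjug_def)

lemma inner_conjug:
  fixes v w :: "'a::{real_normed_field,euclidean_space}"
  shows "v * conjug w + w * conjug v = of_real (2 * inner v w)"
proof -
  have "v * conjug v + (v * conjug w + w * conjug v) + w * conjug w = (v + w) * conjug (v + w)"
    by (simp add: conjug_add algebra_simps)
  also have "\<dots> = of_real ((norm v)\<^sup>2 + 2 * inner v w + (norm w)\<^sup>2)"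
    unfolding mult_conjug dot_norm[of v w] by (simp add: field_simps)
  finally show ?thesis by (simp add: mult_conjug)
qed

text \<open>The hyperboloid model: points become positive definite Hermitian matrices of determinant
  1, on which A acts by X -> A X A*. In this form composition and invariance of distances are matrix
  algebra.\<close>

definition herm :: "'a::{real_normed_field,euclidean_space} \<times> real \<Rightarrow> 'a ^ 2 ^ 2" where
  "herm p = vector [vector [of_real (((norm (fst p))\<^sup>2 + (snd p)\<^sup>2) / snd p), fst p / of_real (snd p)],
                    vector [conjug (fst p) / of_real (snd p), of_real (1 / snd p)]]"

definition ctrans :: "'a::real_normed_field ^ 2 ^ 2 \<Rightarrow> 'a ^ 2 ^ 2" where
  "ctrans A = (\<chi> i j. conjug (A $ j $ i))"

lemma herm_nth [simp]:
  "herm p $ 1 $ 1 = of_real (((norm (fst p))\<^sup>2 + (snd p)\<^sup>2) / snd p)"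
  "herm p $ 1 $ 2 = fst p / of_real (snd p)"
  "herm p $ 2 $ 1 = conjug (fst p) / of_real (snd p)"
  "herm p $ 2 $ 2 = of_real (1 / snd p)"
  by (simp_all add: herm_def)

lemma ctrans_nth [simp]: "ctrans A $ i $ j = conjug (A $ j $ i)"
  by (simp add: ctrans_def)

lemma matrix_mul_2_nth:
  fixes A B :: "'a::semiring_1 ^ 2 ^ 2"
  shows "(A ** B) $ i $ j = A $ i $ 1 * B $ 1 $ j + A $ i $ 2 * B $ 2 $ j"
  by (simp add: matrix_matrix_mult_def sum_2)

lemma matrix_2_eq_iff:
  fixes A B :: "'a ^ 2 ^ 2"
  shows "A = B \<longleftrightarrow> A $ 1 $ 1 = B $ 1 $ 1 \<and> A $ 1 $ 2 = B $ 1 $ 2 \<and> A $ 2 $ 1 = B $ 2 $ 1 \<and> A $ 2 $ 2 = B $ 2 $ 2"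
  by (auto simp: vec_eq_iff forall_2)

lemma det_herm:
  assumes "snd p > 0" shows "det (herm p) = 1"
proof -
  have "of_real (((norm (fst p))\<^sup>2 + (snd p)\<^sup>2) / snd p) * of_real (1 / snd p)
     - (fst p * conjug (fst p)) / (of_real (snd p) * of_real (snd p)) =
     (of_real ((((norm (fst p))\<^sup>2 + (snd p)\<^sup>2) / snd p) * (1 / snd p) - (norm (fst p))\<^sup>2 / (snd p * snd p)) :: 'a)"
    by (simp add: mult_conjug)
  also have "\<dots> = of_real 1"
    using assms by (simp add: field_simps power2_eq_square)
  finally show ?thesis by (simp add: det_2)
qed

lemma det_ctrans:
  fixes A :: "'a::{real_normed_field,euclidean_space} ^ 2 ^ 2"
  shows "det (ctrans A) = conjug (det A)"
  by (simp add: det_2 conjug_diff conjug_mult mult.commute)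

lemma ctrans_mult:
  fixes A B :: "'a::{real_normed_field,euclidean_space} ^ 2 ^ 2"
  shows "ctrans (A ** B) = ctrans B ** ctrans A"
  by (simp add: matrix_2_eq_iff matrix_mul_2_nth conjug_add conjug_mult mult.commute)

lemma mat_act_denominator_pos:
  fixes A :: "'a::real_normed_field ^ 2 ^ 2"
  assumes "det A = 1" "t > 0"
  shows "(norm (A $ 2 $ 1 * z + A $ 2 $ 2))\<^sup>2 + (norm (A $ 2 $ 1))\<^sup>2 * t\<^sup>2 > 0"
proof (cases "A $ 2 $ 1 = 0")
  case True
  with assms(1) have "A $ 2 $ 2 \<noteq> 0" by (auto simp: det_2)
  with True show ?thesis by simp
next
  case False
  with assms(2) show ?thesis by (simp add: add_nonneg_pos)
qed

lemma mat_act_in_hyp_space: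
  assumes "det A = 1" "p \<in> hyp_space"
  shows "mat_act A p \<in> hyp_space"
  using mat_act_denominator_pos[OF assms(1)] assms(2)
  by (cases p) (auto simp: hyp_space_def mat_act_def Let_def)

lemma herm_mat_act:
  fixes A :: "'a::{real_normed_field,euclidean_space} ^ 2 ^ 2"
  assumes "det A = 1" "p \<in> hyp_space"
  shows "herm (mat_act A p) = A ** herm p ** ctrans A"
proof -
  obtain z t where p: "p = (z, t)" by force
  have t: "t > 0" using assms(2) by (simp add: p hyp_space_def)
  define a b c d where abcd: "a = A$1$1" "b = A$1$2" "c = A$2$1" "d = A$2$2"
  define N where "N = (norm (c * z + d))\<^sup>2 + (norm c)\<^sup>2 * t\<^sup>2"
  have N: "N > 0" using mat_act_denominator_pos[OF assms(1) t] by (simp add: N_def abcd)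
  define z' where "z' = ((a * z + b) * conjug (c * z + d) + a * conjug c * of_real (t\<^sup>2)) / of_real N"
  have act: "mat_act A p = (z', t / N)"
    by (simp add: mat_act_def p Let_def abcd z'_def N_def)
  have zz: "of_real ((norm z)\<^sup>2) = z * conjug z" by (simp add: mult_conjug)
  have NN: "(of_real N :: 'a) = (c * z + d) * conjug (c * z + d) + c * conjug c * of_real (t\<^sup>2)"
    by (simp add: N_def mult_conjug)
  define t1 :: 'a where "t1 = of_real t"
  \<comment> \<open>From here on only field identities are needed, so t is moved into the field and
    squared norms are written as z times its conjugate.\<close>
  have t1: "t1 \<noteq> 0" using t by (simp add: t1_def)
  have h11: "herm p $ 1 $ 1 = (z * conjug z + t1 * t1) / t1"
    by (simp add: p zz t1_def power2_eq_square mult_conjug)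
  let ?L = "herm (mat_act A p)" and ?R = "A ** herm p ** ctrans A"
  have L12: "?L $ 1 $ 2 = ((a * z + b) * conjug (c * z + d) + a * conjug c * (t1 * t1)) / t1"
    using N by (simp add: act z'_def t1_def power2_eq_square)
  have R12: "?R $ 1 $ 2 = ((a * z + b) * conjug (c * z + d) + a * conjug c * (t1 * t1)) / t1"
    using t1 by (simp add: matrix_mul_2_nth h11 abcd[symmetric] conjug_add conjug_mult del: herm_nth(1))
      (simp add: p t1_def[symmetric] field_simps)
  have e12: "?L $ 1 $ 2 = ?R $ 1 $ 2" using L12 R12 by simp
  have L22: "?L $ 2 $ 2 = ((c * z + d) * conjug (c * z + d) + c * conjug c * (t1 * t1)) / t1"
    using NN t by (simp add: act t1_def power2_eq_square)
  have R22: "?R $ 2 $ 2 = ((c * z + d) * conjug (c * z + d) + c * conjug c * (t1 * t1)) / t1"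
    using t1 by (simp add: matrix_mul_2_nth h11 abcd[symmetric] conjug_add conjug_mult del: herm_nth(1))
      (simp add: p t1_def[symmetric] field_simps)
  have e22: "?L $ 2 $ 2 = ?R $ 2 $ 2" using L22 R22 by simp
  have sym: "ctrans (herm q) = herm q" for q :: "'a \<times> real"
    by (simp add: matrix_2_eq_iff conjug_divide del: of_real_divide)
  have cc: "ctrans (ctrans A) = A" by (simp add: matrix_2_eq_iff)
  have symR: "ctrans ?R = ?R" by (simp add: ctrans_mult sym cc matrix_mul_assoc)
  have "?L $ 2 $ 1 = conjug (?L $ 1 $ 2)" by (metis sym ctrans_nth)
  also have "\<dots> = conjug (?R $ 1 $ 2)" by (simp only: e12)
  also have "\<dots> = ?R $ 2 $ 1" by (metis symR ctrans_nth)
  finally have e21: "?L $ 2 $ 1 = ?R $ 2 $ 1" .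
  \<comment> \<open>The three entries computed so far and determinant 1 determine the last one,
    because the lower right entry is nonzero.\<close>
  have tN: "t / N > 0" using t N by simp
  have dL: "det ?L = 1" using tN by (intro det_herm) (simp add: act)
  have "det (herm p) = 1" using t by (intro det_herm) (simp add: p)
  then have dR: "det ?R = 1" using assms(1) by (simp add: det_mul det_ctrans)
  have "?L $ 2 $ 2 \<noteq> 0" using t N by (simp add: act)
  moreover have "?L $ 1 $ 1 * ?L $ 2 $ 2 = ?R $ 1 $ 1 * ?L $ 2 $ 2"
    using dL dR e12 e21 e22 unfolding det_2 by (metis diff_eq_eq)
  ultimately have "?L $ 1 $ 1 = ?R $ 1 $ 1" using mult_right_cancel by blast
  with e12 e21 e22 show ?thesis by (subst matrix_2_eq_iff) blast
qed

lemma herm_inj: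
  assumes "herm p = herm q" "p \<in> hyp_space" "q \<in> hyp_space"
  shows "p = q"
proof -
  have *: "(1 / snd p) = (1 / snd q)"
    using assms(1) herm_nth(4)[of p] herm_nth(4)[of q] of_real_eq_iff by metis
  then have t: "snd p = snd q" using assms by (auto simp: hyp_space_def)
  moreover have "fst p / of_real (snd p) = fst q / of_real (snd q)"
    using assms(1) herm_nth(2) by metis
  ultimately show ?thesis using assms(2,3) by (auto simp: hyp_space_def prod_eq_iff)
qed

lemma mat_act_mult:
  fixes A B :: "'a::{real_normed_field,euclidean_space} ^ 2 ^ 2"
  assumes "det A = 1" "det B = 1" "p \<in> hyp_space"
  shows "mat_act (A ** B) p = mat_act A (mat_act B p)"
  using assms
  by (intro herm_inj) (simp_all add: herm_mat_act mat_act_in_hyp_space det_mul ctrans_mult matrix_mul_assoc)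

lemma mat_act_one:
  assumes "p \<in> hyp_space"
  shows "mat_act (mat 1) p = p"
  using assms by (cases p) (simp add: mat_act_def mat_def hyp_space_def)

section \<open>The distance formula and its invariance\<close>

lemma cosh_hyp_dist:
  assumes "p \<in> hyp_space" "q \<in> hyp_space"
  shows "cosh (hyp_dist p q) = 1 + (dist p q)\<^sup>2 / (2 * snd p * snd q)"
  unfolding hyp_dist_def using assms by (intro cosh_arcosh_real) (auto simp: hyp_space_def)

lemma hyp_dist_nonneg:
  assumes "p \<in> hyp_space" "q \<in> hyp_space"
  shows "hyp_dist p q \<ge> 0"
  using assms unfolding hyp_dist_def arcosh_real_def
  by (auto simp: hyp_space_def)

lemma hyp_dist_commute: "hyp_dist p q = hyp_dist q p"
  by (simp add: hyp_dist_def dist_commute mult_ac)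

lemma dist_prod_power2:
  fixes p q :: "'a::euclidean_space \<times> real"
  shows "(dist p q)\<^sup>2 = (norm (fst p))\<^sup>2 + (norm (fst q))\<^sup>2 - 2 * inner (fst p) (fst q) + (snd p - snd q)\<^sup>2"
  by (cases p; cases q) (simp add: dist_Pair_Pair dist_norm power2_norm_eq_inner inner_diff_left inner_diff_right inner_commute power2_eq_square[symmetric])

lemma cosh_hyp_dist':
  fixes p q :: "'a::{real_normed_field,euclidean_space} \<times> real"
  assumes "p \<in> hyp_space" "q \<in> hyp_space"
  shows "2 * snd p * snd q * cosh (hyp_dist p q) =
     (norm (fst p))\<^sup>2 + (snd p)\<^sup>2 + (norm (fst q))\<^sup>2 + (snd q)\<^sup>2 - 2 * inner (fst p) (fst q)"
proof -
  have "snd p > 0" "snd q > 0" using assms by (auto simp: hyp_space_def)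
  then have "2 * snd p * snd q * cosh (hyp_dist p q) = 2 * snd p * snd q + (dist p q)\<^sup>2"
    unfolding cosh_hyp_dist[OF assms] by (simp add: field_simps)
  then show ?thesis by (simp add: dist_prod_power2 power2_diff)
qed

text \<open>The determinant is the Lorentzian quadratic form, so its value at a sum polarizes to the
  Lorentzian product, which is the hyperbolic cosine of the distance. Since A X A* is additive in X,
  this makes A an isometry.\<close>

lemma det_herm_add:
  fixes p q :: "'a::{real_normed_field,euclidean_space} \<times> real"
  assumes "p \<in> hyp_space" "q \<in> hyp_space"
  shows "det (herm p + herm q) = of_real (2 + 2 * cosh (hyp_dist p q))"
proof -
  obtain z t where p: "p = (z, t)" by force
  obtain u s where q: "q = (u, s)" by force
  have ts: "t > 0" "s > 0" using assms by (auto simp: hyp_space_def p q)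
  have 1: "2 * t * s * cosh (hyp_dist p q) = (norm z)\<^sup>2 + t\<^sup>2 + (norm u)\<^sup>2 + s\<^sup>2 - 2 * inner z u"
    using cosh_hyp_dist'[OF assms] by (simp add: p q)
  define t1 s1 :: 'a where "t1 = of_real t" and "s1 = of_real s"
  have t1: "t1 \<noteq> 0" "s1 \<noteq> 0" using ts by (auto simp: t1_def s1_def)
  have zz: "of_real ((norm v)\<^sup>2) = v * conjug v" for v :: 'a by (simp add: mult_conjug)
  have I: "of_real (inner z u) * 2 = z * conjug u + u * conjug z"
    using inner_conjug[of z u] by simp
  have "of_real (2 + 2 * cosh (hyp_dist p q)) * (t1 * s1) = of_real (2 * t * s + 2 * t * s * cosh (hyp_dist p q))"
    by (simp add: t1_def s1_def algebra_simps)
  also have "\<dots> = of_real (2 * t * s + ((norm z)\<^sup>2 + t\<^sup>2 + (norm u)\<^sup>2 + s\<^sup>2 - 2 * inner z u))" by (simp only: 1)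
  also have "\<dots> = 2 * t1 * s1 + z * conjug z + t1 * t1 + u * conjug u + s1 * s1 - (z * conjug u + u * conjug z)"
    by (simp add: zz[symmetric] I[symmetric] t1_def s1_def power2_eq_square del: of_real_power)
  finally have R: "of_real (2 + 2 * cosh (hyp_dist p q)) * (t1 * s1) = \<dots>" .
  have "det (herm p + herm q) * (t1 * s1) = (((z * conjug z + t1 * t1) / t1 + (u * conjug u + s1 * s1) / s1) * (1 / t1 + 1 / s1) -
      (z / t1 + u / s1) * (conjug z / t1 + conjug u / s1)) * (t1 * s1)"
    by (simp add: det_2 p q zz[symmetric] t1_def s1_def power2_eq_square del: of_real_power)
  also have "\<dots> = 2 * t1 * s1 + z * conjug z + t1 * t1 + u * conjug u + s1 * s1 - (z * conjug u + u * conjug z)"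
    using t1 by (simp add: field_simps)
  finally have "det (herm p + herm q) * (t1 * s1) = of_real (2 + 2 * cosh (hyp_dist p q)) * (t1 * s1)"
    using R by simp
  then show ?thesis using t1 by simp
qed

lemma matrix_mul_distrib:
  fixes A B C :: "'a::semiring_1 ^ 2 ^ 2"
  shows "A ** (B + C) = A ** B + A ** C" "(B + C) ** A = B ** A + C ** A"
  by (simp_all add: matrix_2_eq_iff matrix_mul_2_nth algebra_simps)

lemma hyp_dist_mat_act:
  fixes A :: "'a::{real_normed_field,euclidean_space} ^ 2 ^ 2"
  assumes "det A = 1" "p \<in> hyp_space" "q \<in> hyp_space"
  shows "hyp_dist (mat_act A p) (mat_act A q) = hyp_dist p q"
proof -
  have "det (herm (mat_act A p) + herm (mat_act A q)) = det (herm p + herm q)"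
    using assms
    by (simp add: herm_mat_act matrix_mul_distrib[symmetric] det_mul det_ctrans)
  then have "of_real (2 + 2 * cosh (hyp_dist (mat_act A p) (mat_act A q))) = (of_real (2 + 2 * cosh (hyp_dist p q)) :: 'a)"
    using assms by (simp only: det_herm_add mat_act_in_hyp_space)
  then have "2 + 2 * cosh (hyp_dist (mat_act A p) (mat_act A q)) = 2 + 2 * cosh (hyp_dist p q)"
    by (simp only: of_real_eq_iff)
  then have "cosh (hyp_dist (mat_act A p) (mat_act A q)) = cosh (hyp_dist p q)" by simp
  then show ?thesis
    using assms hyp_dist_nonneg mat_act_in_hyp_space
    by (metis arcosh_cosh_real)
qed

section \<open>Triangle inequality and geodesics\<close>

text \<open>X is the space part of the point on the hyperboloid, and its time part is the hyperbolic
  cosine of the distance to the origin.\<close>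

lemma sinh_hyp_dist_origin:
  fixes p :: "'a::{real_normed_field,euclidean_space} \<times> real"
  assumes "p \<in> hyp_space"
  defines "X \<equiv> (fst p /\<^sub>R snd p, ((norm (fst p))\<^sup>2 + (snd p)\<^sup>2 - 1) / (2 * snd p))"
  shows "sinh (hyp_dist p (0, 1)) = norm X"
proof -
  obtain z t where p: "p = (z, t)" by force
  have t: "t > 0" using assms by (simp add: p hyp_space_def)
  have o: "((0::'a), 1::real) \<in> hyp_space" by (simp add: hyp_space_def)
  define C where "C = cosh (hyp_dist p (0, 1))"
  have C: "2 * t * C = (norm z)\<^sup>2 + t\<^sup>2 + 1"
    using cosh_hyp_dist'[OF assms(1) o] by (simp add: p C_def)
  have "norm (z /\<^sub>R t) = norm z / t" using t by (simp add: divide_inverse mult.commute)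
  then have "(norm X)\<^sup>2 = ((norm z) / t)\<^sup>2 + (((norm z)\<^sup>2 + t\<^sup>2 - 1) / (2 * t))\<^sup>2"
    unfolding X_def p fst_conv snd_conv norm_Pair by (simp only: real_norm_def power2_abs) simp
  also have "\<dots> = (((norm z)\<^sup>2 + t\<^sup>2 + 1) / (2 * t))\<^sup>2 - 1"
    using t by (simp add: power_divide divide_simps) (simp add: power2_eq_square algebra_simps)
  also have "((norm z)\<^sup>2 + t\<^sup>2 + 1) / (2 * t) = C"
    using C t by (simp add: field_simps)
  also have "C\<^sup>2 - 1 = (sinh (hyp_dist p (0, 1)))\<^sup>2"
    by (simp add: C_def cosh_square_eq)
  finally show ?thesis
    using hyp_dist_nonneg[OF assms(1) o] by (simp add: power2_eq_iff_nonneg)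
qed

text \<open>On the hyperboloid cosh d(p,q) is the product of the time parts minus
  \<open>inner X Y\<close>; Cauchy-Schwarz turns this into the addition formula for cosh.\<close>

lemma hyp_dist_triangle_origin:
  fixes p q :: "'a::{real_normed_field,euclidean_space} \<times> real"
  assumes "p \<in> hyp_space" "q \<in> hyp_space"
  shows "hyp_dist p q \<le> hyp_dist p (0, 1) + hyp_dist (0, 1) q"
proof -
  obtain z t where p: "p = (z, t)" by force
  obtain u s where q: "q = (u, s)" by force
  have ts: "t > 0" "s > 0" using assms by (auto simp: hyp_space_def p q)
  have o: "((0::'a), 1::real) \<in> hyp_space" by (simp add: hyp_space_def)
  define X where "X = (z /\<^sub>R t, ((norm z)\<^sup>2 + t\<^sup>2 - 1) / (2 * t))"
  define Y where "Y = (u /\<^sub>R s, ((norm u)\<^sup>2 + s\<^sup>2 - 1) / (2 * s))"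
  let ?a = "hyp_dist p (0, 1)" and ?b = "hyp_dist (0, 1) q"
  have X: "norm X = sinh ?a" and Y: "norm Y = sinh ?b"
    using sinh_hyp_dist_origin[OF assms(1)] sinh_hyp_dist_origin[OF assms(2)]
    by (simp_all add: X_def Y_def p q hyp_dist_commute[of "(0,1)"])
  have "2 * t * cosh ?a = (norm z)\<^sup>2 + t\<^sup>2 + 1" "2 * s * cosh ?b = (norm u)\<^sup>2 + s\<^sup>2 + 1"
    using cosh_hyp_dist'[OF assms(1) o] cosh_hyp_dist'[OF o assms(2)] by (simp_all add: p q)
  then have a: "cosh ?a = ((norm z)\<^sup>2 + t\<^sup>2 + 1) / (2 * t)" and b: "cosh ?b = ((norm u)\<^sup>2 + s\<^sup>2 + 1) / (2 * s)"
    using ts by (simp_all add: field_simps)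
  have "2 * t * s * cosh (hyp_dist p q) = (norm z)\<^sup>2 + t\<^sup>2 + (norm u)\<^sup>2 + s\<^sup>2 - 2 * inner z u"
    using cosh_hyp_dist'[OF assms] by (simp add: p q)
  then have "cosh (hyp_dist p q) = cosh ?a * cosh ?b - inner X Y"
    using ts unfolding a b by (simp add: X_def Y_def divide_simps) (simp add: algebra_simps power2_eq_square)
  also have "\<dots> \<le> cosh ?a * cosh ?b + sinh ?a * sinh ?b"
    using Cauchy_Schwarz_ineq2[of X Y] by (simp add: X Y abs_le_iff)
  also have "\<dots> = cosh (?a + ?b)" by (simp add: cosh_add)
  finally show ?thesis
    using assms o hyp_dist_nonneg[OF assms] hyp_dist_nonneg[OF assms(1) o] hyp_dist_nonneg[OF o assms(2)]
    by (subst (asm) cosh_real_nonneg_le_iff) auto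
qed

text \<open>Horizontal translations and dilations carry any middle point to (0, 1), which reduces
  the triangle inequality to the previous case.\<close>

lemma hyp_dist_similarity:
  fixes p q :: "'a::{real_normed_field,euclidean_space} \<times> real"
  assumes "r > 0"
  shows "hyp_dist ((fst p - u) /\<^sub>R r, snd p / r) ((fst q - u) /\<^sub>R r, snd q / r) = hyp_dist p q"
proof -
  have "((fst p - u) /\<^sub>R r, snd p / r) - ((fst q - u) /\<^sub>R r, snd q / r) = (p - q) /\<^sub>R r"
    by (cases p; cases q) (simp add: scaleR_diff_right divide_inverse algebra_simps)
  then have "dist ((fst p - u) /\<^sub>R r, snd p / r) ((fst q - u) /\<^sub>R r, snd q / r) = dist p q / r"
    using assms by (simp add: dist_norm divide_inverse mult.commute)
  then show ?thesis using assms
    by (simp add: hyp_dist_def power_divide power2_eq_square)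
qed

lemma hyp_dist_triangle:
  fixes p q r :: "'a::{real_normed_field,euclidean_space} \<times> real"
  assumes "p \<in> hyp_space" "q \<in> hyp_space" "r \<in> hyp_space"
  shows "hyp_dist p r \<le> hyp_dist p q + hyp_dist q r"
proof -
  define f where "f x = ((fst x - fst q) /\<^sub>R snd q, snd x / snd q)" for x :: "'a \<times> real"
  have q: "snd q > 0" using assms by (auto simp: hyp_space_def)
  then have f: "hyp_dist (f x) (f y) = hyp_dist x y" for x y
    unfolding f_def by (rule hyp_dist_similarity)
  have "f q = (0, 1)" using q by (simp add: f_def)
  moreover have "f p \<in> hyp_space" "f r \<in> hyp_space"
    using assms q by (auto simp: f_def hyp_space_def)
  ultimately show ?thesis
    using hyp_dist_triangle_origin[of "f p" "f r"] f by metis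
qed

section \<open>Euclidean against hyperbolic size, and displacement of the origin\<close>

lemma dist_le_hyp_dist:
  assumes "p \<in> hyp_space" "q \<in> hyp_space"
  shows "(dist p q)\<^sup>2 \<le> 2 * snd p * snd q * cosh (hyp_dist p q)"
  using assms unfolding cosh_hyp_dist[OF assms] by (auto simp: hyp_space_def field_simps)

lemma snd_le_hyp_dist:
  fixes p q :: "'a::{real_normed_field,euclidean_space} \<times> real"
  assumes "p \<in> hyp_space" "q \<in> hyp_space"
  shows "snd p \<le> 2 * cosh (hyp_dist p q) * snd q"
proof -
  have t: "snd p > 0" "snd q > 0" using assms by (auto simp: hyp_space_def)
  have "0 \<le> (norm (fst p - fst q))\<^sup>2" by simp
  also have "(norm (fst p - fst q))\<^sup>2 = (norm (fst p))\<^sup>2 + (norm (fst q))\<^sup>2 - 2 * inner (fst p) (fst q)"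
    by (simp add: power2_norm_eq_inner inner_diff_left inner_diff_right inner_commute)
  finally have "(snd p)\<^sup>2 + (snd q)\<^sup>2 \<le> 2 * snd p * snd q * cosh (hyp_dist p q)"
    using cosh_hyp_dist'[OF assms] by linarith
  then have "(snd p)\<^sup>2 \<le> 2 * snd p * snd q * cosh (hyp_dist p q)"
    using zero_le_power2[of "snd q"] by linarith
  then have "snd p * snd p \<le> snd p * (2 * cosh (hyp_dist p q) * snd q)"
    by (simp add: power2_eq_square mult_ac)
  with t show ?thesis by simp
qed

lemma hyp_space_origin [simp]: "((0::'a::real_normed_field), 1::real) \<in> hyp_space"
  by (simp add: hyp_space_def)

text \<open>The squared Hilbert-Schmidt norm. It is twice the hyperbolic cosine of the displacement
  of the origin (\<open>frob_eq_cosh\<close>), so norm balls in SL(2) are exactly the sets of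
  bounded displacement.\<close>

definition frob :: "'a::real_normed_field ^ 2 ^ 2 \<Rightarrow> real" where
  "frob A = (norm (A $ 1 $ 1))\<^sup>2 + (norm (A $ 1 $ 2))\<^sup>2 + (norm (A $ 2 $ 1))\<^sup>2 + (norm (A $ 2 $ 2))\<^sup>2"

lemma mat_act_origin:
  fixes A :: "'a::{real_normed_field,euclidean_space} ^ 2 ^ 2"
  assumes "det A = 1"
  defines "p \<equiv> mat_act A (0, 1)"
  shows "1 / snd p = (norm (A $ 2 $ 1))\<^sup>2 + (norm (A $ 2 $ 2))\<^sup>2"
    and "((norm (fst p))\<^sup>2 + (snd p)\<^sup>2) / snd p = (norm (A $ 1 $ 1))\<^sup>2 + (norm (A $ 1 $ 2))\<^sup>2"
proof -
  have h: "herm p = A ** ctrans A"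
    unfolding p_def herm_mat_act[OF assms(1) hyp_space_origin]
    by (simp add: matrix_2_eq_iff matrix_mul_2_nth)
  show "1 / snd p = (norm (A $ 2 $ 1))\<^sup>2 + (norm (A $ 2 $ 2))\<^sup>2"
    by (simp add: p_def mat_act_def Let_def)
  have "(of_real (((norm (fst p))\<^sup>2 + (snd p)\<^sup>2) / snd p) :: 'a) = of_real ((norm (A $ 1 $ 1))\<^sup>2 + (norm (A $ 1 $ 2))\<^sup>2)"
    using arg_cong[OF h, of "\<lambda>M. M $ 1 $ 1"] unfolding herm_nth
    by (simp only: matrix_mul_2_nth ctrans_nth mult_conjug of_real_add)
  then show "((norm (fst p))\<^sup>2 + (snd p)\<^sup>2) / snd p = (norm (A $ 1 $ 1))\<^sup>2 + (norm (A $ 1 $ 2))\<^sup>2"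
    by (simp only: of_real_eq_iff)
qed

lemma frob_eq_cosh:
  fixes A :: "'a::{real_normed_field,euclidean_space} ^ 2 ^ 2"
  assumes "det A = 1"
  shows "frob A = 2 * cosh (hyp_dist (mat_act A (0, 1)) (0, 1))"
proof -
  let ?p = "mat_act A (0, 1)"
  have p: "?p \<in> hyp_space" using assms by (simp add: mat_act_in_hyp_space)
  have t: "snd ?p > 0" using p by (auto simp: hyp_space_def)
  have "2 * snd ?p * cosh (hyp_dist ?p (0, 1)) = (norm (fst ?p))\<^sup>2 + (snd ?p)\<^sup>2 + 1"
    using cosh_hyp_dist'[OF p hyp_space_origin] by simp
  then have "2 * cosh (hyp_dist ?p (0, 1)) = ((norm (fst ?p))\<^sup>2 + (snd ?p)\<^sup>2) / snd ?p + 1 / snd ?p"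
    using t by (simp add: field_simps)
  then show ?thesis unfolding mat_act_origin[OF assms] by (simp add: frob_def)
qed

text \<open>The adjugate: the inverse on SL(2), but with entries linear in A and without side
  conditions.\<close>

definition minv :: "'a::field ^ 2 ^ 2 \<Rightarrow> 'a ^ 2 ^ 2" where
  "minv A = vector [vector [A $ 2 $ 2, - (A $ 1 $ 2)], vector [- (A $ 2 $ 1), A $ 1 $ 1]]"

lemma minv_nth [simp]:
  "minv A $ 1 $ 1 = A $ 2 $ 2" "minv A $ 1 $ 2 = - (A $ 1 $ 2)"
  "minv A $ 2 $ 1 = - (A $ 2 $ 1)" "minv A $ 2 $ 2 = A $ 1 $ 1"
  by (simp_all add: minv_def)

lemma det_minv [simp]: "det (minv A) = det A"
  by (simp add: det_2)

lemma minv_mult: "det A = 1 \<Longrightarrow> A ** minv A = mat 1" "det A = 1 \<Longrightarrow> minv A ** A = mat 1"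
  by (simp_all add: matrix_2_eq_iff matrix_mul_2_nth mat_def det_2 algebra_simps)

lemma minv_minv [simp]: "minv (minv A) = A"
  by (simp add: matrix_2_eq_iff)

lemma frob_minv [simp]: "frob (minv A) = frob A"
  by (simp add: frob_def)

lemma mat_act_minv:
  fixes A :: "'a::{real_normed_field,euclidean_space} ^ 2 ^ 2"
  assumes "det A = 1" "p \<in> hyp_space"
  shows "mat_act (minv A) (mat_act A p) = p" "mat_act A (mat_act (minv A) p) = p"
  using assms by (simp_all add: mat_act_mult[symmetric] minv_mult mat_act_one)

lemma hyp_dist_mat_act_minv:
  fixes A B :: "'a::{real_normed_field,euclidean_space} ^ 2 ^ 2"
  assumes "det A = 1" "det B = 1" "p \<in> hyp_space" "q \<in> hyp_space"
  shows "hyp_dist (mat_act (minv A ** B) p) q = hyp_dist (mat_act B p) (mat_act A q)"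
proof -
  have "hyp_dist (mat_act A (mat_act (minv A ** B) p)) (mat_act A q) = hyp_dist (mat_act (minv A ** B) p) q"
    using assms by (intro hyp_dist_mat_act mat_act_in_hyp_space) (simp_all add: det_mul)
  moreover have "mat_act A (mat_act (minv A ** B) p) = mat_act B p"
    using assms by (simp add: mat_act_mult mat_act_in_hyp_space mat_act_minv)
  ultimately show ?thesis by simp
qed

lemma hyp_dist_orbit_le:
  fixes A :: "'a::{real_normed_field,euclidean_space} ^ 2 ^ 2"
  assumes "det A = 1" "p \<in> hyp_space" "q \<in> hyp_space"
  shows "hyp_dist (mat_act A p) p \<le> hyp_dist (mat_act A q) q + 2 * hyp_dist p q"
proof -
  have "hyp_dist (mat_act A p) p \<le> hyp_dist (mat_act A p) (mat_act A q) + hyp_dist (mat_act A q) p"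
    using assms by (intro hyp_dist_triangle mat_act_in_hyp_space)
  also have "\<dots> \<le> hyp_dist p q + (hyp_dist (mat_act A q) q + hyp_dist q p)"
    using assms by (intro add_mono hyp_dist_triangle mat_act_in_hyp_space) (simp_all add: hyp_dist_mat_act)
  finally show ?thesis by (simp add: hyp_dist_commute)
qed

text \<open>In the coordinates \<open>(z, |z|\<^sup>2 + t\<^sup>2)\<close> hyperbolic geodesics are straight, as in the Klein model.\<close>

definition chord_point :: "real \<Rightarrow> 'a::euclidean_space \<times> real \<Rightarrow> 'a \<times> real \<Rightarrow> 'a \<times> real" where
  "chord_point l p q = ((1 - l) *\<^sub>R fst p + l *\<^sub>R fst q,
     sqrt ((1 - l) * (snd p)\<^sup>2 + l * (snd q)\<^sup>2 + l * (1 - l) * (norm (fst p - fst q))\<^sup>2))"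

lemma chord_point_in_hyp_space:
  fixes p q :: "'a::{real_normed_field,euclidean_space} \<times> real"
  assumes "p \<in> hyp_space" "q \<in> hyp_space" "0 \<le> l" "l \<le> 1"
  shows "chord_point l p q \<in> hyp_space"
proof -
  have t: "snd p > 0" "snd q > 0" using assms by (auto simp: hyp_space_def)
  have "(1 - l) * (snd p)\<^sup>2 + l * (snd q)\<^sup>2 > 0"
  proof (cases "l = 0")
    case False
    with assms t show ?thesis by (intro add_nonneg_pos) auto
  qed (use t in simp)
  moreover have "l * (1 - l) * (norm (fst p - fst q))\<^sup>2 \<ge> 0" using assms by simp
  ultimately show ?thesis by (simp add: chord_point_def hyp_space_def)
qed

lemma chord_point_height:
  assumes "0 \<le> l" "l \<le> 1"
  shows "(norm (fst (chord_point l p q)))\<^sup>2 + (snd (chord_point l p q))\<^sup>2 =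
    (1 - l) * ((norm (fst p))\<^sup>2 + (snd p)\<^sup>2) + l * ((norm (fst q))\<^sup>2 + (snd q)\<^sup>2)"
proof -
  have "(1 - l) * (snd p)\<^sup>2 + l * (snd q)\<^sup>2 + l * (1 - l) * (norm (fst p - fst q))\<^sup>2 \<ge> 0"
    using assms by simp
  moreover have "(norm ((1 - l) *\<^sub>R fst p + l *\<^sub>R fst q))\<^sup>2 + l * (1 - l) * (norm (fst p - fst q))\<^sup>2 =
      (1 - l) * (norm (fst p))\<^sup>2 + l * (norm (fst q))\<^sup>2"
    unfolding power2_norm_eq_inner inner_diff_left inner_diff_right inner_add_left inner_add_right
    by (simp add: inner_commute algebra_simps)
  ultimately show ?thesis by (simp add: chord_point_def algebra_simps)
qed

lemma geodesic_chord_point: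
  fixes p q :: "'a::{real_normed_field,euclidean_space} \<times> real"
  assumes "p \<in> hyp_space" "q \<in> hyp_space" "0 \<le> l" "l \<le> 1"
  shows "hyp_dist p (chord_point l p q) + hyp_dist (chord_point l p q) q = hyp_dist p q"
proof -
  define m where "m = chord_point l p q"
  have m: "m \<in> hyp_space" unfolding m_def using assms by (rule chord_point_in_hyp_space)
  define s t u where "s = snd p" "t = snd q" "u = snd m"
  have pos: "s > 0" "t > 0" "u > 0" using assms m by (auto simp: hyp_space_def s_t_u_def)
  define z w where "z = fst p" "w = fst q"
  have fm: "fst m = (1 - l) *\<^sub>R z + l *\<^sub>R w" by (simp add: m_def chord_point_def z_w_def)
  have hm: "(norm (fst m))\<^sup>2 + u\<^sup>2 = (1 - l) * ((norm z)\<^sup>2 + s\<^sup>2) + l * ((norm w)\<^sup>2 + t\<^sup>2)"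
    using chord_point_height[OF assms(3,4)] by (simp add: m_def z_w_def s_t_u_def)
  define C where "C = cosh (hyp_dist p q)"
  have C: "2 * s * t * C = (norm z)\<^sup>2 + s\<^sup>2 + ((norm w)\<^sup>2 + t\<^sup>2) - 2 * inner z w"
    using cosh_hyp_dist'[OF assms(1,2)] by (simp add: C_def s_t_u_def z_w_def)
  \<comment> \<open>On the hyperboloid the chord point is the vector \<open>al\<close> * p +
    \<open>be\<close> * q. Below, \<open>norm1\<close> says that this vector is again on the
    hyperboloid, and the two distances then have hyperbolic sines \<open>be * S\<close> and
    \<open>al * S\<close>, which the addition formula combines.\<close>
  define al be where "al = (1 - l) * s / u" and "be = l * t / u"
  have al: "al \<ge> 0" "be \<ge> 0" using pos assms by (simp_all add: al_def be_def)
  have "2 * s * u * cosh (hyp_dist p m) = (norm z)\<^sup>2 + s\<^sup>2 + ((norm (fst m))\<^sup>2 + u\<^sup>2) - 2 * inner z (fst m)"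
    using cosh_hyp_dist'[OF assms(1) m] by (simp add: s_t_u_def z_w_def)
  also have "\<dots> = (1 - l) * (2 * s * s) + l * (2 * s * t * C)"
    unfolding hm C unfolding fm inner_add_right power2_norm_eq_inner by (simp add: algebra_simps power2_eq_square)
  also have "\<dots> = 2 * s * u * (al + be * C)"
    using pos by (simp add: al_def be_def field_simps)
  finally have pm: "cosh (hyp_dist p m) = al + be * C"
    using pos by simp
  have "2 * u * t * cosh (hyp_dist m q) = ((norm (fst m))\<^sup>2 + u\<^sup>2) + ((norm w)\<^sup>2 + t\<^sup>2) - 2 * inner (fst m) w"
    using cosh_hyp_dist'[OF m assms(2)] by (simp add: s_t_u_def z_w_def)
  also have "\<dots> = (1 - l) * (2 * s * t * C) + l * (2 * t * t)"
    unfolding hm C unfolding fm inner_add_left power2_norm_eq_inner by (simp add: algebra_simps power2_eq_square)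
  also have "\<dots> = 2 * u * t * (al * C + be)"
    using pos by (simp add: al_def be_def field_simps)
  finally have mq: "cosh (hyp_dist m q) = al * C + be"
    using pos by simp
  have uu: "u\<^sup>2 = ((1 - l) * s)\<^sup>2 + (l * t)\<^sup>2 + l * (1 - l) * (2 * s * t * C)"
  proof -
    have "u\<^sup>2 = (1 - l) * ((norm z)\<^sup>2 + s\<^sup>2) + l * ((norm w)\<^sup>2 + t\<^sup>2) - (norm (fst m))\<^sup>2"
      using hm by simp
    also have "\<dots> = ((1 - l) * s)\<^sup>2 + (l * t)\<^sup>2 + l * (1 - l) * (2 * s * t * C)"
      unfolding C unfolding fm power2_norm_eq_inner inner_add_left inner_add_right
      by (simp add: inner_commute algebra_simps power2_eq_square)
    finally show ?thesis .
  qed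
  have au: "u * al = (1 - l) * s" "u * be = l * t" using pos by (simp_all add: al_def be_def)
  have "u\<^sup>2 * (al\<^sup>2 + be\<^sup>2 + 2 * al * be * C) = (u * al)\<^sup>2 + (u * be)\<^sup>2 + 2 * (u * al) * (u * be) * C"
    by (simp add: power2_eq_square algebra_simps)
  also have "\<dots> = u\<^sup>2 * 1" unfolding au uu by (simp add: algebra_simps)
  finally have "u\<^sup>2 * (al\<^sup>2 + be\<^sup>2 + 2 * al * be * C) = u\<^sup>2 * 1" .
  then have norm1: "al\<^sup>2 + be\<^sup>2 + 2 * al * be * C = 1" using pos by simp
  have nn: "hyp_dist p q \<ge> 0" "hyp_dist p m \<ge> 0" "hyp_dist m q \<ge> 0"
    using assms m by (auto intro: hyp_dist_nonneg)
  define S where "S = sinh (hyp_dist p q)"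
  have S: "S \<ge> 0" "S\<^sup>2 = C\<^sup>2 - 1" using nn by (simp_all add: S_def C_def cosh_square_eq)
  have "(sinh (hyp_dist p m))\<^sup>2 = (al + be * C)\<^sup>2 - 1"
    unfolding pm[symmetric] by (simp add: cosh_square_eq)
  also have "\<dots> = (be * S)\<^sup>2"
    unfolding power_mult_distrib S(2) using norm1 by (simp add: power2_eq_square algebra_simps)
  finally have spm: "sinh (hyp_dist p m) = be * S"
    using nn al S by (simp add: power2_eq_iff_nonneg)
  have "(sinh (hyp_dist m q))\<^sup>2 = (al * C + be)\<^sup>2 - 1"
    unfolding mq[symmetric] by (simp add: cosh_square_eq)
  also have "\<dots> = (al * S)\<^sup>2"
    unfolding power_mult_distrib S(2) using norm1 by (simp add: power2_eq_square algebra_simps)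
  finally have smq: "sinh (hyp_dist m q) = al * S"
    using nn al S by (simp add: power2_eq_iff_nonneg)
  have "cosh (hyp_dist p m + hyp_dist m q) = (al + be * C) * (al * C + be) + al * be * S\<^sup>2"
    unfolding cosh_add pm mq spm smq by (simp add: power2_eq_square algebra_simps)
  also have "\<dots> = C * (al\<^sup>2 + be\<^sup>2 + 2 * al * be * C)"
    unfolding S(2) by (simp add: power2_eq_square algebra_simps)
  finally have "cosh (hyp_dist p m + hyp_dist m q) = cosh (hyp_dist p q)"
    by (simp add: norm1 C_def[symmetric])
  then show ?thesis
    using nn unfolding m_def by (metis arcosh_cosh_real add_nonneg_nonneg)
qed

lemma geodesic_point_exists:
  fixes p q :: "'a::{real_normed_field,euclidean_space} \<times> real"
  assumes "p \<in> hyp_space" "q \<in> hyp_space" "0 \<le> x" "x \<le> hyp_dist p q"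
  shows "\<exists>m \<in> geodesic_segment p q. hyp_dist p m = x"
proof -
  have t: "snd p > 0" "snd q > 0" using assms by (auto simp: hyp_space_def)
  define f where "f l = 1 + (dist p (chord_point l p q))\<^sup>2 / (2 * snd p * snd (chord_point l p q))" for l
  have f: "f l = cosh (hyp_dist p (chord_point l p q))" if "0 \<le> l" "l \<le> 1" for l
    using cosh_hyp_dist[OF assms(1) chord_point_in_hyp_space[OF assms(1,2) that]] by (simp add: f_def)
  have pos: "snd (chord_point l p q) > 0" if "0 \<le> l" "l \<le> 1" for l
    using chord_point_in_hyp_space[OF assms(1,2) that] by (auto simp: hyp_space_def)
  have cont: "continuous_on {0..1} (\<lambda>l. chord_point l p q)"
    unfolding chord_point_def by (intro continuous_intros)
  have "continuous_on {0..1} f"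
    unfolding f_def using t pos by (intro continuous_intros cont) force
  moreover have "f 0 = 1" using t by (simp add: f_def chord_point_def)
  moreover have "f 1 = cosh (hyp_dist p q)"
  proof -
    have "chord_point 1 p q = q" using t by (simp add: chord_point_def)
    then show ?thesis using f[of 1] by simp
  qed
  moreover have "1 \<le> cosh x" "cosh x \<le> cosh (hyp_dist p q)"
    using assms by (auto simp: cosh_real_nonneg_le_iff cosh_real_ge_1)
  ultimately obtain l where l: "0 \<le> l" "l \<le> 1" "f l = cosh x"
    using IVT'[of f 0 "cosh x" 1] by auto
  then have "hyp_dist p (chord_point l p q) = x"
    using f assms hyp_dist_nonneg[OF assms(1) chord_point_in_hyp_space] by (metis arcosh_cosh_real)
  moreover have "chord_point l p q \<in> geodesic_segment p q"
    using geodesic_chord_point[OF assms(1,2) l(1,2)] chord_point_in_hyp_space[OF assms(1,2) l(1,2)]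
    by (simp add: geodesic_segment_def)
  ultimately show ?thesis by blast
qed

text \<open>The top of the half circle from x to y. Chord points depend continuously on their
  endpoints down to height 0, so it is the limit of midpoints of chords between points of C that
  tend to x and y; it has positive height because x and y differ.\<close>

lemma chord_midpoint_in_hyp_convex:
  fixes x y :: "'a::{real_normed_field,euclidean_space}"
  assumes "hyp_convex C" "closedin (top_of_set hyp_space) C"
    and "Some x \<in> ideal_boundary C" "Some y \<in> ideal_boundary C" "x \<noteq> y"
  shows "((x + y) /\<^sub>R 2, norm (x - y) / 2) \<in> C"
proof -
  have "(x, 0) \<in> closure C" "(y, 0) \<in> closure C"
    using assms(3,4) by (auto simp: ideal_boundary_def split: if_splits)
  then obtain f g where f: "\<And>n. f n \<in> C" "f \<longlonglongrightarrow> (x, 0)" and g: "\<And>n. g n \<in> C" "g \<longlonglongrightarrow> (y, 0)"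
    unfolding closure_sequential by auto
  define m where "m n = chord_point (1/2) (f n) (g n)" for n
  have CH: "C \<subseteq> hyp_space" using assms(1) by (simp add: hyp_convex_def)
  have mC: "m n \<in> C" for n
  proof -
    have "f n \<in> hyp_space" "g n \<in> hyp_space" using f g CH by auto
    then have "m n \<in> geodesic_segment (f n) (g n)"
      using geodesic_chord_point[of "f n" "g n" "1/2"] chord_point_in_hyp_space[of "f n" "g n" "1/2"]
      by (auto simp: geodesic_segment_def m_def)
    then show ?thesis using assms(1) f(1)[of n] g(1)[of n] unfolding hyp_convex_def by blast
  qed
  have fl: "(\<lambda>n. fst (f n)) \<longlonglongrightarrow> x" "(\<lambda>n. snd (f n)) \<longlonglongrightarrow> 0" "(\<lambda>n. fst (g n)) \<longlonglongrightarrow> y" "(\<lambda>n. snd (g n)) \<longlonglongrightarrow> 0"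
    using tendsto_fst[OF f(2)] tendsto_snd[OF f(2)] tendsto_fst[OF g(2)] tendsto_snd[OF g(2)] by auto
  have "m \<longlonglongrightarrow> ((1 - 1/2) *\<^sub>R x + (1/2) *\<^sub>R y, sqrt ((1 - 1/2) * 0\<^sup>2 + (1/2) * 0\<^sup>2 + (1/2) * (1 - 1/2) * (norm (x - y))\<^sup>2))"
    unfolding m_def chord_point_def by (intro tendsto_intros fl)
  moreover have "sqrt ((1 - 1/2) * 0\<^sup>2 + (1/2) * 0\<^sup>2 + (1/2) * (1 - 1/2) * (norm (x - y))\<^sup>2) = norm (x - y) / 2"
    by (simp add: real_sqrt_divide)
  moreover have "(1 - 1/2) *\<^sub>R x + (1/2) *\<^sub>R y = (x + y) /\<^sub>R 2" by (simp add: scaleR_add_right)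
  ultimately have lim: "m \<longlonglongrightarrow> ((x + y) /\<^sub>R 2, norm (x - y) / 2)" by (simp only:)
  obtain T where T: "closed T" "C = hyp_space \<inter> T"
    using assms(2) by (auto simp: closedin_closed)
  have "((x + y) /\<^sub>R 2, norm (x - y) / 2) \<in> T"
    using T mC by (intro closed_sequentially[OF T(1) _ lim]) auto
  with T assms(5) show ?thesis by (simp add: hyp_space_def)
qed

section \<open>Orbits of discrete groups\<close>

text \<open>The preimage in SL(2) of a discrete group. Discreteness is encoded as finiteness of norm
  balls, the form in which orbits are counted.\<close>

locale discrete_matrix_group =
  fixes G :: "('a::{real_normed_field,euclidean_space} ^ 2 ^ 2) set"
  assumes det_one: "A \<in> G \<Longrightarrow> det A = 1"
    and mat_one_in: "mat 1 \<in> G"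
    and mult_in: "A \<in> G \<Longrightarrow> B \<in> G \<Longrightarrow> A ** B \<in> G"
    and minv_in: "A \<in> G \<Longrightarrow> minv A \<in> G"
    and finite_frob: "finite {A \<in> G. frob A \<le> r}"
begin

lemma act_in [simp]: "A \<in> G \<Longrightarrow> p \<in> hyp_space \<Longrightarrow> mat_act A p \<in> hyp_space"
  by (simp add: mat_act_in_hyp_space det_one)

lemma finite_near:
  assumes "p \<in> hyp_space" "q \<in> hyp_space"
  shows "finite {A \<in> G. hyp_dist (mat_act A p) q \<le> r}"
proof (rule finite_subset)
  let ?R = "2 * cosh (r + 2 * hyp_dist (0, 1) p + hyp_dist p q)"
  show "finite {A \<in> G. frob A \<le> ?R}" by (rule finite_frob)
  show "{A \<in> G. hyp_dist (mat_act A p) q \<le> r} \<subseteq> {A \<in> G. frob A \<le> ?R}"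
  proof safe
    fix A assume A: "A \<in> G" "hyp_dist (mat_act A p) q \<le> r"
    have "hyp_dist (mat_act A (0,1)) (0,1) \<le> hyp_dist (mat_act A p) p + 2 * hyp_dist (0, 1) p"
      using assms A by (intro hyp_dist_orbit_le) (auto simp: det_one)
    moreover have "hyp_dist (mat_act A p) p \<le> hyp_dist (mat_act A p) q + hyp_dist q p"
      using assms A by (intro hyp_dist_triangle) auto
    ultimately have "hyp_dist (mat_act A (0,1)) (0,1) \<le> r + 2 * hyp_dist (0, 1) p + hyp_dist p q"
      using A by (simp add: hyp_dist_commute)
    moreover have "hyp_dist (mat_act A (0,1)) (0,1) \<ge> 0" using A by (intro hyp_dist_nonneg) auto
    ultimately show "frob A \<le> ?R"
      using A by (simp add: frob_eq_cosh det_one cosh_real_nonneg_le_iff)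
  qed
qed

lemma minv_mult_inj: "A \<in> G \<Longrightarrow> inj_on (\<lambda>B. minv A ** B) S"
proof (rule inj_onI)
  fix B C assume "A \<in> G" "minv A ** B = minv A ** C"
  then have "(A ** minv A) ** B = (A ** minv A) ** C" by (metis matrix_mul_assoc)
  with \<open>A \<in> G\<close> show "B = C" by (simp add: minv_mult det_one)
qed

lemma card_near_orbit_point:
  assumes "A \<in> G" "p \<in> hyp_space"
  shows "card {B \<in> G. hyp_dist (mat_act B p) (mat_act A p) \<le> r} \<le> card {B \<in> G. hyp_dist (mat_act B p) p \<le> r}"
  using assms
  by (intro card_inj_on_le[OF minv_mult_inj[OF assms(1)]] finite_near)
    (auto simp: mult_in minv_in det_one hyp_dist_mat_act_minv)

end

text \<open>A packing bound: a point of one ball lies only in balls meeting that one, so the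
  indicator functions add up to at most M inside the big ball; integrate.\<close>

lemma sum_radius_power_le:
  fixes x :: "'i \<Rightarrow> 'a::euclidean_space"
  assumes "finite I" "R \<ge> 0" "\<And>i. i \<in> I \<Longrightarrow> r i \<ge> 0"
    and sub: "\<And>i. i \<in> I \<Longrightarrow> ball (x i) (r i) \<subseteq> ball 0 R"
    and mul: "\<And>i. i \<in> I \<Longrightarrow> card {j \<in> I. ball (x i) (r i) \<inter> ball (x j) (r j) \<noteq> {}} \<le> M"
  shows "(\<Sum>i\<in>I. r i ^ DIM('a)) \<le> real M * R ^ DIM('a)"
proof -
  let ?V = "unit_ball_vol (real DIM('a))"
  have V: "?V > 0" by simp
  have int: "integrable lborel (indicat_real (ball c s))" for c :: 'a and s
    using emeasure_bounded_finite[of "ball c s"] by (simp add: integrable_indicator_iff)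
  have meas: "integral\<^sup>L lborel (indicat_real (ball c s)) = ?V * s ^ DIM('a)" if "s \<ge> 0" for c :: 'a and s
    using content_ball[OF that, of c] by simp
  have "?V * (\<Sum>i\<in>I. r i ^ DIM('a)) = (\<Sum>i\<in>I. integral\<^sup>L lborel (indicat_real (ball (x i) (r i))))"
    unfolding sum_distrib_left using assms(3) meas by (intro sum.cong) (simp_all only:)
  also have "\<dots> = integral\<^sup>L lborel (\<lambda>y. \<Sum>i\<in>I. indicat_real (ball (x i) (r i)) y)"
    by (rule Bochner_Integration.integral_sum[symmetric]) (rule int)
  also have "\<dots> \<le> integral\<^sup>L lborel (\<lambda>y::'a. real M * indicat_real (ball 0 R) y)"
  proof (rule Bochner_Integration.integral_mono)
    fix y
    have card: "(\<Sum>i\<in>I. indicat_real (ball (x i) (r i)) y) = real (card {i \<in> I. y \<in> ball (x i) (r i)})"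
      using assms(1) by (simp add: indicator_def of_nat_sum[symmetric] sum.If_cases Int_def)
    show "(\<Sum>i\<in>I. indicat_real (ball (x i) (r i)) y) \<le> real M * indicat_real (ball 0 R) y"
    proof (cases "\<exists>i\<in>I. y \<in> ball (x i) (r i)")
      case True
      then obtain i where i: "i \<in> I" "y \<in> ball (x i) (r i)" by blast
      have "card {j \<in> I. y \<in> ball (x j) (r j)} \<le> card {j \<in> I. ball (x i) (r i) \<inter> ball (x j) (r j) \<noteq> {}}"
        using assms(1) i(2) by (intro card_mono) auto
      also have "\<dots> \<le> M" by (rule mul[OF i(1)])
      finally show ?thesis using sub[OF i(1)] i(2) unfolding card by (auto simp: indicator_def)
    next
      case False
      then have "{i \<in> I. y \<in> ball (x i) (r i)} = {}" by blast
      then show ?thesis unfolding card by (simp only: card.empty) simp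
    qed
  qed (intro Bochner_Integration.integrable_sum integrable_mult_right int)+
  also have "\<dots> = real M * (?V * R ^ DIM('a))"
    using meas[OF assms(2)] by simp
  finally have "?V * (\<Sum>i\<in>I. r i ^ DIM('a)) \<le> ?V * (real M * R ^ DIM('a))" by (simp add: mult_ac)
  with V show ?thesis by simp
qed

lemma summable_exp_of_shell_bound:
  fixes D :: "'i \<Rightarrow> real"
  assumes nn: "\<And>i. i \<in> S \<Longrightarrow> D i \<ge> 0"
    and fin: "\<And>k::nat. finite {i \<in> S. real k \<le> D i \<and> D i < real k + 1}"
    and card: "\<And>k::nat. real (card {i \<in> S. real k \<le> D i \<and> D i < real k + 1}) \<le> C * exp (a * real k)"
    and "a < s"
  shows "(\<lambda>i. exp (- s * D i)) summable_on S"
proof (rule nonneg_bdd_above_summable_on)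
  define q where "q = exp (a - s)"
  have q: "0 \<le> q" "q < 1" using \<open>a < s\<close> by (auto simp: q_def)
  have C: "C \<ge> 0" using card[of 0] by (simp add: order_trans[OF of_nat_0_le_iff])
  \<comment> \<open>Replacing \<open>D i\<close> by its integer part k changes each term by at most
    the factor \<open>exp \<bar>s\<bar>\<close>; the shells are then dominated by a geometric series
    of ratio q.\<close>
  define B where "B = exp \<bar>s\<bar> * C * (1 / (1 - q))"
  have "sum (\<lambda>i. exp (- s * D i)) F \<le> B" if F: "finite F" "F \<subseteq> S" for F
  proof -
    define g where "g i = nat \<lfloor>D i\<rfloor>" for i
    have g: "g i = k \<longleftrightarrow> real k \<le> D i \<and> D i < real k + 1" if "i \<in> S" for i k
      using nn[OF that] by (auto simp: g_def nat_eq_iff floor_eq_iff)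
    have "sum (\<lambda>i. exp (- s * D i)) F = (\<Sum>k\<in>g ` F. \<Sum>i\<in>{i\<in>F. g i = k}. exp (- s * D i))"
      by (rule sum.image_gen[OF F(1)])
    also have "\<dots> \<le> (\<Sum>k\<in>g ` F. exp \<bar>s\<bar> * C * q ^ k)"
    proof (rule sum_mono)
      fix k assume "k \<in> g ` F"
      have "exp (- s * D i) \<le> exp \<bar>s\<bar> * exp (- s * real k)" if "i \<in> {i \<in> F. g i = k}" for i
      proof -
        have "real k \<le> D i \<and> D i < real k + 1" using that g F by blast
        then have "\<bar>s\<bar> * \<bar>D i - real k\<bar> \<le> \<bar>s\<bar> * 1" by (intro mult_left_mono) auto
        moreover have "- s * (D i - real k) \<le> \<bar>s\<bar> * \<bar>D i - real k\<bar>"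
          by (metis abs_ge_self abs_minus_cancel abs_mult)
        ultimately have "- s * (D i - real k) \<le> \<bar>s\<bar>" by linarith
        then have "- s * D i \<le> \<bar>s\<bar> + (- s * real k)" by (simp add: algebra_simps)
        then show ?thesis by (metis exp_add exp_le_cancel_iff)
      qed
      then have "(\<Sum>i\<in>{i\<in>F. g i = k}. exp (- s * D i)) \<le> real (card {i\<in>F. g i = k}) * (exp \<bar>s\<bar> * exp (- s * real k))"
        by (intro sum_bounded_above) auto
      also have "\<dots> \<le> (C * exp (a * real k)) * (exp \<bar>s\<bar> * exp (- s * real k))"
      proof (rule mult_right_mono)
        have "card {i\<in>F. g i = k} \<le> card {i \<in> S. real k \<le> D i \<and> D i < real k + 1}"
          using F g by (intro card_mono fin) blast
        then show "real (card {i\<in>F. g i = k}) \<le> C * exp (a * real k)"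
          using card[of k] by linarith
      qed simp
      also have "\<dots> = exp \<bar>s\<bar> * C * q ^ k"
        unfolding q_def exp_of_nat_mult[symmetric]
        by (simp add: exp_add[symmetric] exp_diff exp_minus algebra_simps divide_inverse)
      finally show "(\<Sum>i\<in>{i\<in>F. g i = k}. exp (- s * D i)) \<le> exp \<bar>s\<bar> * C * q ^ k" .
    qed
    also have "\<dots> = exp \<bar>s\<bar> * C * (\<Sum>k\<in>g ` F. q ^ k)" by (simp add: sum_distrib_left)
    also have "\<dots> \<le> exp \<bar>s\<bar> * C * (\<Sum>k. q ^ k)"
      using q C F by (intro mult_left_mono sum_le_suminf summable_geometric) auto
    also have "\<dots> = B" using q by (simp add: B_def suminf_geometric)
    finally show ?thesis .
  qed
  then show "bdd_above (sum (\<lambda>i. exp (- s * D i)) ` {F. F \<subseteq> S \<and> finite F})"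
    by (intro bdd_aboveI[of _ B]) auto
qed simp

text \<open>Inside the unit half ball, 2 t cosh d = |z|^2 + t^2 + 1 lies between 1 and 2, so a point
  at distance about k from (0, 1) has height about exp (- k). Discs of that radius about the
  projections to the boundary overlap only for points at bounded distance, and they all fit into a
  disc of radius 2.\<close>

lemma card_shell_half_ball:
  fixes P :: "'i \<Rightarrow> 'a::{real_normed_field,euclidean_space} \<times> real"
    and k :: nat
  assumes "finite I" and hyp: "\<And>i. i \<in> I \<Longrightarrow> P i \<in> hyp_space"
    and half: "\<And>i. i \<in> I \<Longrightarrow> (norm (fst (P i)))\<^sup>2 + (snd (P i))\<^sup>2 \<le> 1"
    and shell: "\<And>i. i \<in> I \<Longrightarrow> real k \<le> hyp_dist (P i) (0, 1) \<and> hyp_dist (P i) (0, 1) \<le> real k + 1"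
    and mult: "\<And>i. i \<in> I \<Longrightarrow> card {j \<in> I. hyp_dist (P j) (P i) \<le> arcosh (1 + 16 * exp 2)} \<le> M"
  shows "real (card I) \<le> real M * 2 ^ DIM('a) * exp (real DIM('a) * real k)"
proof -
  define r where "r = exp (- real k)"
  have r: "r > 0" "r \<le> 1" by (auto simp: r_def)
  have t: "snd (P i) > 0" "snd (P i) \<le> 2 * r" "snd (P i) \<ge> r * exp (-1) / 2" if "i \<in> I" for i
  proof -
    let ?d = "hyp_dist (P i) (0, 1)"
    show t0: "snd (P i) > 0" using hyp[OF that] by (auto simp: hyp_space_def)
    have eq: "2 * snd (P i) * cosh ?d = (norm (fst (P i)))\<^sup>2 + (snd (P i))\<^sup>2 + 1"
      using cosh_hyp_dist'[OF hyp[OF that] hyp_space_origin] by simp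
    have "exp (real k) \<le> exp ?d" "exp ?d \<le> exp (real k + 1)" using shell[OF that] by auto
    moreover have "exp ?d \<le> 2 * cosh ?d" "cosh ?d \<le> exp ?d"
      using shell[OF that] by (auto simp: cosh_def)
    ultimately have c: "exp (real k) \<le> 2 * cosh ?d" "cosh ?d \<le> exp (real k + 1)" by linarith+
    have "snd (P i) * exp (real k) \<le> snd (P i) * (2 * cosh ?d)" using t0 c by (intro mult_left_mono) auto
    also have "\<dots> \<le> 2" using eq half[OF that] by simp
    finally show "snd (P i) \<le> 2 * r" by (simp add: r_def exp_minus field_simps)
    have "1 \<le> 2 * snd (P i) * cosh ?d" unfolding eq by simp
    also have "\<dots> \<le> 2 * snd (P i) * exp (real k + 1)" using t0 c by (intro mult_left_mono) auto
    finally show "snd (P i) \<ge> r * exp (-1) / 2" by (simp add: r_def exp_minus exp_add field_simps)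
  qed
  have "(\<Sum>i\<in>I. r ^ DIM('a)) \<le> real M * 2 ^ DIM('a)"
  proof (rule sum_radius_power_le[where x = "\<lambda>i. fst (P i)" and r = "\<lambda>_. r"])
    fix i assume i: "i \<in> I"
    have "(norm (fst (P i)))\<^sup>2 \<le> 1" using half[OF i] zero_le_power2[of "snd (P i)"] by linarith
    then have "norm (fst (P i)) \<le> 1" by (simp add: abs_square_le_1)
    then show "ball (fst (P i)) r \<subseteq> ball 0 2"
      using r by (subst ball_subset_ball_iff) (auto simp: dist_norm)
    have "hyp_dist (P j) (P i) \<le> arcosh (1 + 16 * exp 2)"
      if j: "j \<in> I" and ne: "ball (fst (P i)) r \<inter> ball (fst (P j)) r \<noteq> {}" for j
    proof -
      obtain y where "dist (fst (P i)) y < r" "dist (fst (P j)) y < r" using ne by auto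
      then have "dist (fst (P j)) (fst (P i)) \<le> 2 * r"
        using dist_triangle2[of "fst (P j)" "fst (P i)" y] by linarith
      then have "(dist (fst (P j)) (fst (P i)))\<^sup>2 \<le> (2 * r)\<^sup>2" by (intro power_mono) auto
      moreover have "(dist (snd (P j)) (snd (P i)))\<^sup>2 \<le> (2 * r)\<^sup>2"
        using t[OF i] t[OF j] by (intro power_mono) (auto simp: dist_real_def)
      ultimately have "(dist (P j) (P i))\<^sup>2 \<le> 8 * r\<^sup>2"
        \<comment> \<open>Horizontal and vertical differences are at most 2 r each, and both heights
          are at least r / (2 e). The quotient of 8 r^2 by r^2 exp (- 2) / 2 is the constant 16 exp
          2 of the statement.\<close>
        by (simp add: dist_prod_def power_mult_distrib)
      moreover have "2 * snd (P j) * snd (P i) \<ge> 2 * (r * exp (-1) / 2) * (r * exp (-1) / 2)"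
        using t[OF i] t[OF j] r by (intro mult_mono mult_nonneg_nonneg) auto
      moreover have "2 * (r * exp (-1) / 2) * (r * exp (-1) / 2) = r\<^sup>2 * exp (-2) / 2"
        by (simp add: power2_eq_square exp_add[symmetric])
      ultimately have "(dist (P j) (P i))\<^sup>2 / (2 * snd (P j) * snd (P i)) \<le> (8 * r\<^sup>2) / (r\<^sup>2 * exp (-2) / 2)"
        using r by (intro frac_le) auto
      also have "\<dots> = 16 * exp 2" using r by (simp add: exp_minus field_simps)
      finally have "(dist (P j) (P i))\<^sup>2 / (2 * snd (P j) * snd (P i)) \<le> 16 * exp 2" .
      moreover have "(dist (P j) (P i))\<^sup>2 / (2 * snd (P j) * snd (P i)) \<ge> 0"
        using t[OF i] t[OF j] by simp
      ultimately show ?thesis unfolding hyp_dist_def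
        by (subst not_less[symmetric], subst arcosh_less_iff_real) auto
    qed
    then have "card {j \<in> I. ball (fst (P i)) r \<inter> ball (fst (P j)) r \<noteq> {}} \<le> card {j \<in> I. hyp_dist (P j) (P i) \<le> arcosh (1 + 16 * exp 2)}"
      using \<open>finite I\<close> by (intro card_mono) auto
    also have "\<dots> \<le> M" by (rule mult[OF i])
    finally show "card {j \<in> I. ball (fst (P i)) r \<inter> ball (fst (P j)) r \<noteq> {}} \<le> M" .
  qed (use r assms in auto)
  then have "real (card I) * r ^ DIM('a) \<le> real M * 2 ^ DIM('a)" by simp
  moreover have "r ^ DIM('a) * exp (real DIM('a) * real k) = 1"
    unfolding r_def exp_of_nat_mult[symmetric] by (simp add: exp_add[symmetric])
  ultimately show ?thesis
    using mult_right_mono[of "real (card I) * r ^ DIM('a)" "real M * 2 ^ DIM('a)" "exp (real DIM('a) * real k)"]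
    by (simp add: mult.assoc)
qed

text \<open>Inversion in the unit hemisphere, an isometry fixing (0, 1). It brings the orbit points
  outside the unit half ball into it, so that the count there covers the whole orbit.\<close>

definition hyp_inversion :: "'a::real_normed_vector \<times> real \<Rightarrow> 'a \<times> real" where
  "hyp_inversion p = (let w = (norm (fst p))\<^sup>2 + (snd p)\<^sup>2 in (fst p /\<^sub>R w, snd p / w))"

lemma
  fixes p :: "'a::{real_normed_field,euclidean_space} \<times> real"
  assumes "p \<in> hyp_space"
  shows hyp_inversion_in: "hyp_inversion p \<in> hyp_space"
    and hyp_inversion_height: "(norm (fst (hyp_inversion p)))\<^sup>2 + (snd (hyp_inversion p))\<^sup>2 = 1 / ((norm (fst p))\<^sup>2 + (snd p)\<^sup>2)"
proof -
  define w where "w = (norm (fst p))\<^sup>2 + (snd p)\<^sup>2"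
  have w: "w > 0" using assms by (auto simp: w_def hyp_space_def add_nonneg_pos)
  then show "hyp_inversion p \<in> hyp_space"
    using assms by (auto simp: hyp_inversion_def Let_def w_def[symmetric] hyp_space_def)
  have "(norm (fst (hyp_inversion p)))\<^sup>2 + (snd (hyp_inversion p))\<^sup>2 = w / w\<^sup>2"
    using w by (simp add: hyp_inversion_def Let_def w_def[symmetric] power_mult_distrib power_divide)
      (simp add: w_def add_divide_distrib divide_inverse power_inverse distrib_right mult.commute)
  also have "\<dots> = 1 / w" using w by (simp add: power2_eq_square)
  finally show "(norm (fst (hyp_inversion p)))\<^sup>2 + (snd (hyp_inversion p))\<^sup>2 = 1 / ((norm (fst p))\<^sup>2 + (snd p)\<^sup>2)"
    by (simp add: w_def)
qed

lemma hyp_dist_inversion: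
  fixes p q :: "'a::{real_normed_field,euclidean_space} \<times> real"
  assumes "p \<in> hyp_space" "q \<in> hyp_space"
  shows "hyp_dist (hyp_inversion p) (hyp_inversion q) = hyp_dist p q"
proof -
  define w v where "w = (norm (fst p))\<^sup>2 + (snd p)\<^sup>2" "v = (norm (fst q))\<^sup>2 + (snd q)\<^sup>2"
  have t: "snd p > 0" "snd q > 0" using assms by (auto simp: hyp_space_def)
  then have wv: "w > 0" "v > 0" by (simp_all add: w_v_def add_nonneg_pos)
  note in_hyp = hyp_inversion_in[OF assms(1)] hyp_inversion_in[OF assms(2)]
  have f: "fst (hyp_inversion p) = fst p /\<^sub>R w" "snd (hyp_inversion p) = snd p / w"
     "fst (hyp_inversion q) = fst q /\<^sub>R v" "snd (hyp_inversion q) = snd q / v"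
    by (simp_all add: hyp_inversion_def w_v_def Let_def)
  have "2 * (snd p / w) * (snd q / v) * cosh (hyp_dist (hyp_inversion p) (hyp_inversion q)) =
      1 / w + 1 / v - 2 * inner (fst p /\<^sub>R w) (fst q /\<^sub>R v)"
    using cosh_hyp_dist'[OF in_hyp] hyp_inversion_height[OF assms(1)] hyp_inversion_height[OF assms(2)]
    unfolding f w_v_def by simp
  also have "\<dots> = (w + v - 2 * inner (fst p) (fst q)) / (w * v)"
    using wv by (simp add: field_simps)
  also have "w + v - 2 * inner (fst p) (fst q) = 2 * snd p * snd q * cosh (hyp_dist p q)"
    unfolding cosh_hyp_dist'[OF assms] by (simp add: w_v_def)
  finally have "cosh (hyp_dist (hyp_inversion p) (hyp_inversion q)) = cosh (hyp_dist p q)"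
    using t wv by (simp add: field_simps)
  then show ?thesis
    using hyp_dist_nonneg[OF assms] hyp_dist_nonneg[OF in_hyp] by (metis arcosh_cosh_real)
qed

context discrete_matrix_group
begin

abbreviation displacement :: "'a ^ 2 ^ 2 \<Rightarrow> real" where
  "displacement A \<equiv> hyp_dist (mat_act A (0, 1)) (0, 1)"

lemma displacement_nonneg: "A \<in> G \<Longrightarrow> displacement A \<ge> 0"
  by (simp add: hyp_dist_nonneg)

lemma summable_above_dimension:
  assumes "s > real DIM('a)"
  shows "(\<lambda>A. exp (- s * displacement A)) summable_on G"
proof (rule summable_exp_of_shell_bound[OF displacement_nonneg _ _ assms])
  define M where "M = card {B \<in> G. displacement B \<le> arcosh (1 + 16 * exp 2)}"
  fix k :: nat
  let ?S = "{A \<in> G. real k \<le> displacement A \<and> displacement A < real k + 1}"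
  let ?w = "\<lambda>A. (norm (fst (mat_act A (0, 1))))\<^sup>2 + (snd (mat_act A (0, 1)))\<^sup>2"
  show fin: "finite ?S"
    by (rule finite_subset[OF _ finite_near[of "(0,1)" "(0,1)" "real k + 1"]]) auto
  define S1 S2 where "S1 = {A \<in> ?S. ?w A \<le> 1}" and "S2 = {A \<in> ?S. \<not> ?w A \<le> 1}"
  have near: "card {B \<in> T. hyp_dist (mat_act B (0,1)) (mat_act A (0,1)) \<le> arcosh (1 + 16 * exp 2)} \<le> M"
    if "A \<in> G" "T \<subseteq> G" for A T
  proof -
    have "card {B \<in> T. hyp_dist (mat_act B (0,1)) (mat_act A (0,1)) \<le> arcosh (1 + 16 * exp 2)} \<le>
        card {B \<in> G. hyp_dist (mat_act B (0,1)) (mat_act A (0,1)) \<le> arcosh (1 + 16 * exp 2)}"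
      using that by (intro card_mono finite_near) auto
    also have "\<dots> \<le> M" unfolding M_def using that by (intro card_near_orbit_point) auto
    finally show ?thesis .
  qed
  have "real (card S1) \<le> real M * 2 ^ DIM('a) * exp (DIM('a) * real k)"
  proof (rule card_shell_half_ball[where P = "\<lambda>A::'a ^ 2 ^ 2. mat_act A (0,1)"])
    show "finite S1" by (rule finite_subset[OF _ fin]) (auto simp: S1_def)
  qed (use near[of _ S1] in \<open>auto simp: S1_def\<close>)
  moreover have "real (card S2) \<le> real M * 2 ^ DIM('a) * exp (DIM('a) * real k)"
  proof (rule card_shell_half_ball[where P = "\<lambda>A::'a ^ 2 ^ 2. hyp_inversion (mat_act A (0,1))"])
    show "finite S2" by (rule finite_subset[OF _ fin]) (auto simp: S2_def)
  next
    fix A assume A: "A \<in> S2"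
    then have AG: "A \<in> G" by (auto simp: S2_def)
    then show "hyp_inversion (mat_act A (0,1)) \<in> hyp_space" by (simp add: hyp_inversion_in)
    show "(norm (fst (hyp_inversion (mat_act A (0, 1)))))\<^sup>2 + (snd (hyp_inversion (mat_act A (0, 1))))\<^sup>2 \<le> 1"
      using A AG by (subst hyp_inversion_height) (auto simp: S2_def)
    have "hyp_inversion ((0::'a), 1::real) = (0, 1)" by (simp add: hyp_inversion_def Let_def)
    then have "hyp_dist (hyp_inversion (mat_act A (0, 1))) (0, 1) = displacement A"
      using hyp_dist_inversion[of "mat_act A (0,1)" "(0,1)"] AG by simp
    with A show "real k \<le> hyp_dist (hyp_inversion (mat_act A (0, 1))) (0, 1) \<and>
         hyp_dist (hyp_inversion (mat_act A (0, 1))) (0, 1) \<le> real k + 1" by (auto simp: S2_def)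
    have "{B \<in> S2. hyp_dist (hyp_inversion (mat_act B (0, 1))) (hyp_inversion (mat_act A (0, 1))) \<le> arcosh (1 + 16 * exp 2)}
       = {B \<in> S2. hyp_dist (mat_act B (0,1)) (mat_act A (0,1)) \<le> arcosh (1 + 16 * exp 2)}"
      using AG by (auto simp: S2_def hyp_dist_inversion)
    then show "card {B \<in> S2. hyp_dist (hyp_inversion (mat_act B (0, 1))) (hyp_inversion (mat_act A (0, 1))) \<le> arcosh (1 + 16 * exp 2)} \<le> M"
      using near[OF AG, of S2] by (auto simp: S2_def)
  qed
  moreover have "card ?S \<le> card S1 + card S2"
  proof -
    have "?S = S1 \<union> S2" by (auto simp: S1_def S2_def)
    then show ?thesis by (simp add: card_Un_le)
  qed
  ultimately show "real (card ?S) \<le> (2 * real M * 2 ^ DIM('a)) * exp (real DIM('a) * real k)"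
    by linarith
qed

end

section \<open>Convergence at the dimension\<close>

lemma norm_add_mult_power2_le:
  fixes a b x y :: "'a::real_normed_field"
  shows "(norm (a * x + b * y))\<^sup>2 \<le> ((norm a)\<^sup>2 + (norm b)\<^sup>2) * ((norm x)\<^sup>2 + (norm y)\<^sup>2)"
proof -
  have "norm (a * x + b * y) \<le> norm a * norm x + norm b * norm y"
    by (metis norm_mult norm_triangle_ineq)
  then have "(norm (a * x + b * y))\<^sup>2 \<le> (norm a * norm x + norm b * norm y)\<^sup>2"
    by (intro power_mono) auto
  also have "\<dots> \<le> ((norm a)\<^sup>2 + (norm b)\<^sup>2) * ((norm x)\<^sup>2 + (norm y)\<^sup>2)"
    using zero_le_power2[of "norm a * norm y - norm b * norm x"]
    by (simp add: power2_eq_square algebra_simps)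
  finally show ?thesis .
qed

lemma frob_nonneg: "frob A \<ge> 0"
  by (simp add: frob_def)

lemma frob_mult_le:
  fixes A B :: "'a::real_normed_field ^ 2 ^ 2"
  shows "frob (A ** B) \<le> frob A * frob B"
proof -
  let ?n = "\<lambda>M i j. (norm ((M :: 'a ^ 2 ^ 2) $ i $ j))\<^sup>2"
  have *: "?n (A ** B) i j \<le> (?n A i 1 + ?n A i 2) * (?n B 1 j + ?n B 2 j)" for i j
    unfolding matrix_mul_2_nth by (rule norm_add_mult_power2_le)
  have "frob (A ** B) \<le> (?n A 1 1 + ?n A 1 2) * (?n B 1 1 + ?n B 2 1) + (?n A 1 1 + ?n A 1 2) * (?n B 1 2 + ?n B 2 2)
     + (?n A 2 1 + ?n A 2 2) * (?n B 1 1 + ?n B 2 1) + (?n A 2 1 + ?n A 2 2) * (?n B 1 2 + ?n B 2 2)"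
    unfolding frob_def by (intro add_mono *)
  also have "\<dots> = frob A * frob B" by (simp add: frob_def algebra_simps)
  finally show ?thesis .
qed

text \<open>A matrix of large norm is nearly of rank one, so its four entries are comparable to the
  lower left one as soon as neither its image nor its kernel is close to \<open>\<infinity>\<close>.\<close>

lemma entries_dominated_by_lower_left:
  fixes x y u v \<beta> :: real
  assumes nn: "x \<ge> 0" "y \<ge> 0" "u \<ge> 0" "v \<ge> 0" and "\<beta> \<ge> 1"
    and det: "x * v \<le> 1 + y * u"
    and 1: "x\<^sup>2 + y\<^sup>2 \<le> \<beta> * (u\<^sup>2 + v\<^sup>2)" and 2: "v\<^sup>2 + y\<^sup>2 \<le> \<beta> * (u\<^sup>2 + x\<^sup>2)"
  shows "x\<^sup>2 + y\<^sup>2 + u\<^sup>2 + v\<^sup>2 \<le> 8 * \<beta> * (\<beta> + 1) \<or> x\<^sup>2 + y\<^sup>2 + u\<^sup>2 + v\<^sup>2 \<le> (\<beta> + 1) * (1 + 64 * \<beta> ^ 4) * u\<^sup>2"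
\<comment> \<open>Think of x, y, u, v as the moduli of a, b, c, d. If u controls v, the row bound 1
  controls the other entries. Otherwise v dwarfs u; then 2 gives v <= 2 \<beta> x, 1 gives y <= 2
  \<beta> v, and the determinant inequality bounds v absolutely.\<close>
proof (cases "8 * \<beta>\<^sup>2 * u \<ge> v")
  case True
  then have "v\<^sup>2 \<le> (8 * \<beta>\<^sup>2 * u)\<^sup>2" using nn by (intro power_mono)
  then have v: "v\<^sup>2 \<le> 64 * \<beta> ^ 4 * u\<^sup>2" by (simp add: power_mult_distrib)
  have "x\<^sup>2 + y\<^sup>2 + u\<^sup>2 + v\<^sup>2 \<le> (\<beta> + 1) * (u\<^sup>2 + v\<^sup>2)" using 1 by (simp add: algebra_simps)
  also have "\<dots> \<le> (\<beta> + 1) * (u\<^sup>2 + 64 * \<beta> ^ 4 * u\<^sup>2)" using v \<open>\<beta> \<ge> 1\<close> by (intro mult_left_mono) auto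
  finally show ?thesis by (simp add: algebra_simps)
next
  case False
  have b2: "1 \<le> \<beta>\<^sup>2" "\<beta> \<le> \<beta>\<^sup>2" using \<open>\<beta> \<ge> 1\<close> self_le_power[of \<beta> 2] one_le_power[of \<beta> 2] by simp_all
  have v8: "8 * \<beta>\<^sup>2 * u \<le> v" using False by simp
  have uv: "u \<le> v"
    using v8 mult_left_mono[OF b2(1), of "u * 8"] nn by (simp add: algebra_simps)
  then have u2: "u\<^sup>2 \<le> v\<^sup>2" using nn by (intro power_mono) auto
  have bu: "\<beta> * u\<^sup>2 * 2 \<le> v\<^sup>2"
  proof -
    have "\<beta> * u\<^sup>2 * 2 = (2 * \<beta> * u) * u" by (simp add: power2_eq_square)
    also have "\<dots> \<le> v * v"
    proof (rule mult_mono)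
      have "2 * \<beta> * u \<le> 8 * \<beta>\<^sup>2 * u" using b2 nn by (intro mult_right_mono) auto
      then show "2 * \<beta> * u \<le> v" using v8 by linarith
    qed (use uv nn in auto)
    finally show ?thesis by (simp add: power2_eq_square)
  qed
  moreover have "0 \<le> y\<^sup>2" by simp
  ultimately have "v\<^sup>2 \<le> 2 * \<beta> * x\<^sup>2" using 2 unfolding distrib_left by linarith
  also have "\<dots> \<le> (2 * \<beta> * x)\<^sup>2"
    using mult_right_mono[of "2 * \<beta>" "4 * \<beta>\<^sup>2" "x\<^sup>2"] b2 \<open>\<beta> \<ge> 1\<close> by (simp add: power_mult_distrib)
  finally have vx: "v \<le> 2 * \<beta> * x" using nn \<open>\<beta> \<ge> 1\<close> by (simp add: power2_le_iff_abs_le)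
  have "y\<^sup>2 \<le> \<beta> * (u\<^sup>2 + v\<^sup>2)" using 1 zero_le_power2[of x] by linarith
  also have "\<dots> \<le> \<beta> * (2 * v\<^sup>2)" using u2 \<open>\<beta> \<ge> 1\<close> by (intro mult_left_mono) auto
  also have "\<dots> \<le> (2 * \<beta> * v)\<^sup>2"
    using mult_right_mono[of "2 * \<beta>" "4 * \<beta>\<^sup>2" "v\<^sup>2"] b2 \<open>\<beta> \<ge> 1\<close> by (simp add: power_mult_distrib)
  finally have yv: "y \<le> 2 * \<beta> * v" using nn \<open>\<beta> \<ge> 1\<close> by (simp add: power2_le_iff_abs_le)
  have "v * v \<le> (2 * \<beta> * x) * v" using vx nn by (intro mult_right_mono) auto
  also have "\<dots> = 2 * \<beta> * (x * v)" by simp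
  also have "\<dots> \<le> 2 * \<beta> * (1 + y * u)" using det \<open>\<beta> \<ge> 1\<close> by (intro mult_left_mono) auto
  also have "\<dots> \<le> 2 * \<beta> * (1 + (2 * \<beta> * v) * u)"
    using yv nn \<open>\<beta> \<ge> 1\<close> by (intro mult_left_mono add_left_mono mult_right_mono) auto
  also have "\<dots> = 2 * \<beta> + v * (4 * \<beta>\<^sup>2 * u)" by (simp add: algebra_simps power2_eq_square)
  also have "\<dots> \<le> 2 * \<beta> + v * (v / 2)" using v8 nn by (intro add_left_mono mult_left_mono) auto
  finally have v2: "v\<^sup>2 \<le> 4 * \<beta>" by (simp add: power2_eq_square)
  have "x\<^sup>2 + y\<^sup>2 + u\<^sup>2 + v\<^sup>2 \<le> (\<beta> + 1) * (u\<^sup>2 + v\<^sup>2)" using 1 by (simp add: algebra_simps)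
  also have "\<dots> \<le> (\<beta> + 1) * (8 * \<beta>)"
    using u2 v2 \<open>\<beta> \<ge> 1\<close> by (intro mult_left_mono) auto
  finally show ?thesis by (simp add: mult_ac)
qed

context discrete_matrix_group
begin

text \<open>Points at fixed hyperbolic distance have comparable heights and a Euclidean distance at
  most a multiple of these heights, so boundedness of one orbit passes to another.\<close>

lemma bounded_orbit_change_base:
  assumes "q \<in> hyp_space" "bounded ((\<lambda>A. mat_act A q) ` G)"
  shows "\<exists>B\<ge>1. \<forall>A\<in>G. norm (mat_act A (0, 1)) \<le> B"
proof -
  obtain b where b: "\<And>A. A \<in> G \<Longrightarrow> norm (mat_act A q) \<le> b"
    using assms(2) by (auto simp: bounded_iff)
  define C where "C = cosh (hyp_dist (0, 1) q)"
  have C: "C \<ge> 1" by (simp add: C_def cosh_real_ge_1)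
  have b0: "b \<ge> 0" using b[OF mat_one_in] norm_ge_zero order_trans by blast
  have "norm (mat_act A (0, 1)) \<le> b + 2 * C * b + 1" if A: "A \<in> G" for A
  proof -
    let ?p = "mat_act A (0, 1)" and ?q = "mat_act A q"
    have h: "?p \<in> hyp_space" "?q \<in> hyp_space" using A assms by auto
    have C': "cosh (hyp_dist ?p ?q) = C"
      using A assms by (simp add: hyp_dist_mat_act det_one C_def)
    have sq: "0 \<le> snd ?q" "snd ?q \<le> b"
      using h b[OF A] norm_snd_le[of "snd ?q" "fst ?q"] by (auto simp: hyp_space_def)
    have sp: "0 \<le> snd ?p" "snd ?p \<le> 2 * C * b"
      using order_trans[OF snd_le_hyp_dist[OF h, unfolded C'] mult_left_mono[OF sq(2), of "2 * C"]] C h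
      by (auto simp: hyp_space_def)
    have "(dist ?p ?q)\<^sup>2 \<le> 2 * snd ?p * snd ?q * C" using dist_le_hyp_dist[OF h] C' by simp
    also have "\<dots> \<le> 2 * (2 * C * b) * b * C" using sq sp C b0 by (intro mult_mono mult_nonneg_nonneg) auto
    also have "\<dots> = (2 * C * b)\<^sup>2" by (simp add: power2_eq_square)
    finally have "dist ?p ?q \<le> 2 * C * b" using C b0 by (simp add: power2_le_iff_abs_le)
    then show ?thesis using b[OF A] norm_triangle_sub[of ?p ?q] by (simp add: dist_norm)
  qed
  moreover have "b + 2 * C * b + 1 \<ge> 1" using b0 C by simp
  ultimately show ?thesis by blast
qed

lemma frob_dominated_by_lower_left:
  assumes "q \<in> hyp_space" "bounded ((\<lambda>A. mat_act A q) ` G)"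
  shows "\<exists>D K. K \<ge> 1 \<and> (\<forall>A\<in>G. frob A \<le> D \<or> frob A \<le> K * (norm (A $ 2 $ 1))\<^sup>2)"
proof -
  obtain B where B: "B \<ge> 1" "\<And>A. A \<in> G \<Longrightarrow> norm (mat_act A (0, 1)) \<le> B"
    using bounded_orbit_change_base[OF assms] by blast
  define \<beta> where "\<beta> = B\<^sup>2"
  have \<beta>: "\<beta> \<ge> 1" using B by (simp add: \<beta>_def)
  \<comment> \<open>The squared Euclidean norm of the orbit point is the quotient of the squared
    norms of the two rows.\<close>
  have row: "(norm (A $ 1 $ 1))\<^sup>2 + (norm (A $ 1 $ 2))\<^sup>2 \<le> \<beta> * ((norm (A $ 2 $ 1))\<^sup>2 + (norm (A $ 2 $ 2))\<^sup>2)"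
    if "A \<in> G" for A
  proof -
    let ?p = "mat_act A (0, 1)"
    have t: "snd ?p > 0" using that act_in[of A "(0,1)"] by (auto simp: hyp_space_def)
    have "(norm (fst ?p))\<^sup>2 + (snd ?p)\<^sup>2 = (norm ?p)\<^sup>2"
      by (simp add: norm_prod_def)
    also have "\<dots> \<le> \<beta>" unfolding \<beta>_def using B that by (intro power_mono) auto
    finally have "((norm (fst ?p))\<^sup>2 + (snd ?p)\<^sup>2) / snd ?p \<le> \<beta> * (1 / snd ?p)"
      using t by (simp add: divide_right_mono)
    then show ?thesis unfolding mat_act_origin[OF det_one[OF that]] .
  qed
  have "frob A \<le> 8 * \<beta> * (\<beta> + 1) \<or> frob A \<le> (\<beta> + 1) * (1 + 64 * \<beta> ^ 4) * (norm (A $ 2 $ 1))\<^sup>2"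
    if A: "A \<in> G" for A
    unfolding frob_def
  proof (rule entries_dominated_by_lower_left)
    have "A $ 1 $ 1 * A $ 2 $ 2 = 1 + A $ 1 $ 2 * A $ 2 $ 1"
      using det_one[OF A] by (simp add: det_2 algebra_simps)
    then have "norm (A $ 1 $ 1) * norm (A $ 2 $ 2) = norm (1 + A $ 1 $ 2 * A $ 2 $ 1)"
      by (metis norm_mult)
    also have "\<dots> \<le> 1 + norm (A $ 1 $ 2) * norm (A $ 2 $ 1)"
      by (metis norm_mult norm_one norm_triangle_ineq)
    finally show "norm (A $ 1 $ 1) * norm (A $ 2 $ 2) \<le> 1 + norm (A $ 1 $ 2) * norm (A $ 2 $ 1)" .
    \<comment> \<open>The inverse lies in the group as well, and its row bound is the column bound
      for A.\<close>
    show "(norm (A $ 2 $ 2))\<^sup>2 + (norm (A $ 1 $ 2))\<^sup>2 \<le> \<beta> * ((norm (A $ 2 $ 1))\<^sup>2 + (norm (A $ 1 $ 1))\<^sup>2)"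
      using row[OF minv_in[OF A]] by simp
  qed (use \<beta> row[OF A] in auto)
  moreover have "(\<beta> + 1) * (1 + 64 * \<beta> ^ 4) \<ge> 1 * 1" using \<beta> by (intro mult_mono) auto
  ultimately show ?thesis by (metis mult_1)
qed

text \<open>If infinity is not a limit point, the disc of radius \<open>\<epsilon> / |c|\<^sup>2\<close> about \<open>A \<infinity> = a / c\<close> is the
  image of a neighbourhood of infinity. Two such discs meet only if \<open>A\<inverse> B\<close> is small, because the
  lower left entry of \<open>A\<inverse> B\<close> is \<open>c c' (a / c - a' / c')\<close>.\<close>

lemma summable_at_dimension_of_bounded_orbit:
  assumes "q \<in> hyp_space" "bounded ((\<lambda>A. mat_act A q) ` G)"
  shows "(\<lambda>A. exp (- real DIM('a) * displacement A)) summable_on G"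
proof -
  let ?c = "\<lambda>A. norm ((A :: 'a ^ 2 ^ 2) $ 2 $ 1)"
  obtain D K where K: "K \<ge> 1" and dom: "\<And>A. A \<in> G \<Longrightarrow> frob A \<le> D \<or> frob A \<le> K * (?c A)\<^sup>2"
    using frob_dominated_by_lower_left[OF assms] by blast
  define L where "L = {A \<in> G. frob A > D}"
  \<comment> \<open>The size 1 / (4 K) makes K * \<epsilon> * 2 < 1, which is what contradicts the
    final chain of inequalities in \<open>key\<close>.\<close>
  define \<epsilon> where "\<epsilon> = 1 / (4 * K)"
  have \<epsilon>: "\<epsilon> > 0" "K * \<epsilon> = 1 / 4" using K by (auto simp: \<epsilon>_def)
  define M where "M = card {A \<in> G. frob A \<le> D}"
  have frob2: "frob A \<ge> 2" if "A \<in> G" for A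
    using that by (simp add: frob_eq_cosh det_one cosh_real_ge_1)
  have cK: "frob A \<le> K * (?c A)\<^sup>2" "?c A > 0" if "A \<in> L" for A
  proof -
    show *: "frob A \<le> K * (?c A)\<^sup>2" using dom[of A] that by (auto simp: L_def)
    show "?c A > 0" using * frob2[of A] that by (cases "A $ 2 $ 1 = 0") (auto simp: L_def)
  qed
  define x where "x A = A $ 1 $ 1 / A $ 2 $ 1" for A :: "'a ^ 2 ^ 2"
  define r where "r A = \<epsilon> / (?c A)\<^sup>2" for A
  have key: "frob (minv A ** B) \<le> D" if "A \<in> L" "B \<in> L" "?c A \<le> ?c B" "dist (x A) (x B) < r A + r B" for A B
  proof (rule ccontr)
    let ?h = "minv A ** B"
    assume "\<not> frob ?h \<le> D"
    moreover have AB: "A \<in> G" "B \<in> G" using that by (auto simp: L_def)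
    ultimately have h: "frob ?h \<le> K * (?c ?h)\<^sup>2" using dom[of ?h] by (auto simp: mult_in minv_in)
    have c0: "A $ 2 $ 1 \<noteq> 0" "B $ 2 $ 1 \<noteq> 0" and cp: "?c A > 0" "?c B > 0" using cK(2) that by auto
    have "?h $ 2 $ 1 = (A $ 2 $ 1 * B $ 2 $ 1) * (x A - x B)"
      using c0 by (simp add: matrix_mul_2_nth x_def field_simps)
    then have "?c ?h = ?c A * ?c B * dist (x A) (x B)" by (simp add: norm_mult dist_norm)
    also have "\<dots> \<le> ?c A * ?c B * (r A + r B)" using that by (intro mult_left_mono) auto
    also have "\<dots> = \<epsilon> * (?c B / ?c A + ?c A / ?c B)"
      using cp by (simp add: r_def field_simps power2_eq_square)
    finally have ch: "?c ?h \<le> \<epsilon> * (?c B / ?c A + ?c A / ?c B)" .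
    \<comment> \<open>If h = A^-1 B were large, its norm would be comparable to its lower left
      entry, which is small since the centres are close. Then B = A h would be smaller than its own
      lower left entry.\<close>
    have "A ** ?h = B" using AB by (simp add: matrix_mul_assoc minv_mult det_one)
    then have "frob B \<le> frob A * frob ?h" using frob_mult_le[of A ?h] by simp
    also have "\<dots> \<le> (K * (?c A)\<^sup>2) * (K * (?c ?h)\<^sup>2)"
      using cK(1)[OF that(1)] h K by (intro mult_mono) (auto simp: frob_nonneg)
    also have "\<dots> = (K * ?c A * ?c ?h)\<^sup>2" by (simp add: power2_eq_square)
    finally have "(?c B)\<^sup>2 \<le> (K * ?c A * ?c ?h)\<^sup>2"
      unfolding frob_def[of B] using zero_le_power2[of "norm (B $ 1 $ 1)"] zero_le_power2[of "norm (B $ 1 $ 2)"]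
        zero_le_power2[of "norm (B $ 2 $ 2)"] by linarith
    then have "?c B \<le> K * ?c A * ?c ?h" using K cp by (simp add: power2_le_iff_abs_le)
    also have "\<dots> \<le> K * ?c A * (\<epsilon> * (?c B / ?c A + ?c A / ?c B))" using ch K cp by (intro mult_left_mono) auto
    also have "\<dots> = (K * \<epsilon>) * (?c B + ?c A * (?c A / ?c B))" using cp by (simp add: field_simps)
    also have "\<dots> \<le> (K * \<epsilon>) * (?c B + ?c B * 1)"
      using that cp K \<epsilon> by (intro mult_left_mono add_left_mono mult_mono) auto
    also have "\<dots> < ?c B" unfolding \<epsilon>(2) using cp by simp
    finally show False by simp
  qed
  \<comment> \<open>The norm of a matrix and of its inverse agree, so A and B may be ordered by the
    size of their lower left entries.\<close>
  have key': "frob (minv A ** B) \<le> D" if "A \<in> L" "B \<in> L" "dist (x A) (x B) < r A + r B" for A B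
  proof (cases "?c A \<le> ?c B")
    case False
    then have "frob (minv B ** A) \<le> D" using that by (intro key) (auto simp: dist_commute)
    moreover have "minv (minv B ** A) = minv A ** B" by (simp add: matrix_2_eq_iff matrix_mul_2_nth)
    ultimately show ?thesis by (metis frob_minv)
  qed (use key that in auto)
  define R where "R = K + \<epsilon> * K"
  have bound: "(\<Sum>A\<in>I. r A ^ DIM('a)) \<le> real M * R ^ DIM('a)" if I: "finite I" "I \<subseteq> L" for I
  proof (rule sum_radius_power_le[where x = x])
    show "R \<ge> 0" using K \<epsilon> by (simp add: R_def)
    show "r A \<ge> 0" if "A \<in> I" for A using \<epsilon> by (simp add: r_def)
    show "ball (x A) (r A) \<subseteq> ball 0 R" if "A \<in> I" for A
    proof -
      have A: "A \<in> L" "A \<in> G" using that I by (auto simp: L_def)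
      have c: "?c A > 0" using cK A by auto
      have "(norm (A $ 1 $ 1))\<^sup>2 \<le> frob A" by (simp add: frob_def)
      also have "\<dots> \<le> K * (?c A)\<^sup>2" using cK A by auto
      also have "\<dots> \<le> (K * ?c A)\<^sup>2" unfolding power_mult_distrib using K self_le_power[of K 2] by (intro mult_right_mono) auto
      finally have "norm (A $ 1 $ 1) \<le> K * ?c A" using K by (simp add: power2_le_iff_abs_le)
      then have x: "norm (x A) \<le> K" using c by (simp add: x_def norm_divide field_simps)
      have "1 \<le> K * (?c A)\<^sup>2" using cK(1)[OF A(1)] frob2[OF A(2)] by simp
      then have "r A \<le> \<epsilon> * K" using c \<epsilon> by (simp add: r_def field_simps)
      then show ?thesis using x by (subst ball_subset_ball_iff) (auto simp: R_def)
    qed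
    show "card {B \<in> I. ball (x A) (r A) \<inter> ball (x B) (r B) \<noteq> {}} \<le> M" if A: "A \<in> I" for A
      unfolding M_def
    proof (rule card_inj_on_le[OF minv_mult_inj[of A]])
      show "A \<in> G" using A I by (auto simp: L_def)
      show "(**) (minv A) ` {B \<in> I. ball (x A) (r A) \<inter> ball (x B) (r B) \<noteq> {}} \<subseteq> {A \<in> G. frob A \<le> D}"
      proof clarsimp
        fix B assume B: "B \<in> I" "ball (x A) (r A) \<inter> ball (x B) (r B) \<noteq> {}"
        then obtain y where "dist (x A) y < r A" "dist (x B) y < r B" by auto
        then have "dist (x A) (x B) < r A + r B" using dist_triangle2[of "x A" "x B" y] by linarith
        moreover have "A \<in> L" "B \<in> L" "A \<in> G" "B \<in> G" using A B I by (auto simp: L_def)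
        ultimately show "minv A ** B \<in> G \<and> frob (minv A ** B) \<le> D"
          using key' by (auto simp: mult_in minv_in)
      qed
    qed (rule finite_frob)
  qed (use I in auto)
  have "(\<lambda>A. exp (- real DIM('a) * displacement A)) summable_on L"
  proof (rule nonneg_bdd_above_summable_on)
    have "sum (\<lambda>A. exp (- real DIM('a) * displacement A)) I \<le> (2 * K / \<epsilon>) ^ DIM('a) * (real M * R ^ DIM('a))"
      if I: "finite I" "I \<subseteq> L" for I
    proof -
      have "exp (- real DIM('a) * displacement A) \<le> (2 / \<epsilon>) ^ DIM('a) * r A ^ DIM('a)" if "A \<in> I" for A
      proof -
        have A: "A \<in> L" "A \<in> G" using that I by (auto simp: L_def)
        have c: "?c A > 0" using cK A by auto
        have "(?c A)\<^sup>2 \<le> frob A" by (simp add: frob_def)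
        also have "\<dots> = 2 * cosh (displacement A)" using A by (simp add: frob_eq_cosh det_one)
        also have "\<dots> \<le> 2 * exp (displacement A)" using displacement_nonneg[OF A(2)] by (simp add: cosh_def)
        finally have "exp (- displacement A) \<le> 2 / \<epsilon> * r A"
          using c \<epsilon> by (simp add: r_def exp_minus field_simps)
        then have "exp (- displacement A) ^ DIM('a) \<le> (2 / \<epsilon> * r A) ^ DIM('a)"
          by (intro power_mono) auto
        then show ?thesis unfolding power_mult_distrib exp_of_nat_mult[symmetric] by simp
      qed
      then have "sum (\<lambda>A. exp (- real DIM('a) * displacement A)) I \<le> (\<Sum>A\<in>I. (2 / \<epsilon>) ^ DIM('a) * r A ^ DIM('a))"
        by (intro sum_mono)
      also have "\<dots> = (2 / \<epsilon>) ^ DIM('a) * (\<Sum>A\<in>I. r A ^ DIM('a))" by (simp add: sum_distrib_left)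
      also have "\<dots> \<le> (2 / \<epsilon>) ^ DIM('a) * (real M * R ^ DIM('a))"
        using \<epsilon> by (intro mult_left_mono bound I) auto
      also have "\<dots> \<le> (2 * K / \<epsilon>) ^ DIM('a) * (real M * R ^ DIM('a))"
        using \<epsilon> K by (intro mult_right_mono power_mono divide_right_mono) (auto simp: R_def)
      finally show ?thesis .
    qed
    then show "bdd_above (sum (\<lambda>A. exp (- real DIM('a) * displacement A)) ` {F. F \<subseteq> L \<and> finite F})"
      by (intro bdd_aboveI[of _ "(2 * K / \<epsilon>) ^ DIM('a) * (real M * R ^ DIM('a))"]) auto
  qed simp
  moreover have "finite (G - L)"
    by (rule finite_subset[OF _ finite_frob[of D]]) (auto simp: L_def)
  ultimately have "(\<lambda>A. exp (- real DIM('a) * displacement A)) summable_on (L \<union> (G - L))"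
    by (intro summable_on_Un_disjoint[OF _ summable_on_finite]) auto
  moreover have "L \<union> (G - L) = G" by (auto simp: L_def)
  ultimately show ?thesis by simp
qed

end

section \<open>Conjugation, and moving a boundary point to infinity\<close>

lemma minv_matrix_mul:
  fixes A B :: "'a::field ^ 2 ^ 2"
  shows "minv (A ** B) = minv B ** minv A"
  by (simp add: matrix_2_eq_iff matrix_mul_2_nth algebra_simps)

lemma conjugate_mult:
  fixes S A B :: "'a::field ^ 2 ^ 2"
  assumes "det S = 1"
  shows "(S ** A ** minv S) ** (S ** B ** minv S) = S ** (A ** B) ** minv S"
proof -
  have "(S ** A ** minv S) ** (S ** B ** minv S) = S ** A ** (minv S ** S) ** B ** minv S"
    by (simp only: matrix_mul_assoc)
  then show ?thesis by (simp add: minv_mult(2)[OF assms] matrix_mul_assoc)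
qed

lemma minv_conjugate:
  fixes S A :: "'a::field ^ 2 ^ 2"
  shows "minv (S ** A ** minv S) = S ** minv A ** minv S"
  by (simp add: minv_matrix_mul matrix_mul_assoc)

lemma conjugate_cancel:
  fixes S A :: "'a::field ^ 2 ^ 2"
  assumes "det S = 1"
  shows "minv S ** (S ** A ** minv S) ** S = A"
proof -
  have "minv S ** (S ** A ** minv S) ** S = (minv S ** S) ** A ** (minv S ** S)"
    by (simp only: matrix_mul_assoc)
  then show ?thesis by (simp add: minv_mult(2)[OF assms])
qed

lemma discrete_matrix_group_conjugate:
  fixes G :: "('a::{real_normed_field,euclidean_space} ^ 2 ^ 2) set"
  assumes "discrete_matrix_group G" "det S = 1"
  shows "discrete_matrix_group ((\<lambda>A. S ** A ** minv S) ` G)"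
proof -
  interpret discrete_matrix_group G by fact
  show ?thesis
  proof
    show "det A = 1" if "A \<in> (\<lambda>A. S ** A ** minv S) ` G" for A
      using that assms(2) by (auto simp: det_mul det_one)
    show "mat 1 \<in> (\<lambda>A. S ** A ** minv S) ` G" using mat_one_in minv_mult(1)[OF assms(2)] by force
    show "A ** B \<in> (\<lambda>A. S ** A ** minv S) ` G"
      if "A \<in> (\<lambda>A. S ** A ** minv S) ` G" "B \<in> (\<lambda>A. S ** A ** minv S) ` G" for A B
      using that by (auto simp: conjugate_mult[OF assms(2)] mult_in)
    show "minv A \<in> (\<lambda>A. S ** A ** minv S) ` G" if "A \<in> (\<lambda>A. S ** A ** minv S) ` G" for A
      using that by (auto simp: minv_conjugate minv_in)
    show "finite {A \<in> (\<lambda>A. S ** A ** minv S) ` G. frob A \<le> r}" for r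
    proof (rule finite_surj[OF finite_frob[of "frob S * r * frob S"]])
      show "{A \<in> (\<lambda>A. S ** A ** minv S) ` G. frob A \<le> r} \<subseteq>
         (\<lambda>A. S ** A ** minv S) ` {A \<in> G. frob A \<le> frob S * r * frob S}"
      proof safe
        fix A assume A: "A \<in> G" "frob (S ** A ** minv S) \<le> r"
        have "frob A = frob (minv S ** (S ** A ** minv S) ** S)" by (simp only: conjugate_cancel[OF assms(2)])
        also have "\<dots> \<le> frob (minv S ** (S ** A ** minv S)) * frob S" by (rule frob_mult_le)
        also have "\<dots> \<le> (frob (minv S) * frob (S ** A ** minv S)) * frob S"
          by (intro mult_right_mono frob_mult_le) (simp add: frob_def)
        also have "\<dots> \<le> frob S * r * frob S"
          using A(2) by (simp add: mult_right_mono mult_left_mono frob_nonneg)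
        finally show "S ** A ** minv S \<in> (\<lambda>A. S ** A ** minv S) ` {A \<in> G. frob A \<le> frob S * r * frob S}"
          using A by blast
      qed
    qed
  qed
qed

lemma (in discrete_matrix_group) summable_at_dimension:
  assumes "bounded ((\<lambda>A. mat_act A (0, 1)) ` G) \<or> (x, 0) \<notin> closure ((\<lambda>A. mat_act A (0, 1)) ` G)"
  shows "(\<lambda>A. exp (- real DIM('a) * displacement A)) summable_on G"
  using assms
proof
  assume "(x, 0) \<notin> closure ((\<lambda>A. mat_act A (0, 1)) ` G)"
  then obtain \<delta> where \<delta>: "\<delta> > 0" "\<And>A. A \<in> G \<Longrightarrow> dist (mat_act A (0, 1)) (x, 0) \<ge> \<delta>"
    unfolding closure_approachable by (auto simp: not_less)
  \<comment> \<open>S is z -> - 1 / (z - x): it sends x to infinity and turns Euclidean distance to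
    (x, 0) into the reciprocal norm, so an orbit avoiding a neighbourhood of (x, 0) becomes bounded.
    The base point becomes S (0, 1), which is why the bounded case allows any q.\<close>
  define S :: "'a ^ 2 ^ 2" where "S = vector [vector [0, - 1], vector [1, - x]]"
  have S: "S $ 1 $ 1 = 0" "S $ 1 $ 2 = - 1" "S $ 2 $ 1 = 1" "S $ 2 $ 2 = - x" by (simp_all add: S_def)
  then have detS: "det S = 1" by (simp add: det_2)
  define c where "c A = S ** A ** minv S" for A
  interpret c: discrete_matrix_group "c ` G"
    unfolding c_def by (rule discrete_matrix_group_conjugate[OF discrete_matrix_group_axioms detS])
  have S_act: "norm (mat_act S p) = 1 / dist p (x, 0)" if "p \<in> hyp_space" for p
  proof -
    obtain z t where p: "p = (z, t)" by force
    define N where "N = (norm (z - x))\<^sup>2 + t\<^sup>2"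
    have N: "N > 0" using that by (simp add: N_def p hyp_space_def add_nonneg_pos)
    have "mat_act S p = (- conjug (z - x) / of_real N, t / N)"
      by (simp add: p mat_act_def Let_def S N_def)
    then have "(norm (mat_act S p))\<^sup>2 = (norm (z - x))\<^sup>2 / N\<^sup>2 + t\<^sup>2 / N\<^sup>2"
      by (simp add: norm_prod_def norm_divide power_divide)
    also have "\<dots> = N / N\<^sup>2" by (simp add: N_def add_divide_distrib)
    also have "\<dots> = 1 / N" using N by (simp add: power2_eq_square)
    also have "N = (dist p (x, 0))\<^sup>2" by (simp add: p dist_prod_def dist_norm N_def)
    finally have "(norm (mat_act S p))\<^sup>2 = (1 / dist p (x, 0))\<^sup>2" by (simp add: power_divide)
    then show ?thesis by (simp add: power2_eq_iff_nonneg)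
  qed
  have q: "mat_act S (0, 1) \<in> hyp_space" by (simp add: mat_act_in_hyp_space detS)
  have "norm (mat_act B (mat_act S (0, 1))) \<le> 1 / \<delta>" if B: "B \<in> c ` G" for B
  proof -
    obtain A where A: "A \<in> G" "B = c A" using B by blast
    have "B ** S = S ** A ** (minv S ** S)" by (simp only: A(2) c_def matrix_mul_assoc)
    then have "B ** S = S ** A" by (simp add: minv_mult detS)
    then have "mat_act B (mat_act S (0, 1)) = mat_act S (mat_act A (0, 1))"
      using A B by (metis mat_act_mult hyp_space_origin c.det_one det_one detS)
    then show ?thesis using \<delta> A(1) by (simp add: S_act divide_simps)
  qed
  then have "bounded ((\<lambda>B. mat_act B (mat_act S (0, 1))) ` c ` G)" by (auto simp: bounded_iff)
  then have "(\<lambda>B. exp (- real DIM('a) * displacement B)) summable_on (c ` G)"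
    by (rule c.summable_at_dimension_of_bounded_orbit[OF q])
  moreover have inj: "inj_on c G"
  proof (rule inj_on_inverseI)
    fix A show "minv S ** c A ** S = A" unfolding c_def by (rule conjugate_cancel[OF detS])
  qed
  ultimately have "(\<lambda>A. exp (- real DIM('a) * displacement (c A))) summable_on G"
    by (simp add: summable_on_reindex o_def)
  \<comment> \<open>Moving the base point back to (0, 1) changes displacements by at most this
    amount, hence the terms by a constant factor.\<close>
  define \<rho> where "\<rho> = 2 * hyp_dist (mat_act (minv S) (0, 1)) (0, 1)"
  have "(\<lambda>A. exp (real DIM('a) * \<rho>) * exp (- real DIM('a) * displacement (c A))) summable_on G"
    by (intro summable_on_cmult_right) fact
  then show ?thesis
  proof (rule summable_on_comparison_test)
    fix A assume A: "A \<in> G"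
    let ?q = "mat_act (minv S) (0, 1)"
    have q: "?q \<in> hyp_space" by (simp add: mat_act_in_hyp_space detS)
    have "mat_act (c A) (0, 1) = mat_act S (mat_act A ?q)"
      using A q by (simp add: c_def mat_act_mult det_mul detS det_one)
    moreover have "mat_act S ?q = (0, 1)" by (simp add: mat_act_minv detS)
    ultimately have "displacement (c A) = hyp_dist (mat_act S (mat_act A ?q)) (mat_act S ?q)" by simp
    also have "\<dots> = hyp_dist (mat_act A ?q) ?q"
      using A q by (intro hyp_dist_mat_act detS) auto
    also have "\<dots> \<le> displacement A + \<rho>"
      unfolding \<rho>_def using A q by (intro hyp_dist_orbit_le) (auto simp: det_one)
    finally have "real DIM('a) * displacement (c A) \<le> real DIM('a) * (displacement A + \<rho>)"
      by (intro mult_left_mono) auto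
    then show "exp (- real DIM('a) * displacement A) \<le> exp (real DIM('a) * \<rho>) * exp (- real DIM('a) * displacement (c A))"
      by (simp add: exp_add[symmetric] algebra_simps)
  qed simp
qed (rule summable_at_dimension_of_bounded_orbit[OF hyp_space_origin])

section \<open>Orbit counting for convex cocompact groups\<close>

context discrete_matrix_group
begin

lemma summable_change_base:
  assumes "p \<in> hyp_space" "q \<in> hyp_space" "s \<ge> 0"
    and "(\<lambda>A. exp (- s * hyp_dist (mat_act A p) p)) summable_on G"
  shows "(\<lambda>A. exp (- s * hyp_dist (mat_act A q) q)) summable_on G"
proof (rule summable_on_comparison_test)
  show "(\<lambda>A. exp (2 * s * hyp_dist p q) * exp (- s * hyp_dist (mat_act A p) p)) summable_on G"
    by (intro summable_on_cmult_right assms)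
  fix A assume "A \<in> G"
  then have "s * hyp_dist (mat_act A p) p \<le> s * (hyp_dist (mat_act A q) q + 2 * hyp_dist p q)"
    using assms by (intro mult_left_mono hyp_dist_orbit_le) (auto simp: det_one)
  then show "exp (- s * hyp_dist (mat_act A q) q) \<le> exp (2 * s * hyp_dist p q) * exp (- s * hyp_dist (mat_act A p) p)"
    by (simp add: exp_add[symmetric] algebra_simps)
qed simp

text \<open>Cut the geodesic from q to A q at distance j. By convexity the cutting point lies in C,
  so some B q is within R of it, and A = B (B^-1 A) splits A into factors of displacement at most j
  + R and k + R.\<close>

lemma card_orbit_submultiplicative:
  assumes C: "hyp_convex C" "q \<in> C" "\<And>A. A \<in> G \<Longrightarrow> mat_act A q \<in> C"
    and R: "\<And>p. p \<in> C \<Longrightarrow> \<exists>A\<in>G. hyp_dist (mat_act A q) p \<le> R"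
    and "0 \<le> j" "0 \<le> k"
  defines "N \<equiv> \<lambda>T. card {A \<in> G. hyp_dist (mat_act A q) q \<le> T}"
  shows "N (j + k) \<le> N (j + R) * N (k + R)"
proof -
  have q: "q \<in> hyp_space" using C by (auto simp: hyp_convex_def)
  let ?S = "\<lambda>T. {A \<in> G. hyp_dist (mat_act A q) q \<le> T}"
  have fin: "finite (?S T)" for T by (rule finite_near[OF q q])
  have "?S (j + k) \<subseteq> (\<lambda>(B, E). B ** E) ` (?S (j + R) \<times> ?S (k + R))"
  proof
    fix A assume "A \<in> ?S (j + k)"
    then have A: "A \<in> G" "hyp_dist (mat_act A q) q \<le> j + k" by auto
    have Aq: "mat_act A q \<in> hyp_space" using A q by auto
    \<comment> \<open>The minimum covers the case that A q is closer than j: the cut is then at A q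
      itself.\<close>
    define x where "x = min j (hyp_dist q (mat_act A q))"
    have x: "0 \<le> x" "x \<le> hyp_dist q (mat_act A q)" using assms hyp_dist_nonneg[OF q Aq] by (auto simp: x_def)
    obtain m where m: "m \<in> geodesic_segment q (mat_act A q)" "hyp_dist q m = x"
      using geodesic_point_exists[OF q Aq x] by blast
    have "m \<in> C" using m C A unfolding hyp_convex_def by blast
    then obtain B where B: "B \<in> G" "hyp_dist (mat_act B q) m \<le> R" using R by blast
    have mh: "m \<in> hyp_space" and mA: "hyp_dist m (mat_act A q) = hyp_dist q (mat_act A q) - x"
      using m by (auto simp: geodesic_segment_def)
    have Bq: "mat_act B q \<in> hyp_space" using B q by auto
    have "hyp_dist (mat_act B q) q \<le> hyp_dist (mat_act B q) m + hyp_dist m q"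
      by (rule hyp_dist_triangle[OF Bq mh q])
    also have "\<dots> \<le> R + j" using B m by (simp add: hyp_dist_commute x_def)
    finally have 1: "B \<in> ?S (j + R)" using B by simp
    have "hyp_dist (mat_act (minv B ** A) q) q = hyp_dist (mat_act A q) (mat_act B q)"
      using A B q by (simp add: hyp_dist_mat_act_minv det_one)
    also have "\<dots> \<le> hyp_dist (mat_act A q) m + hyp_dist m (mat_act B q)"
      by (rule hyp_dist_triangle[OF Aq mh Bq])
    also have "\<dots> \<le> (hyp_dist q (mat_act A q) - x) + R" using mA B by (simp add: hyp_dist_commute)
    also have "\<dots> \<le> k + R" using A(2) \<open>0 \<le> k\<close> by (simp add: x_def hyp_dist_commute min_def)
    finally have 2: "minv B ** A \<in> ?S (k + R)" using A B by (simp add: mult_in minv_in)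
    have "A = B ** (minv B ** A)" using B by (simp add: matrix_mul_assoc minv_mult det_one)
    with 1 2 show "A \<in> (\<lambda>(B, E). B ** E) ` (?S (j + R) \<times> ?S (k + R))" by force
  qed
  then have "card (?S (j + k)) \<le> card (?S (j + R) \<times> ?S (k + R))"
    by (rule surj_card_le[OF finite_cartesian_product[OF fin fin]])
  then show ?thesis by (simp add: N_def card_cartesian_product)
qed

text \<open>Orbit points outside a large finite set F0 contribute almost nothing to the convergent
  series, while each one within T + c contributes at least exp (- a (T + c)). So the count is of
  smaller order than exp (a T).\<close>

lemma exists_card_orbit_less:
  assumes q: "q \<in> hyp_space" and "a > 0"
    and "(\<lambda>A. exp (- a * hyp_dist (mat_act A q) q)) summable_on G"
  shows "\<exists>T>0. real (card {A \<in> G. hyp_dist (mat_act A q) q \<le> T + c}) < exp (a * T)"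
proof -
  let ?D = "\<lambda>A. hyp_dist (mat_act A q) q" and ?f = "\<lambda>A. exp (- a * hyp_dist (mat_act A q) q)"
  \<comment> \<open>Chosen so that, after the shift by c, the points outside F0 number at most a
    quarter of exp (a T). The points of F0 give another quarter once T is large.\<close>
  define \<eta> where "\<eta> = exp (- a * c) / 4"
  have \<eta>: "\<eta> > 0" by (simp add: \<eta>_def)
  obtain l where l: "(?f has_sum l) G" using assms(3) by (auto simp: summable_on_def)
  then have "\<forall>\<^sub>F F in finite_subsets_at_top G. dist (sum ?f F) l < \<eta> / 2"
    using \<eta> unfolding has_sum_def by (intro tendstoD) auto
  then obtain F0 where F0: "finite F0" "F0 \<subseteq> G"
    and "\<forall>F. finite F \<and> F0 \<subseteq> F \<and> F \<subseteq> G \<longrightarrow> dist (sum ?f F) l < \<eta> / 2"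
    unfolding eventually_finite_subsets_at_top by (elim exE conjE)
  then have near: "dist (sum ?f F) l < \<eta> / 2" if "finite F" "F0 \<subseteq> F" "F \<subseteq> G" for F
    using that by presburger
  have "((\<lambda>T. real (card F0) * exp (- a * T)) \<longlongrightarrow> real (card F0) * 0) at_top"
    using \<open>a > 0\<close>
    by (intro tendsto_mult tendsto_const filterlim_compose[OF exp_at_bot])
      (simp add: filterlim_uminus_at_bot filterlim_tendsto_pos_mult_at_top[OF tendsto_const _ filterlim_ident])
  then have "\<forall>\<^sub>F T in at_top. real (card F0) * exp (- a * T) < 1 / 4"
    by (rule order_tendstoD) simp
  then have "\<forall>\<^sub>F T in at_top. T > 0 \<and> real (card F0) * exp (- a * T) < 1 / 4"
    by (intro eventually_conj eventually_gt_at_top)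
  then obtain T where T: "T > 0" "real (card F0) * exp (- a * T) < 1 / 4"
    unfolding eventually_at_top_linorder by (meson order_refl)
  let ?S = "{A \<in> G. ?D A \<le> T + c}"
  have fin: "finite ?S" by (rule finite_near[OF q q])
  have "real (card (?S - F0)) * exp (- a * (T + c)) = (\<Sum>A\<in>?S - F0. exp (- a * (T + c)))" by simp
  also have "\<dots> \<le> sum ?f (?S - F0)" using \<open>a > 0\<close> by (intro sum_mono) auto
  also have "\<dots> = sum ?f (F0 \<union> ?S) - sum ?f F0"
    using sum.subset_diff[of F0 "F0 \<union> ?S" ?f] fin F0(1) by (simp add: Un_Diff)
  also have "\<dots> < \<eta>"
  proof -
    have "dist (sum ?f F0) l < \<eta> / 2" using F0 by (intro near) auto
    moreover have "dist (sum ?f (F0 \<union> ?S)) l < \<eta> / 2" using F0 fin by (intro near) auto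
    ultimately show ?thesis unfolding dist_real_def by linarith
  qed
  finally have "real (card (?S - F0)) * exp (- a * (T + c)) * exp (a * (T + c)) \<le> \<eta> * exp (a * (T + c))"
    by (intro mult_right_mono) auto
  then have "real (card (?S - F0)) \<le> \<eta> * exp (a * (T + c))"
    by (simp add: mult.assoc exp_add[symmetric])
  also have "\<dots> = exp (a * T) / 4" by (simp add: \<eta>_def exp_add[symmetric] algebra_simps)
  finally have 1: "real (card (?S - F0)) \<le> exp (a * T) / 4" .
  have "real (card F0) * exp (- a * T) * exp (a * T) \<le> 1 / 4 * exp (a * T)"
    using T by (intro mult_right_mono) auto
  then have 2: "real (card F0) \<le> exp (a * T) / 4" by (simp add: mult.assoc exp_add[symmetric])
  have "card ?S \<le> card (F0 \<union> (?S - F0))" using F0 fin by (intro card_mono) auto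
  also have "\<dots> \<le> card F0 + card (?S - F0)" by (rule card_Un_le)
  finally have "real (card ?S) \<le> exp (a * T) / 2" using 1 2 by linarith
  also have "\<dots> < exp (a * T)" by simp
  finally show ?thesis using T by blast
qed

lemma summable_below_of_cocompact_convex:
  assumes C: "hyp_convex C" "q \<in> C" "\<And>A. A \<in> G \<Longrightarrow> mat_act A q \<in> C"
    and R: "\<And>p. p \<in> C \<Longrightarrow> \<exists>A\<in>G. hyp_dist (mat_act A q) p \<le> R"
    and "a > 0" and sum: "(\<lambda>A. exp (- a * displacement A)) summable_on G"
  shows "\<exists>s. 0 < s \<and> s < a \<and> (\<lambda>A. exp (- s * displacement A)) summable_on G"
proof -
  let ?D = "\<lambda>A. hyp_dist (mat_act A q) q"
  define N where "N T = card {A \<in> G. ?D A \<le> T}" for T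
  have q: "q \<in> hyp_space" using C by (auto simp: hyp_convex_def)
  have fin: "finite {A \<in> G. ?D A \<le> T}" for T by (rule finite_near[OF q q])
  have N_mono: "N T \<le> N T'" if "T \<le> T'" for T T'
    unfolding N_def using that by (intro card_mono fin) auto
  have R0: "R \<ge> 0"
  proof -
    obtain A where "A \<in> G" "hyp_dist (mat_act A q) q \<le> R" using R C by blast
    moreover have "hyp_dist (mat_act A q) q \<ge> 0" using \<open>A \<in> G\<close> q by (intro hyp_dist_nonneg) auto
    ultimately show ?thesis by linarith
  qed
  have sub: "N (j + k) \<le> N (j + R) * N (k + R)" if "0 \<le> j" "0 \<le> k" for j k
    unfolding N_def by (rule card_orbit_submultiplicative[OF C R that])
  have "(\<lambda>A. exp (- a * ?D A)) summable_on G"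
    using summable_change_base[OF hyp_space_origin q _ sum] \<open>a > 0\<close> by simp
  then obtain T where T: "T > 0" "real (N (T + 2 * R)) < exp (a * T)"
    using exists_card_orbit_less[OF q \<open>a > 0\<close>, of "2 * R"] by (auto simp: N_def)
  \<comment> \<open>The slack 2 R reproduces itself: split at T + R and (m + 1) T + R, and each part
    gains one more R.\<close>
  have pow: "N (real (Suc m) * T + 2 * R) \<le> N (T + 2 * R) ^ Suc m" for m
  proof (induction m)
    case (Suc m)
    have "N (real (Suc (Suc m)) * T + 2 * R) = N ((T + R) + (real (Suc m) * T + R))"
      by (simp add: algebra_simps)
    also have "\<dots> \<le> N (T + R + R) * N (real (Suc m) * T + R + R)"
      using T R0 by (intro sub) auto
    also have "\<dots> \<le> N (T + 2 * R) * N (T + 2 * R) ^ Suc m"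
      using Suc by (simp add: algebra_simps)
    finally show ?case by simp
  qed simp
  have "mat 1 \<in> {A \<in> G. ?D A \<le> T + 2 * R}"
    using mat_one_in q T R0 by (simp add: mat_act_one hyp_dist_def)
  then have "{A \<in> G. ?D A \<le> T + 2 * R} \<noteq> {}" by (rule ex_in_conv[THEN iffD1, OF exI])
  then have N1: "N (T + 2 * R) \<ge> 1"
    using fin[of "T + 2 * R"] by (simp only: N_def Suc_le_eq One_nat_def card_gt_0_iff simp_thms)
  \<comment> \<open>The growth rate at scale T. The strict count at this single scale makes it
    smaller than a, and \<open>pow\<close> makes it a bound at all scales.\<close>
  define b where "b = ln (real (N (T + 2 * R))) / T"
  have b: "b \<ge> 0" "b < a" "real (N (T + 2 * R)) = exp (b * T)"
  proof -
    show "b \<ge> 0" using N1 T by (simp add: b_def)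
    show *: "real (N (T + 2 * R)) = exp (b * T)" using N1 T by (simp add: b_def)
    show "b < a" using T unfolding * by simp
  qed
  have count: "real (N (real k + 1)) \<le> exp (b * (2 * T + 1)) * exp (b * real k)" for k :: nat
  proof -
    define m where "m = nat \<lceil>(real k + 1) / T\<rceil>"
    have "(real k + 1) / T \<le> real m" by (simp add: m_def real_nat_ceiling_ge)
    then have "real k + 1 \<le> real m * T" using T by (simp add: field_simps)
    also have "\<dots> \<le> real (Suc m) * T + 2 * R" using T R0 by (simp add: algebra_simps)
    finally have "N (real k + 1) \<le> N (T + 2 * R) ^ Suc m" using pow[of m] N_mono order_trans by blast
    then have "real (N (real k + 1)) \<le> real (N (T + 2 * R)) ^ Suc m"
      by (metis of_nat_le_iff of_nat_power)
    also have "\<dots> = exp (b * (real (Suc m) * T))"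
      unfolding b(3) exp_of_nat_mult[symmetric] by (simp only: mult_ac)
    also have "\<dots> \<le> exp (b * ((2 * T + 1) + real k))"
    proof -
      have "0 \<le> (real k + 1) / T" using T by simp
      then have "0 \<le> \<lceil>(real k + 1) / T\<rceil>" by linarith
      then have "real m = of_int \<lceil>(real k + 1) / T\<rceil>" unfolding m_def by (rule of_nat_nat)
      then have "real m \<le> (real k + 1) / T + 1" by linarith
      then have "real (Suc m) * T \<le> ((real k + 1) / T + 2) * T" using T by (intro mult_right_mono) auto
      also have "\<dots> = (2 * T + 1) + real k" using T by (simp add: field_simps)
      finally show ?thesis using b by (simp add: mult_left_mono)
    qed
    finally show ?thesis by (simp add: exp_add distrib_left)
  qed
  define s where "s = (a + b) / 2"
  have s: "0 < s" "s < a" "b < s" using b \<open>a > 0\<close> by (auto simp: s_def)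
  have "(\<lambda>A. exp (- s * ?D A)) summable_on G"
  proof (rule summable_exp_of_shell_bound[OF _ _ _ s(3)])
    show "?D A \<ge> 0" if "A \<in> G" for A using that q by (intro hyp_dist_nonneg) auto
    show "finite {A \<in> G. real k \<le> ?D A \<and> ?D A < real k + 1}" for k :: nat
      by (rule finite_subset[OF _ fin[of "real k + 1"]]) auto
    have "card {A \<in> G. real k \<le> ?D A \<and> ?D A < real k + 1} \<le> N (real k + 1)" for k :: nat
      unfolding N_def by (intro card_mono fin) auto
    then show "real (card {A \<in> G. real k \<le> ?D A \<and> ?D A < real k + 1}) \<le> exp (b * (2 * T + 1)) * exp (b * real k)" for k :: nat
      using count[of k] by (meson of_nat_le_iff order_trans)
  qed
  then have "(\<lambda>A. exp (- s * displacement A)) summable_on G"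
    using summable_change_base[OF q hyp_space_origin] s by simp
  with s show ?thesis by blast
qed

end

section \<open>A common cocompact group of the plane and of space\<close>

definition upper :: "'a::field \<Rightarrow> 'a \<Rightarrow> 'a ^ 2 ^ 2" where
  "upper a b = vector [vector [a, b], vector [0, inverse a]]"

lemma upper_nth [simp]:
  "upper a b $ 1 $ 1 = a" "upper a b $ 1 $ 2 = b" "upper a b $ 2 $ 1 = 0" "upper a b $ 2 $ 2 = inverse a"
  by (simp_all add: upper_def)

lemma det_upper: "a \<noteq> 0 \<Longrightarrow> det (upper a b) = 1"
  by (simp add: det_2)

lemma upper_mult: "upper a b ** upper a' b' = upper (a * a') (a * b' + b * inverse a')"
  by (simp add: matrix_2_eq_iff matrix_mul_2_nth)

lemma minv_upper: "minv (upper a 0) = upper (inverse a) 0"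
  by (simp add: matrix_2_eq_iff)

text \<open>The condition says that A fixes infinity or the boundary point z.\<close>

lemma triangularizable:
  fixes A :: "'a::field ^ 2 ^ 2"
  assumes det: "det A = 1"
    and fixpt: "A $ 2 $ 1 = 0 \<or> (\<exists>z. A $ 2 $ 1 * z\<^sup>2 + (A $ 2 $ 2 - A $ 1 $ 1) * z - A $ 1 $ 2 = 0)"
  shows "\<exists>S a b. det S = 1 \<and> a \<noteq> 0 \<and> A = S ** upper a b ** minv S"
  using fixpt
proof
  assume c: "A $ 2 $ 1 = 0"
  then have ad: "A $ 1 $ 1 * A $ 2 $ 2 = 1" using det by (simp add: det_2)
  then have a: "A $ 1 $ 1 \<noteq> 0" "A $ 2 $ 2 = inverse (A $ 1 $ 1)"
    by (auto simp: inverse_unique)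
  have m1: "minv (mat 1) = (mat 1 :: 'a ^ 2 ^ 2)" by (simp add: matrix_2_eq_iff mat_def)
  have "A = mat 1 ** upper (A $ 1 $ 1) (A $ 1 $ 2) ** minv (mat 1)"
    unfolding m1 matrix_mul_lid matrix_mul_rid using a c by (simp add: matrix_2_eq_iff)
  with a show ?thesis by (metis det_I)
next
  assume "\<exists>z. A $ 2 $ 1 * z\<^sup>2 + (A $ 2 $ 2 - A $ 1 $ 1) * z - A $ 1 $ 2 = 0"
  then obtain z where z: "A $ 2 $ 1 * z\<^sup>2 + (A $ 2 $ 2 - A $ 1 $ 1) * z - A $ 1 $ 2 = 0" by blast
  \<comment> \<open>S sends infinity to z, so the conjugate of A by its inverse fixes infinity and
    is upper triangular.\<close>
  define S :: "'a ^ 2 ^ 2" where "S = vector [vector [z, - 1], vector [1, 0]]"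
  have S: "S $ 1 $ 1 = z" "S $ 1 $ 2 = - 1" "S $ 2 $ 1 = 1" "S $ 2 $ 2 = 0" by (simp_all add: S_def)
  then have detS: "det S = 1" by (simp add: det_2)
  define U where "U = minv S ** A ** S"
  have U21: "U $ 2 $ 1 = 0"
    using z by (simp add: U_def matrix_mul_2_nth S power2_eq_square algebra_simps)
  have "det U = 1" using det detS by (simp add: U_def det_mul)
  then have "U $ 1 $ 1 * U $ 2 $ 2 = 1" using U21 by (simp add: det_2)
  then have a: "U $ 1 $ 1 \<noteq> 0" "U $ 2 $ 2 = inverse (U $ 1 $ 1)" by (auto simp: inverse_unique)
  have U: "U = upper (U $ 1 $ 1) (U $ 1 $ 2)" using U21 a by (simp add: matrix_2_eq_iff)
  have "S ** U ** minv S = (S ** minv S) ** A ** (S ** minv S)" by (simp only: U_def matrix_mul_assoc)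
  then have "A = S ** U ** minv S" by (simp add: minv_mult detS)
  then have "A = S ** upper (U $ 1 $ 1) (U $ 1 $ 2) ** minv S" using U by metis
  with detS a show ?thesis by blast
qed

lemma diagonalizable_of_triangular:
  fixes a :: "'a::real_normed_field"
  assumes "norm a \<noteq> 1" "a \<noteq> 0" "det S = 1"
  shows "\<exists>T. det T = 1 \<and> S ** upper a b ** minv S = T ** upper a 0 ** minv T"
proof -
  have ne: "a - inverse a \<noteq> 0"
  proof
    assume "a - inverse a = 0"
    then have "a * a = 1" using assms by (simp add: field_simps)
    then have "norm a * norm a = 1" by (metis norm_mult norm_one)
    then have "(norm a - 1) * (norm a + 1) = 0" by (simp add: algebra_simps)
    then show False using assms norm_ge_zero[of a] by auto
  qed
  \<comment> \<open>The other fixed point b / (1/a - a) of the triangular matrix; N translates it to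
    0.\<close>
  define s where "s = - b / (a - inverse a)"
  have "s * (a - inverse a) = - b" using ne by (simp add: s_def)
  then have s: "b = s * inverse a - a * s" by (simp add: algebra_simps)
  define N :: "'a ^ 2 ^ 2" where "N = vector [vector [1, s], vector [0, 1]]"
  have N: "N $ 1 $ 1 = 1" "N $ 1 $ 2 = s" "N $ 2 $ 1 = 0" "N $ 2 $ 2 = 1" by (simp_all add: N_def)
  have "upper a b = N ** upper a 0 ** minv N"
    by (simp add: matrix_2_eq_iff matrix_mul_2_nth N s algebra_simps)
  then have "S ** upper a b ** minv S = (S ** N) ** upper a 0 ** minv (S ** N)"
    by (simp add: minv_matrix_mul matrix_mul_assoc)
  moreover have "det (S ** N) = 1"
  proof -
    have "det N = 1" by (simp add: det_2 N)
    with assms show ?thesis by (simp add: det_mul)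
  qed
  ultimately show ?thesis by blast
qed

lemma mat_act_diag:
  fixes \<nu> :: "'a::{real_normed_field,euclidean_space}"
  assumes "\<nu> \<noteq> 0"
  shows "norm (fst (mat_act (upper \<nu> 0) p)) = (norm \<nu>)\<^sup>2 * norm (fst p)"
    and "snd (mat_act (upper \<nu> 0) p) = (norm \<nu>)\<^sup>2 * snd p"
proof -
  obtain z t where p: "p = (z, t)" by force
  have "norm (\<nu> * z * conjug (inverse \<nu>) / of_real ((norm (inverse \<nu>))\<^sup>2)) = (norm \<nu>)\<^sup>2 * norm z"
    using assms by (simp add: norm_mult norm_divide norm_inverse power2_eq_square field_simps)
  then show "norm (fst (mat_act (upper \<nu> 0) p)) = (norm \<nu>)\<^sup>2 * norm (fst p)"
    by (simp add: p mat_act_def Let_def)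
  show "snd (mat_act (upper \<nu> 0) p) = (norm \<nu>)\<^sup>2 * snd p"
    by (simp add: p mat_act_def Let_def norm_inverse divide_inverse power_inverse)
qed

fun matrix_power :: "'a::semiring_1 ^ 2 ^ 2 \<Rightarrow> nat \<Rightarrow> 'a ^ 2 ^ 2" where
  "matrix_power A 0 = mat 1"
| "matrix_power A (Suc n) = A ** matrix_power A n"

lemma matrix_power_conjugate:
  fixes A S :: "'a::field ^ 2 ^ 2"
  assumes "det S = 1"
  shows "matrix_power (S ** A ** minv S) n = S ** matrix_power A n ** minv S"
  by (induction n) (simp_all add: assms minv_mult conjugate_mult)

lemma matrix_power_upper: "\<exists>b'. matrix_power (upper a b) n = upper (a ^ n) b'"
proof (induction n)
  case 0
  have "mat 1 = upper 1 (0 :: 'a)" by (simp add: matrix_2_eq_iff mat_def)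
  then show ?case by auto
next
  case (Suc n)
  then show ?case by (auto simp: upper_mult)
qed

lemma matrix_power_diag: "matrix_power (upper a 0) n = upper (a ^ n) 0"
proof (induction n)
  case 0
  show ?case by (simp add: matrix_2_eq_iff mat_def)
qed (simp add: upper_mult)

lemma matrix_power_diag_conjugate_inj:
  fixes \<nu> :: "'a::real_normed_field"
  assumes "norm \<nu> \<noteq> 1" "\<nu> \<noteq> 0" "det S = 1"
    and "matrix_power (S ** upper \<nu> 0 ** minv S) i = matrix_power (S ** upper \<nu> 0 ** minv S) j"
  shows "i = j"
proof -
  have "S ** upper (\<nu> ^ i) 0 ** minv S = S ** upper (\<nu> ^ j) 0 ** minv S"
    using assms by (simp add: matrix_power_conjugate matrix_power_diag)
  then have "minv S ** (S ** upper (\<nu> ^ i) 0 ** minv S) ** S = minv S ** (S ** upper (\<nu> ^ j) 0 ** minv S) ** S"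
    by simp
  then have "upper (\<nu> ^ i) 0 $ 1 $ 1 = upper (\<nu> ^ j) 0 $ 1 $ 1"
    by (simp only: conjugate_cancel[OF assms(3)])
  then have "norm \<nu> ^ i = norm \<nu> ^ j" by (metis upper_nth(1) norm_power)
  moreover have "norm \<nu> > 0" using assms by simp
  ultimately have "real i * ln (norm \<nu>) = real j * ln (norm \<nu>)" by (metis ln_realpow)
  moreover have "ln (norm \<nu>) \<noteq> 0" using assms \<open>norm \<nu> > 0\<close> by simp
  ultimately show ?thesis by simp
qed

text \<open>The lift of the graph of an isomorphism between discrete groups. Each projection is
  proper; keeping a symmetric relation instead of a map lets every statement be used in both
  directions through \<open>swapped\<close>.\<close>

locale matrix_pair_group =
  fixes P :: "(('a::{real_normed_field,euclidean_space} ^ 2 ^ 2) \<times> ('b::{real_normed_field,euclidean_space} ^ 2 ^ 2)) set"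
  assumes det_one1: "(A, B) \<in> P \<Longrightarrow> det A = 1"
    and det_one2: "(A, B) \<in> P \<Longrightarrow> det B = 1"
    and pair_mult: "(A, B) \<in> P \<Longrightarrow> (A', B') \<in> P \<Longrightarrow> (A ** A', B ** B') \<in> P"
    and pair_one: "(mat 1, mat 1) \<in> P"
    and pair_minv: "(A, B) \<in> P \<Longrightarrow> (minv A, minv B) \<in> P"
    and finite1: "finite {(A, B) \<in> P. frob A \<le> r}"
    and finite2: "finite {(A, B) \<in> P. frob B \<le> r}"
begin

lemma swapped: "matrix_pair_group (prod.swap ` P)"
proof
  show "finite {(A, B) \<in> prod.swap ` P. frob A \<le> r}" for r
    by (rule finite_surj[OF finite2[of r], of _ prod.swap]) auto
  show "finite {(A, B) \<in> prod.swap ` P. frob B \<le> r}" for r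
    by (rule finite_surj[OF finite1[of r], of _ prod.swap]) auto
qed (auto intro: det_one1 det_one2 pair_mult pair_one pair_minv)

lemma pair_power: "(A, B) \<in> P \<Longrightarrow> (matrix_power A n, matrix_power B n) \<in> P"
  by (induction n) (auto intro: pair_mult pair_one)

lemma axis_normalization:
  assumes S: "det S1 = 1" "det S2 = 1" and \<nu>: "\<nu>1 \<noteq> 0" "\<nu>2 \<noteq> 0" "norm \<nu>1 \<noteq> 1"
    and mem: "(S1 ** upper \<nu>1 0 ** minv S1, S2 ** upper \<nu>2 0 ** minv S2) \<in> P" and "t > 0"
  shows "\<exists>\<mu>1 \<mu>2. \<mu>1 \<noteq> 0 \<and> \<mu>2 \<noteq> 0 \<and> (S1 ** upper \<mu>1 0 ** minv S1, S2 ** upper \<mu>2 0 ** minv S2) \<in> P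
    \<and> \<bar>ln ((norm \<mu>1)\<^sup>2 * t)\<bar> \<le> \<bar>ln ((norm \<nu>1)\<^sup>2)\<bar>"
proof -
  define l where "l = ln ((norm \<nu>1)\<^sup>2)"
  have n0: "norm \<nu>1 > 0" using \<nu> by simp
  have l: "l \<noteq> 0" using \<nu> n0 by (simp add: l_def ln_realpow)
  \<comment> \<open>The k-th power multiplies heights by exp (k * l), so this k brings the height t
    to within one period of 1. Negative k is realized by inverses.\<close>
  define k where "k = \<lfloor>- ln t / l\<rfloor>"
  have "\<bar>of_int k + ln t / l\<bar> \<le> 1" unfolding k_def by linarith
  then have "\<bar>of_int k + ln t / l\<bar> * \<bar>l\<bar> \<le> 1 * \<bar>l\<bar>" by (intro mult_right_mono) auto
  then have kl: "\<bar>of_int k * l + ln t\<bar> \<le> \<bar>l\<bar>"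
    using l by (simp add: abs_mult[symmetric] distrib_right)
  have pow: "(S1 ** upper (\<nu>1 ^ n) 0 ** minv S1, S2 ** upper (\<nu>2 ^ n) 0 ** minv S2) \<in> P" for n
    using pair_power[OF mem, of n] S by (simp add: matrix_power_conjugate matrix_power_diag)
  have pow': "(S1 ** upper (inverse (\<nu>1 ^ n)) 0 ** minv S1, S2 ** upper (inverse (\<nu>2 ^ n)) 0 ** minv S2) \<in> P" for n
    using pair_minv[OF pow[of n]] by (simp add: minv_conjugate minv_upper)
  have len: "ln ((norm (\<nu>1 ^ n))\<^sup>2) = real n * l" for n
    using n0 by (simp add: l_def ln_realpow norm_power)
  show ?thesis
  proof (cases "k \<ge> 0")
    case True
    define n where "n = nat k"
    have "ln ((norm (\<nu>1 ^ n))\<^sup>2 * t) = of_int k * l + ln t"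
      using \<open>t > 0\<close> \<nu> True by (simp add: ln_mult len n_def del: norm_power)
    then show ?thesis using pow[of n] \<nu> kl unfolding l_def[symmetric]
      by (intro exI[of _ "\<nu>1 ^ n"] exI[of _ "\<nu>2 ^ n"]) auto
  next
    case False
    define n where "n = nat (- k)"
    have "(norm (inverse (\<nu>1 ^ n)))\<^sup>2 = inverse ((norm (\<nu>1 ^ n))\<^sup>2)" by (simp add: norm_inverse power_inverse)
    then have "ln ((norm (inverse (\<nu>1 ^ n)))\<^sup>2 * t) = - (real n * l) + ln t"
      using \<open>t > 0\<close> \<nu> len[of n] by (simp add: ln_mult ln_inverse del: norm_power)
    also have "- (real n * l) = of_int k * l" using False by (simp add: n_def)
    finally have "\<bar>ln ((norm (inverse (\<nu>1 ^ n)))\<^sup>2 * t)\<bar> \<le> \<bar>l\<bar>" using kl by simp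
    then show ?thesis using pow'[of n] \<nu> unfolding l_def[symmetric]
      by (intro exI[of _ "inverse (\<nu>1 ^ n)"] exI[of _ "inverse (\<nu>2 ^ n)"]) auto
  qed
qed

text \<open>For a point \<open>(z, t)\<close> the ratio \<open>|z| / t\<close> measures its distance from the geodesic from \<open>0\<close> to
  \<open>\<infinity>\<close>. The element generating the translations along this axis moves every point into a
  bounded range of heights without changing the ratio, and there are finitely many orbit points
  of bounded ratio in that range.\<close>

lemma axis_distance_transfer:
  assumes S: "det S1 = 1" "det S2 = 1" and \<nu>: "\<nu>1 \<noteq> 0" "\<nu>2 \<noteq> 0" "norm \<nu>1 \<noteq> 1"
    and mem: "(S1 ** upper \<nu>1 0 ** minv S1, S2 ** upper \<nu>2 0 ** minv S2) \<in> P"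
  defines "ratio1 \<equiv> \<lambda>A. norm (fst (mat_act (minv S1 ** A) (0, 1))) / snd (mat_act (minv S1 ** A) (0, 1))"
    and "ratio2 \<equiv> \<lambda>B. norm (fst (mat_act (minv S2 ** B) (0, 1))) / snd (mat_act (minv S2 ** B) (0, 1))"
  shows "\<exists>M'. \<forall>(A, B) \<in> P. ratio1 A \<le> M \<longrightarrow> ratio2 B \<le> M'"
proof -
  define L where "L = \<bar>ln ((norm \<nu>1)\<^sup>2)\<bar>"
  \<comment> \<open>A point of ratio at most M and height between exp (- L) and exp L has this
    bounded norm; the factor \<open>frob S1\<close> undoes the change of coordinates.\<close>
  define F where "F = frob S1 * ((M\<^sup>2 + 1) * exp L + exp L)"
  have finF: "finite {(A, B) \<in> P. frob A \<le> F}" by (rule finite1)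
  \<comment> \<open>The inserted 0 keeps the maximum meaningful if no pair qualifies.\<close>
  define M' where "M' = Max (insert 0 ((\<lambda>(A, B). ratio2 B) ` {(A, B) \<in> P. frob A \<le> F}))"
  have "ratio2 B \<le> M'" if AB: "(A, B) \<in> P" and r: "ratio1 A \<le> M" for A B
  proof -
    let ?f = "\<lambda>A. mat_act (minv S1 ** A) (0, 1)"
    note d = det_one1[OF AB] det_one2[OF AB]
    have fh: "?f A \<in> hyp_space" using d S by (intro mat_act_in_hyp_space) (simp_all add: det_mul)
    then have t: "snd (?f A) > 0" by (auto simp: hyp_space_def)
    obtain \<mu>1 \<mu>2 where \<mu>: "\<mu>1 \<noteq> 0" "\<mu>2 \<noteq> 0"
      and E: "(S1 ** upper \<mu>1 0 ** minv S1, S2 ** upper \<mu>2 0 ** minv S2) \<in> P"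
      and bd: "\<bar>ln ((norm \<mu>1)\<^sup>2 * snd (?f A))\<bar> \<le> L"
      using axis_normalization[OF S \<nu> mem t] unfolding L_def by blast
    define E1 E2 where "E1 = S1 ** upper \<mu>1 0 ** minv S1" and "E2 = S2 ** upper \<mu>2 0 ** minv S2"
    have E12: "(E1 ** A, E2 ** B) \<in> P" using pair_mult[OF E AB] by (simp add: E1_def E2_def)
    have cancel: "minv S1 ** (E1 ** A) = upper \<mu>1 0 ** (minv S1 ** A)" "minv S2 ** (E2 ** B) = upper \<mu>2 0 ** (minv S2 ** B)"
    proof -
      have "minv S1 ** (E1 ** A) = (minv S1 ** S1) ** upper \<mu>1 0 ** (minv S1 ** A)"
        by (simp only: E1_def matrix_mul_assoc)
      then show "minv S1 ** (E1 ** A) = upper \<mu>1 0 ** (minv S1 ** A)" by (simp add: minv_mult S)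
      have "minv S2 ** (E2 ** B) = (minv S2 ** S2) ** upper \<mu>2 0 ** (minv S2 ** B)"
        by (simp only: E2_def matrix_mul_assoc)
      then show "minv S2 ** (E2 ** B) = upper \<mu>2 0 ** (minv S2 ** B)" by (simp add: minv_mult S)
    qed
    have act1: "?f (E1 ** A) = mat_act (upper \<mu>1 0) (?f A)"
      unfolding cancel using d S \<mu> by (intro mat_act_mult det_upper) (simp_all add: det_mul)
    have act2: "mat_act (minv S2 ** (E2 ** B)) (0, 1) = mat_act (upper \<mu>2 0) (mat_act (minv S2 ** B) (0, 1))"
      unfolding cancel using d S \<mu> by (intro mat_act_mult det_upper) (simp_all add: det_mul)
    have r1: "ratio1 (E1 ** A) = ratio1 A" unfolding ratio1_def act1 mat_act_diag[OF \<mu>(1)] using \<mu> by simp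
    have r2: "ratio2 (E2 ** B) = ratio2 B" unfolding ratio2_def act2 mat_act_diag[OF \<mu>(2)] using \<mu> by simp
    define t' where "t' = snd (?f (E1 ** A))"
    have t': "t' > 0" "\<bar>ln t'\<bar> \<le> L" using bd t \<mu> unfolding t'_def act1 mat_act_diag[OF \<mu>(1)] by auto
    then have "ln t' \<le> L" "- ln t' \<le> L" by auto
    then have "exp (ln t') \<le> exp L" "exp (- ln t') \<le> exp L" by (simp_all only: exp_le_cancel_iff)
    then have te: "t' \<le> exp L" "1 / t' \<le> exp L" using t' by (simp_all add: exp_minus divide_inverse)
    have "norm (fst (?f (E1 ** A))) / t' \<le> M" using r r1 by (simp add: ratio1_def t'_def)
    then have "norm (fst (?f (E1 ** A))) \<le> M * t'" using t' by (simp add: field_simps)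
    then have z: "(norm (fst (?f (E1 ** A))))\<^sup>2 \<le> (M * t')\<^sup>2" by (intro power_mono) auto
    have det: "det (minv S1 ** (E1 ** A)) = 1" using det_one1[OF E12] S by (simp add: det_mul)
    have "frob (minv S1 ** (E1 ** A)) = ((norm (fst (?f (E1 ** A))))\<^sup>2 + t'\<^sup>2) / t' + 1 / t'"
      unfolding t'_def mat_act_origin[OF det] by (simp add: frob_def)
    also have "\<dots> \<le> ((M * t')\<^sup>2 + t'\<^sup>2) / t' + 1 / t'" using z t' by (intro add_mono divide_right_mono) auto
    also have "\<dots> = (M\<^sup>2 + 1) * t' + 1 / t'" using t' by (simp add: field_simps power2_eq_square)
    also have "\<dots> \<le> (M\<^sup>2 + 1) * exp L + exp L" using te by (intro add_mono mult_left_mono) auto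
    finally have f: "frob (minv S1 ** (E1 ** A)) \<le> (M\<^sup>2 + 1) * exp L + exp L" .
    have "E1 ** A = S1 ** (minv S1 ** (E1 ** A))" by (simp add: matrix_mul_assoc minv_mult S)
    then have "frob (E1 ** A) \<le> frob S1 * frob (minv S1 ** (E1 ** A))" by (metis frob_mult_le)
    also have "\<dots> \<le> F" unfolding F_def using f by (intro mult_left_mono frob_nonneg)
    finally have "(E1 ** A, E2 ** B) \<in> {(A, B) \<in> P. frob A \<le> F}" using E12 by simp
    then have "ratio2 (E2 ** B) \<in> (\<lambda>(A, B). ratio2 B) ` {(A, B) \<in> P. frob A \<le> F}" by force
    then show ?thesis unfolding M'_def r2 using finF by (intro Max_ge) auto
  qed
  then show ?thesis by blast
qed

text \<open>If \<open>|a| = 1\<close>, then near the fixed point \<open>\<infinity>\<close> any number of powers of the triangular matrix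
  displace points by a bounded amount, which a cocompact discrete group only allows for finitely
  many elements.\<close>

lemma not_unimodular_of_infinite_order:
  assumes inf: "\<And>i j. matrix_power A i = matrix_power A j \<Longrightarrow> i = j"
    and mem: "(A, S ** upper a b ** minv S) \<in> P" and S: "det S = 1" "a \<noteq> 0"
    and R: "\<And>p. p \<in> hyp_space \<Longrightarrow> \<exists>(A, B) \<in> P. hyp_dist (mat_act B (0, 1)) p \<le> R"
  shows "norm a \<noteq> 1"
proof
  assume a: "norm a = 1"
  define F where "F = {(A, B) \<in> P. frob B \<le> 2 * cosh (2 * R + arcosh 2)}"
  have finF: "finite F" unfolding F_def by (rule finite2)
  define m where "m = card F"
  obtain \<beta> where \<beta>: "\<And>n. matrix_power (upper a b) n = upper (a ^ n) (\<beta> n)"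
    using matrix_power_upper by metis
  \<comment> \<open>Above all translation parts of the powers up to m: at height T each of them
    moves (0, T) by at most arcosh 2.\<close>
  define T where "T = 1 + (\<Sum>n\<le>m. norm (\<beta> n))"
  have T: "T > 0" by (simp add: T_def add_pos_nonneg sum_nonneg)
  have T\<beta>: "norm (\<beta> n) \<le> T" if "n \<le> m" for n
    using member_le_sum[of n "{..m}" "\<lambda>n. norm (\<beta> n)"] that by (simp add: T_def)
  have "(0, T) \<in> hyp_space" using T by (simp add: hyp_space_def)
  define p where "p = mat_act S (0, T)"
  have p: "p \<in> hyp_space" unfolding p_def by (intro mat_act_in_hyp_space S) fact
  have move: "hyp_dist (mat_act (matrix_power (S ** upper a b ** minv S) n) p) p \<le> arcosh 2" if n: "n \<le> m" for n
  proof -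
    let ?U = "upper (a ^ n) (\<beta> n)"
    have U: "det ?U = 1" using S by (intro det_upper) simp
    have h: "(0, T) \<in> (hyp_space :: ('b \<times> real) set)" using T by (simp add: hyp_space_def)
    have "mat_act (S ** ?U ** minv S) p = mat_act S (mat_act ?U (mat_act (minv S) p))"
      using S U p by (simp add: mat_act_mult det_mul mat_act_in_hyp_space)
    also have "mat_act (minv S) p = (0, T)" using S h by (simp add: p_def mat_act_minv)
    finally have "hyp_dist (mat_act (matrix_power (S ** upper a b ** minv S) n) p) p = hyp_dist (mat_act S (mat_act ?U (0, T))) (mat_act S (0, T))"
      by (simp add: matrix_power_conjugate S \<beta> p_def)
    also have "\<dots> = hyp_dist (mat_act ?U (0, T)) (0, T)"
      using S U h by (intro hyp_dist_mat_act mat_act_in_hyp_space)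
    also have "mat_act ?U (0, T) = (\<beta> n * conjug (inverse (a ^ n)), T)"
      by (simp add: mat_act_def norm_inverse norm_power a)
    also have "hyp_dist (\<beta> n * conjug (inverse (a ^ n)), T) (0, T) = arcosh (1 + (norm (\<beta> n))\<^sup>2 / (2 * T * T))"
      by (simp add: hyp_dist_def dist_prod_def dist_norm norm_mult norm_inverse norm_power a)
    also have "\<dots> \<le> arcosh 2"
    proof -
      have "(norm (\<beta> n))\<^sup>2 \<le> T\<^sup>2" using T\<beta>[OF n] by (intro power_mono) auto
      also have "\<dots> \<le> 2 * T * T" by (simp add: power2_eq_square)
      finally have "(norm (\<beta> n))\<^sup>2 / (2 * T * T) \<le> 1" using T by (simp add: divide_le_eq)
      moreover have "(norm (\<beta> n))\<^sup>2 / (2 * T * T) \<ge> 0" using T by simp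
      ultimately show ?thesis by (subst not_less[symmetric], subst arcosh_less_iff_real) auto
    qed
    finally show ?thesis .
  qed
  obtain A' B' where AB: "(A', B') \<in> P" "hyp_dist (mat_act B' (0, 1)) p \<le> R"
    using R[OF p] by blast
  define B where "B = S ** upper a b ** minv S"
  \<comment> \<open>Conjugation by an orbit element near p turns small displacement at p into
    bounded displacement at the origin. So the exponents 0, ..., m give m + 1 distinct elements of
    F, which has only m.\<close>
  define e where "e n = (minv A' ** matrix_power A n ** A', minv B' ** matrix_power B n ** B')" for n
  have e_in: "e n \<in> F" if n: "n \<le> m" for n
  proof -
    have eP: "e n \<in> P" unfolding e_def B_def by (intro pair_mult pair_minv pair_power AB mem)
    have Bn: "(matrix_power A n, matrix_power B n) \<in> P" unfolding B_def by (rule pair_power[OF mem])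
    note d = det_one2[OF AB(1)] det_one2[OF Bn]
    have h: "mat_act B' (0, 1) \<in> hyp_space" using d by (simp add: mat_act_in_hyp_space)
    have "hyp_dist (mat_act (minv B' ** (matrix_power B n ** B')) (0, 1)) (0, 1) = hyp_dist (mat_act (matrix_power B n ** B') (0, 1)) (mat_act B' (0, 1))"
      using d by (intro hyp_dist_mat_act_minv) (simp_all add: det_mul)
    also have "\<dots> = hyp_dist (mat_act (matrix_power B n) (mat_act B' (0, 1))) (mat_act B' (0, 1))"
      using d by (simp add: mat_act_mult)
    also have "\<dots> \<le> hyp_dist (mat_act (matrix_power B n) p) p + 2 * hyp_dist (mat_act B' (0, 1)) p"
      by (rule hyp_dist_orbit_le[OF d(2) h p])
    also have "\<dots> \<le> 2 * R + arcosh 2" using move[OF n] AB(2) unfolding B_def by linarith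
    finally have *: "hyp_dist (mat_act (minv B' ** (matrix_power B n ** B')) (0, 1)) (0, 1) \<le> 2 * R + arcosh 2" .
    have det: "det (minv B' ** (matrix_power B n ** B')) = 1" using d by (simp add: det_mul)
    moreover have "hyp_dist (mat_act (minv B' ** (matrix_power B n ** B')) (0, 1)) (0, 1) \<ge> 0"
      using det by (intro hyp_dist_nonneg mat_act_in_hyp_space) auto
    ultimately have "frob (minv B' ** (matrix_power B n ** B')) \<le> 2 * cosh (2 * R + arcosh 2)"
      using * by (simp add: frob_eq_cosh cosh_real_nonneg_le_iff)
    then show ?thesis using eP unfolding F_def by (simp add: e_def matrix_mul_assoc)
  qed
  have "inj_on e {..m}"
  proof (rule inj_onI)
    fix i j assume "e i = e j"
    then have "A' ** (minv A' ** matrix_power A i ** A') ** minv A' = A' ** (minv A' ** matrix_power A j ** A') ** minv A'"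
      by (simp add: e_def)
    moreover have "A' ** (minv A' ** X ** A') ** minv A' = X" for X
      using conjugate_cancel[of "minv A'" X] det_one1[OF AB(1)] by simp
    ultimately have "matrix_power A i = matrix_power A j" by simp
    then show "i = j" by (rule inf)
  qed
  then have "card {..m} \<le> card F" using e_in finF by (intro card_inj_on_le[of e]) auto
  then show False by (simp add: m_def)
qed

end

lemma frob_eq_norm: "frob A = (norm A)\<^sup>2"
  by (simp add: frob_def norm_vec_def L2_set_def sum_2 sum_nonneg)

text \<open>Elements \<open>A\<^sub>k\<close> moving the origin close to \<open>(0, 64^k)\<close> differ from \<open>diag (8^k, 8^-k)\<close> by a
  bounded factor, so by compactness two of these factors are almost equal.\<close>

lemma exists_trace_gt_2:
  fixes G :: "(real ^ 2 ^ 2) set"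
  assumes "discrete_matrix_group G"
    and R: "\<And>p. p \<in> hyp_space \<Longrightarrow> \<exists>A\<in>G. hyp_dist (mat_act A (0, 1)) p \<le> R"
  shows "\<exists>A\<in>G. A $ 1 $ 1 + A $ 2 $ 2 > 2"
proof -
  interpret discrete_matrix_group G by fact
  \<comment> \<open>Height 64^k on the axis from 0 to infinity. The base 8 exceeds what is needed
    for 8 * (1/2) > 2 in the final trace estimate.\<close>
  let ?D = "\<lambda>k. upper ((8::real) ^ k) 0"
  have D: "det (?D k) = 1" for k by (simp add: det_upper)
  have "\<exists>A. A \<in> G \<and> hyp_dist (mat_act A (0, 1)) (mat_act (?D k) (0, 1)) \<le> R" for k
    using R[OF mat_act_in_hyp_space[OF D[of k] hyp_space_origin]] by blast
  then obtain A where A: "\<And>k. A k \<in> G" "\<And>k. hyp_dist (mat_act (A k) (0, 1)) (mat_act (?D k) (0, 1)) \<le> R"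
    by metis
  define C where "C k = minv (?D k) ** A k" for k
  have detC: "det (C k) = 1" for k by (simp add: C_def det_mul D det_one A)
  have "frob (C k) \<le> 2 * cosh R" for k
  proof -
    have "hyp_dist (mat_act (C k) (0, 1)) (0, 1) \<le> R"
      unfolding C_def using A D by (simp add: hyp_dist_mat_act_minv det_one)
    moreover have "hyp_dist (mat_act (C k) (0, 1)) (0, 1) \<ge> 0"
      using detC by (intro hyp_dist_nonneg mat_act_in_hyp_space) auto
    ultimately show ?thesis by (simp add: frob_eq_cosh detC cosh_real_nonneg_le_iff)
  qed
  then have "norm (C k) \<le> sqrt (2 * cosh R)" for k
    by (intro real_le_rsqrt) (simp add: frob_eq_norm)
  then have "bounded (range C)" by (auto simp: bounded_iff)
  then obtain L r where r: "strict_mono r" and lim: "(C \<circ> r) \<longlonglongrightarrow> L"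
    using bounded_imp_convergent_subsequence by blast
  have l: "(\<lambda>n. C (r n) $ i $ j) \<longlonglongrightarrow> L $ i $ j" for i j
    using tendsto_vec_nth[OF tendsto_vec_nth[OF lim]] by (simp add: o_def)
  have l': "(\<lambda>n. C (r (Suc n)) $ i $ j) \<longlonglongrightarrow> L $ i $ j" for i j
    using LIMSEQ_Suc[OF l] .
  have "(\<lambda>n. det (C (r n))) \<longlonglongrightarrow> det L" unfolding det_2 by (intro tendsto_intros l)
  then have detL: "det L = 1" by (simp add: detC LIMSEQ_const_iff)
  \<comment> \<open>E tends to L L^-1 = 1. For a trace bound only the two diagonal entries matter,
    since conjugated between diagonal matrices they are merely rescaled.\<close>
  define E where "E n = C (r (Suc n)) ** minv (C (r n))" for n
  have E: "(\<lambda>n. E n $ 1 $ 1) \<longlonglongrightarrow> det L" "(\<lambda>n. E n $ 2 $ 2) \<longlonglongrightarrow> det L"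
  proof -
    have "(\<lambda>n. E n $ 1 $ 1) \<longlonglongrightarrow> L $ 1 $ 1 * L $ 2 $ 2 + L $ 1 $ 2 * (- (L $ 2 $ 1))"
      unfolding E_def matrix_mul_2_nth minv_nth by (intro tendsto_intros l l')
    then show "(\<lambda>n. E n $ 1 $ 1) \<longlonglongrightarrow> det L" by (simp add: det_2)
    have "(\<lambda>n. E n $ 2 $ 2) \<longlonglongrightarrow> L $ 2 $ 1 * (- (L $ 1 $ 2)) + L $ 2 $ 2 * L $ 1 $ 1"
      unfolding E_def matrix_mul_2_nth minv_nth by (intro tendsto_intros l l')
    then show "(\<lambda>n. E n $ 2 $ 2) \<longlonglongrightarrow> det L" by (simp add: det_2 mult.commute)
  qed
  have "\<forall>\<^sub>F n in sequentially. E n $ 1 $ 1 > 1 / 2" "\<forall>\<^sub>F n in sequentially. E n $ 2 $ 2 > 1 / 2"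
    using order_tendstoD(1)[OF E(1), of "1 / 2"] order_tendstoD(1)[OF E(2), of "1 / 2"] detL by simp_all
  then have "\<forall>\<^sub>F n in sequentially. E n $ 1 $ 1 > 1 / 2 \<and> E n $ 2 $ 2 > 1 / 2" by (rule eventually_conj)
  then obtain n where n: "E n $ 1 $ 1 > 1 / 2" "E n $ 2 $ 2 > 1 / 2"
    unfolding eventually_sequentially by blast
  define j k where "j = r n" and "k = r (Suc n)"
  have jk: "j < k" using r by (simp add: j_def k_def strict_mono_Suc_iff)
  define M where "M = A k ** minv (A j)"
  have "M \<in> G" using A by (simp add: M_def mult_in minv_in)
  have AC: "A i = ?D i ** C i" for i by (simp add: C_def matrix_mul_assoc minv_mult D)
  have "M = (?D k ** C k) ** minv (?D j ** C j)" by (simp only: M_def AC[symmetric])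
  then have M: "M = ?D k ** E n ** minv (?D j)"
    unfolding minv_matrix_mul E_def j_def k_def by (simp only: matrix_mul_assoc)
  have M11: "M $ 1 $ 1 = 8 ^ k * E n $ 1 $ 1 * inverse (8 ^ j)" and M22: "M $ 2 $ 2 = inverse (8 ^ k) * E n $ 2 $ 2 * 8 ^ j"
    by (simp_all add: M matrix_mul_2_nth minv_upper)
  have "(8::real) ^ Suc j \<le> 8 ^ k" using jk by (intro power_increasing) auto
  then have "8 \<le> 8 ^ k * inverse ((8::real) ^ j)" by (simp add: field_simps)
  then have "8 * (1 / 2) < (8 ^ k * inverse (8 ^ j)) * E n $ 1 $ 1" using n by (intro mult_le_less_imp_less) auto
  then have "M $ 1 $ 1 > 4" by (simp add: M11 mult_ac)
  moreover have "M $ 2 $ 2 > 0" unfolding M22 using n by simp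
  ultimately show ?thesis using \<open>M \<in> G\<close> by force
qed

lemma quadratic_root_exists:
  fixes b c e w :: "'a::field_char_0"
  assumes "c \<noteq> 0" "w\<^sup>2 = e\<^sup>2 + 4 * c * b"
  shows "\<exists>z. c * z\<^sup>2 + e * z - b = 0"
proof -
  define z where "z = (w - e) / (2 * c)"
  have "2 * c * z = w - e" using assms by (simp add: z_def)
  then have "(2 * c * z + e)\<^sup>2 = e\<^sup>2 + 4 * c * b" using assms by simp
  then have "4 * c * (c * z\<^sup>2 + e * z - b) = 0" by (simp add: power2_eq_square algebra_simps)
  with assms show ?thesis by auto
qed

lemma hyperbolic_real_diagonalizable:
  fixes A :: "real ^ 2 ^ 2"
  assumes det: "det A = 1" and tr: "A $ 1 $ 1 + A $ 2 $ 2 > 2"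
  shows "\<exists>S \<nu>. det S = 1 \<and> \<nu> \<noteq> 0 \<and> norm \<nu> \<noteq> 1 \<and> A = S ** upper \<nu> 0 ** minv S"
proof -
  have "A $ 2 $ 1 = 0 \<or> (\<exists>z. A $ 2 $ 1 * z\<^sup>2 + (A $ 2 $ 2 - A $ 1 $ 1) * z - A $ 1 $ 2 = 0)"
  proof (cases "A $ 2 $ 1 = 0")
    case False
    have "4 \<le> (A $ 1 $ 1 + A $ 2 $ 2)\<^sup>2" using power_mono[of 2 "A $ 1 $ 1 + A $ 2 $ 2" 2] tr by simp
    \<comment> \<open>The discriminant of the fixed point equation is the squared trace minus 4, so
      a trace above 2 gives real fixed points. Conjugation keeps the trace a + 1/a, which then
      excludes |a| = 1.\<close>
    moreover have "(A $ 2 $ 2 - A $ 1 $ 1)\<^sup>2 + 4 * A $ 2 $ 1 * A $ 1 $ 2 = (A $ 1 $ 1 + A $ 2 $ 2)\<^sup>2 - 4"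
      using det by (simp add: det_2 power2_eq_square algebra_simps)
    ultimately have "(sqrt ((A $ 1 $ 1 + A $ 2 $ 2)\<^sup>2 - 4))\<^sup>2 = (A $ 2 $ 2 - A $ 1 $ 1)\<^sup>2 + 4 * A $ 2 $ 1 * A $ 1 $ 2"
      by simp
    from quadratic_root_exists[OF False this] show ?thesis by simp
  qed simp
  then obtain S a b where S: "det S = 1" "a \<noteq> 0" "A = S ** upper a b ** minv S"
    using triangularizable[OF det] by blast
  have "A $ 1 $ 1 + A $ 2 $ 2 = (S $ 1 $ 1 * S $ 2 $ 2 - S $ 1 $ 2 * S $ 2 $ 1) * (a + inverse a)"
    by (simp add: S matrix_mul_2_nth algebra_simps)
  then have "a + inverse a > 2" using tr S(1) by (simp add: det_2)
  then have "norm a \<noteq> 1" by (auto simp: abs_eq_iff' )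
  with S diagonalizable_of_triangular[OF this S(2,1)] show ?thesis by metis
qed

lemma complex_triangularizable:
  fixes A :: "complex ^ 2 ^ 2"
  assumes det: "det A = 1"
  shows "\<exists>S a b. det S = 1 \<and> a \<noteq> 0 \<and> A = S ** upper a b ** minv S"
proof (rule triangularizable[OF det])
  show "A $ 2 $ 1 = 0 \<or> (\<exists>z. A $ 2 $ 1 * z\<^sup>2 + (A $ 2 $ 2 - A $ 1 $ 1) * z - A $ 1 $ 2 = 0)"
    using quadratic_root_exists[OF _ power2_csqrt, of "A $ 2 $ 1"] by blast
qed

text \<open>If the signs differed, the horizontal distance squared would be at least 2 |x| |x'|,
  more than 2 t t' cosh(C)^2, whereas distance at most C allows no more than 2 t t' cosh C.\<close>

lemma same_side_of_axis:
  fixes p q :: "real \<times> real"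
  assumes "p \<in> hyp_space" "q \<in> hyp_space" "hyp_dist p q \<le> C"
    and "norm (fst p) / snd p > cosh C" "norm (fst q) / snd q > cosh C"
  shows "fst p * fst q > 0"
proof (rule ccontr)
  assume "\<not> fst p * fst q > 0"
  then have le: "fst p * fst q \<le> 0" by simp
  have t: "snd p > 0" "snd q > 0" using assms by (auto simp: hyp_space_def)
  have nn: "hyp_dist p q \<ge> 0" using assms by (intro hyp_dist_nonneg)
  have C1: "cosh C \<ge> 1" by (rule cosh_real_ge_1)
  have p: "cosh C * snd p < \<bar>fst p\<bar>" and q: "cosh C * snd q < \<bar>fst q\<bar>"
    using assms(4,5) t by (simp_all add: pos_less_divide_eq)
  have "(cosh C * snd p) * (cosh C * snd q) < \<bar>fst p\<bar> * \<bar>fst q\<bar>"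
    using p q t by (intro mult_strict_mono') auto
  moreover have "2 * (\<bar>fst p\<bar> * \<bar>fst q\<bar>) \<le> (fst p)\<^sup>2 + (fst q)\<^sup>2"
    using zero_le_power2[of "\<bar>fst p\<bar> - \<bar>fst q\<bar>"] by (simp add: power2_diff)
  moreover have "(fst p)\<^sup>2 + (fst q)\<^sup>2 \<le> 2 * snd p * snd q * cosh (hyp_dist p q)"
  proof -
    have "0 \<le> (snd p)\<^sup>2" "0 \<le> (snd q)\<^sup>2" by simp_all
    then show ?thesis
      unfolding cosh_hyp_dist'[OF assms(1,2)] inner_real_def real_norm_def power2_abs using le by linarith
  qed
  moreover have "2 * snd p * snd q * cosh (hyp_dist p q) \<le> 2 * snd p * snd q * cosh C"
    using t nn assms(3) by (intro mult_left_mono) (auto simp: cosh_real_nonneg_le_iff)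
  moreover have "snd p * snd q * cosh C \<le> (cosh C * snd p) * (cosh C * snd q)"
    using mult_left_mono[OF C1, of "snd p * snd q * cosh C"] t C1 by (simp add: mult_ac)
  ultimately show False by linarith
qed

text \<open>The ratio is the hyperbolic sine of the distance to the axis, so it can change only in a
  controlled way over distance R.\<close>

lemma axis_ratio_le:
  fixes p q :: "'a::{real_normed_field,euclidean_space} \<times> real"
  assumes "p \<in> hyp_space" "q \<in> hyp_space" "hyp_dist p q \<le> R"
  shows "norm (fst p) / snd p \<le> 2 * cosh R * (norm (fst q) / snd q + 1)"
proof -
  have t: "snd p > 0" "snd q > 0" using assms by (auto simp: hyp_space_def)
  have nn: "hyp_dist p q \<ge> 0" using assms by (intro hyp_dist_nonneg)
  have c: "cosh (hyp_dist p q) \<le> cosh R" using nn assms by (auto simp: cosh_real_nonneg_le_iff)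
  have "snd q \<le> 2 * cosh (hyp_dist p q) * snd p"
    using snd_le_hyp_dist[OF assms(2,1)] by (simp add: hyp_dist_commute)
  also have "\<dots> \<le> 2 * cosh R * snd p" using c t by (intro mult_right_mono mult_left_mono) auto
  finally have q: "snd q \<le> 2 * cosh R * snd p" .
  have "(dist p q)\<^sup>2 \<le> 2 * snd p * snd q * cosh (hyp_dist p q)" by (rule dist_le_hyp_dist[OF assms(1,2)])
  also have "\<dots> \<le> 2 * snd p * (2 * cosh R * snd p) * cosh R" using c q t by (intro mult_mono) auto
  also have "\<dots> = (2 * cosh R * snd p)\<^sup>2" by (simp add: power2_eq_square)
  finally have "dist p q \<le> 2 * cosh R * snd p" using t by (simp add: power2_le_iff_abs_le)
  moreover have "norm (fst p) \<le> norm (fst q) + dist p q"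
    using dist_fst_le[of p q] norm_triangle_sub[of "fst p" "fst q"] by (simp add: dist_norm)
  moreover have "norm (fst q) = (norm (fst q) / snd q) * snd q" using t by simp
  moreover have "(norm (fst q) / snd q) * snd q \<le> (norm (fst q) / snd q) * (2 * cosh R * snd p)"
    using q t by (intro mult_left_mono) auto
  ultimately have "norm (fst p) \<le> (norm (fst q) / snd q) * (2 * cosh R * snd p) + 2 * cosh R * snd p" by linarith
  then show ?thesis using t by (simp add: pos_divide_le_eq algebra_simps)
qed

text \<open>This is where space differs from the plane: the region is a product of an interval with
  the punctured boundary, and the complex plane minus a point is connected while the real line minus
  a point is not.\<close>

lemma connected_outside_axis:
  assumes "M > 0"
  shows "connected {p :: complex \<times> real. snd p > 0 \<and> norm (fst p) > M * snd p}"
proof -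
  have "connected ((- {0 :: complex}) \<times> {0 <..< 1 :: real})"
    by (intro connected_Times path_connected_imp_connected path_connected_punctured_universe) auto
  then have "connected ((\<lambda>(z, s). (z, s * norm z / M)) ` ((- {0 :: complex}) \<times> {0 <..< 1 :: real}))"
    using assms by (intro connected_continuous_image) (auto intro!: continuous_intros simp: case_prod_unfold)
  also have "(\<lambda>(z, s). (z, s * norm z / M)) ` ((- {0 :: complex}) \<times> {0 <..< 1 :: real})
      = {p. snd p > 0 \<and> norm (fst p) > M * snd p}"
  proof safe
    fix z :: complex and t :: real
    assume zt: "0 < snd (z, t)" "M * snd (z, t) < norm (fst (z, t))"
    then have z: "z \<noteq> 0" using assms by (auto simp: mult_less_0_iff)
    then have "(z, t) = (\<lambda>(z, s). (z, s * norm z / M)) (z, M * t / norm z)" using assms by simp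
    moreover have "(z, M * t / norm z) \<in> (- {0}) \<times> {0 <..< 1}" using zt z assms by simp
    ultimately show "(z, t) \<in> (\<lambda>(z, s). (z, s * norm z / M)) ` ((- {0 :: complex}) \<times> {0 <..< 1 :: real})"
      by (rule image_eqI)
  qed (use assms in auto)
  finally show ?thesis .
qed

lemma eventually_hyp_dist_le_1:
  fixes p :: "'a::{real_normed_field,euclidean_space} \<times> real"
  assumes "p \<in> hyp_space"
  shows "\<forall>\<^sub>F q in at p. q \<in> hyp_space \<longrightarrow> hyp_dist p q \<le> 1"
proof -
  have t: "snd p > 0" using assms by (auto simp: hyp_space_def)
  have "((\<lambda>q. 1 + (dist p q)\<^sup>2 / (2 * snd p * snd q)) \<longlongrightarrow> 1 + (dist p p)\<^sup>2 / (2 * snd p * snd p)) (at p)"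
    using t by (intro tendsto_intros) auto
  then have "\<forall>\<^sub>F q in at p. 1 + (dist p q)\<^sup>2 / (2 * snd p * snd q) < cosh 1"
    by (rule order_tendstoD) (use cosh_real_nonneg_less_iff[of 0 1] in simp)
  then show ?thesis
  proof eventually_elim
    case (elim q)
    show ?case
    proof
      assume q: "q \<in> hyp_space"
      then have "cosh (hyp_dist p q) \<le> cosh 1" using elim cosh_hyp_dist[OF assms q] by simp
      then show "hyp_dist p q \<le> 1" using hyp_dist_nonneg[OF assms q] by (simp add: cosh_real_nonneg_le_iff)
    qed
  qed
qed

context matrix_pair_group
begin

lemma discrete_matrix_group_fst: "discrete_matrix_group (fst ` P)"
proof
  show "finite {A \<in> fst ` P. frob A \<le> r}" for r
    by (rule finite_surj[OF finite1[of r], of _ fst]) force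
  show "X ** Y \<in> fst ` P" if XY: "X \<in> fst ` P" "Y \<in> fst ` P" for X Y
  proof -
    obtain u v where "u \<in> P" "v \<in> P" "X = fst u" "Y = fst v" using XY by (elim imageE)
    with pair_mult[of "fst u" "snd u" "fst v" "snd v"] show ?thesis by force
  qed
  show "minv X \<in> fst ` P" if X: "X \<in> fst ` P" for X
  proof -
    obtain u where "u \<in> P" "X = fst u" using X by (elim imageE)
    with pair_minv[of "fst u" "snd u"] show ?thesis by force
  qed
qed (use det_one1 pair_one in force)+

text \<open>Translating by A'^-1 and B'^-1 reduces to displacements of the origin, and only finitely
  many pairs have a second component of bounded displacement.\<close>

lemma orbit_distance_transfer:
  "\<exists>C. \<forall>(A, B) \<in> P. \<forall>(A', B') \<in> P. hyp_dist (mat_act B (0, 1)) (mat_act B' (0, 1)) \<le> r \<longrightarrow>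
     hyp_dist (mat_act A (0, 1)) (mat_act A' (0, 1)) \<le> C"
proof -
  define Q where "Q = {(A, B) \<in> P. frob B \<le> 2 * cosh r}"
  define C where "C = Max (insert 0 ((\<lambda>(A, B). hyp_dist (mat_act A (0, 1)) (0, 1)) ` Q))"
  have finQ: "finite Q" unfolding Q_def by (rule finite2)
  have "hyp_dist (mat_act A (0, 1)) (mat_act A' (0, 1)) \<le> C"
    if AB: "(A, B) \<in> P" "(A', B') \<in> P" and le: "hyp_dist (mat_act B (0, 1)) (mat_act B' (0, 1)) \<le> r" for A B A' B'
  proof -
    note d = det_one1[OF AB(1)] det_one2[OF AB(1)] det_one1[OF AB(2)] det_one2[OF AB(2)]
    have PM: "(minv A' ** A, minv B' ** B) \<in> P" by (intro pair_mult pair_minv AB)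
    have "hyp_dist (mat_act (minv B' ** B) (0, 1)) (0, 1) \<le> r"
      using d le by (simp add: hyp_dist_mat_act_minv)
    moreover have "hyp_dist (mat_act (minv B' ** B) (0, 1)) (0, 1) \<ge> 0"
      using d by (intro hyp_dist_nonneg mat_act_in_hyp_space) (auto simp: det_mul)
    ultimately have "frob (minv B' ** B) \<le> 2 * cosh r"
      using d by (simp add: frob_eq_cosh det_mul cosh_real_nonneg_le_iff)
    then have "(minv A' ** A, minv B' ** B) \<in> Q" using PM by (simp add: Q_def)
    then have "hyp_dist (mat_act (minv A' ** A) (0, 1)) (0, 1) \<in> (\<lambda>(A, B). hyp_dist (mat_act A (0, 1)) (0, 1)) ` Q"
      by force
    then have "hyp_dist (mat_act (minv A' ** A) (0, 1)) (0, 1) \<le> C"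
      unfolding C_def using finQ by (intro Max_ge) auto
    then show ?thesis using d by (simp add: hyp_dist_mat_act_minv)
  qed
  then show ?thesis by blast
qed

end

text \<open>The axis of a hyperbolic element separates the hyperbolic plane, and points of the orbit lie far
  away from it on both sides. In hyperbolic space the corresponding orbit points can be joined
  far away from the axis of the corresponding element, because there the complement of a
  neighbourhood of a geodesic is connected.\<close>

lemma no_cocompact_pair:
  fixes P :: "((real ^ 2 ^ 2) \<times> (complex ^ 2 ^ 2)) set"
  assumes "matrix_pair_group P"
    and R1: "\<And>p. p \<in> hyp_space \<Longrightarrow> \<exists>(A, B) \<in> P. hyp_dist (mat_act A (0, 1)) p \<le> R1"
    and R2: "\<And>p. p \<in> hyp_space \<Longrightarrow> \<exists>(A, B) \<in> P. hyp_dist (mat_act B (0, 1)) p \<le> R2"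
  shows False
proof -
  interpret matrix_pair_group P by fact
  interpret swap: matrix_pair_group "prod.swap ` P" by (rule swapped)
  have "\<exists>A\<in>fst ` P. A $ 1 $ 1 + A $ 2 $ 2 > 2"
  proof (rule exists_trace_gt_2[OF discrete_matrix_group_fst])
    fix p :: "real \<times> real" assume "p \<in> hyp_space"
    then show "\<exists>A\<in>fst ` P. hyp_dist (mat_act A (0, 1)) p \<le> R1" using R1[of p] by force
  qed
  then obtain A0 B0 where A0: "(A0, B0) \<in> P" "A0 $ 1 $ 1 + A0 $ 2 $ 2 > 2" by auto
  obtain S1 \<nu>1 where S1: "det S1 = 1" "\<nu>1 \<noteq> 0" "norm \<nu>1 \<noteq> 1" "A0 = S1 ** upper \<nu>1 0 ** minv S1"
    using hyperbolic_real_diagonalizable[OF det_one1[OF A0(1)] A0(2)] by blast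
  obtain S \<nu>2 b where S: "det S = 1" "\<nu>2 \<noteq> 0" "B0 = S ** upper \<nu>2 b ** minv S"
    using complex_triangularizable[OF det_one2[OF A0(1)]] by blast
  \<comment> \<open>Cocompactness in space rules out a parabolic or elliptic partner of the
    hyperbolic element \<open>A0\<close>.\<close>
  have "norm \<nu>2 \<noteq> 1"
  proof (rule not_unimodular_of_infinite_order[OF _ _ S(1,2) R2])
    show "(A0, S ** upper \<nu>2 b ** minv S) \<in> P" using A0 S by simp
    show "i = j" if "matrix_power A0 i = matrix_power A0 j" for i j
      using that matrix_power_diag_conjugate_inj[OF S1(3,2,1)] unfolding S1(4) by blast
  qed
  then obtain S2 where S2: "det S2 = 1" "B0 = S2 ** upper \<nu>2 0 ** minv S2"
    using diagonalizable_of_triangular[OF _ S(2,1)] S(3) by metis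
  note \<nu>2 = \<open>\<nu>2 \<noteq> 0\<close> \<open>norm \<nu>2 \<noteq> 1\<close>
  have mem: "(S1 ** upper \<nu>1 0 ** minv S1, S2 ** upper \<nu>2 0 ** minv S2) \<in> P"
    using A0(1) S1(4) S2(2) by simp
  \<comment> \<open>Orbit points in coordinates in which both axes run from 0 to infinity, so the
    sides of the axis in the plane are the signs of \<open>fst\<close>.\<close>
  define f1 where "f1 A = mat_act (minv S1 ** A) (0, 1)" for A
  define f2 where "f2 B = mat_act (minv S2 ** B) (0, 1)" for B
  define \<tau>1 :: "real \<times> real \<Rightarrow> real" where "\<tau>1 p = norm (fst p) / snd p" for p
  define \<tau>2 :: "complex \<times> real \<Rightarrow> real" where "\<tau>2 p = norm (fst p) / snd p" for p
  have f1_hyp: "f1 A \<in> hyp_space" and f2_hyp: "f2 B \<in> hyp_space" if "(A, B) \<in> P" for A B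
    using det_one1[OF that] det_one2[OF that] S1 S2
    by (auto simp: f1_def f2_def det_mul intro!: mat_act_in_hyp_space)
  have f1_dist: "hyp_dist (f1 A) p = hyp_dist (mat_act A (0, 1)) (mat_act S1 p)" if "(A, B) \<in> P" "p \<in> hyp_space" for A B p
    unfolding f1_def using that det_one1[OF that(1)] S1 by (intro hyp_dist_mat_act_minv) auto
  have f2_dist: "hyp_dist (f2 B) p = hyp_dist (mat_act B (0, 1)) (mat_act S2 p)" if "(A, B) \<in> P" "p \<in> hyp_space" for A B p
    unfolding f2_def using that det_one2[OF that(1)] S2 by (intro hyp_dist_mat_act_minv) auto
  have S1_f1: "mat_act S1 (f1 A) = mat_act A (0, 1)" and S2_f2: "mat_act S2 (f2 B) = mat_act B (0, 1)" if "(A, B) \<in> P" for A B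
    using det_one1[OF that] det_one2[OF that] S1(1) S2(1)
    by (simp_all add: f1_def f2_def mat_act_mult[symmetric] det_mul matrix_mul_assoc minv_mult)
  have near1: "\<exists>A B. (A, B) \<in> P \<and> hyp_dist (f1 A) p \<le> R1" if p: "p \<in> hyp_space" for p
    using R1[OF mat_act_in_hyp_space[OF S1(1) p]] f1_dist[OF _ p] by fastforce
  have near2: "\<exists>A B. (A, B) \<in> P \<and> hyp_dist (f2 B) p \<le> R2" if p: "p \<in> hyp_space" for p
    using R2[OF mat_act_in_hyp_space[OF S2(1) p]] f2_dist[OF _ p] by fastforce
  obtain C where "\<forall>(A, B) \<in> P. \<forall>(A', B') \<in> P. hyp_dist (mat_act B (0, 1)) (mat_act B' (0, 1)) \<le> 2 * R2 + 1 \<longrightarrow>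
     hyp_dist (mat_act A (0, 1)) (mat_act A' (0, 1)) \<le> C"
    using orbit_distance_transfer by blast
  then have C: "hyp_dist (f1 A) (f1 A') \<le> C" if "(A, B) \<in> P" "(A', B') \<in> P" "hyp_dist (f2 B) (f2 B') \<le> 2 * R2 + 1" for A B A' B'
    using that f1_dist[OF that(1) f1_hyp[OF that(2)]] f2_dist[OF that(1) f2_hyp[OF that(2)]] S1_f1[OF that(2)] S2_f2[OF that(2)]
    by fastforce
  \<comment> \<open>Large enough for \<open>same_side_of_axis\<close> both at distance C
    (neighbouring orbit points) and at distance R1 (approximation of a chosen point).\<close>
  define M1 where "M1 = cosh C + cosh R1"
  have M1: "M1 > cosh C" "M1 > cosh R1" by (simp_all add: M1_def)
  have "\<exists>M'. \<forall>(A, B) \<in> P. \<tau>1 (f1 A) \<le> M1 \<longrightarrow> \<tau>2 (f2 B) \<le> M'"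
    unfolding \<tau>1_def \<tau>2_def f1_def f2_def
    by (rule axis_distance_transfer[OF S1(1) S2(1) S1(2) \<nu>2(1) S1(3) mem])
  then obtain M2 where M2: "\<And>A B. (A, B) \<in> P \<Longrightarrow> \<tau>1 (f1 A) \<le> M1 \<Longrightarrow> \<tau>2 (f2 B) \<le> M2" by blast
  \<comment> \<open>By \<open>axis_ratio_le\<close>, an orbit point within R2 of a point of ratio
    above M3 has ratio above M2; by the choice of M2 its partner in the plane is then farther than
    M1 from the axis.\<close>
  define M3 where "M3 = 2 * cosh R2 * (\<bar>M2\<bar> + 1)"
  have M3: "M3 > 0" by (simp add: M3_def add_nonneg_pos)
  have "\<exists>M'. \<forall>(B, A) \<in> prod.swap ` P. \<tau>2 (f2 B) \<le> M3 \<longrightarrow> \<tau>1 (f1 A) \<le> M'"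
    unfolding \<tau>1_def \<tau>2_def f1_def f2_def
    by (rule swap.axis_distance_transfer[OF S2(1) S1(1) \<nu>2(1) S1(2) \<nu>2(2)]) (use mem in force)
  then obtain M4 where M4': "\<forall>(B, A) \<in> prod.swap ` P. \<tau>2 (f2 B) \<le> M3 \<longrightarrow> \<tau>1 (f1 A) \<le> M4" by blast
  have M4: "\<tau>1 (f1 A) \<le> M4" if "(A, B) \<in> P" "\<tau>2 (f2 B) \<le> M3" for A B
  proof -
    have "(B, A) \<in> prod.swap ` P" using that(1) by force
    with M4' that(2) show ?thesis by blast
  qed
  define \<Omega> where "\<Omega> = {p :: complex \<times> real. snd p > 0 \<and> norm (fst p) > M3 * snd p}"
  have \<Omega>_iff: "p \<in> \<Omega> \<longleftrightarrow> p \<in> hyp_space \<and> \<tau>2 p > M3" for p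
    by (cases p) (auto simp: \<Omega>_def hyp_space_def \<tau>2_def pos_less_divide_eq)
  have far: "\<tau>1 (f1 A) > M1" if "(A, B) \<in> P" "p \<in> \<Omega>" "hyp_dist (f2 B) p \<le> R2" for A B p
  proof (rule ccontr)
    assume "\<not> \<tau>1 (f1 A) > M1"
    then have le: "\<tau>2 (f2 B) \<le> M2" using M2[OF that(1)] by simp
    have "\<tau>2 p \<le> 2 * cosh R2 * (\<tau>2 (f2 B) + 1)"
      unfolding \<tau>2_def using that f2_hyp[OF that(1)] by (intro axis_ratio_le) (auto simp: \<Omega>_iff hyp_dist_commute)
    also have "\<dots> \<le> M3" unfolding M3_def using le by (intro mult_left_mono) auto
    finally show False using that by (simp add: \<Omega>_iff)
  qed
  have side: "fst (f1 A) * fst (f1 A') > 0"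
    if AB: "(A, B) \<in> P" "(A', B') \<in> P" and p: "p \<in> \<Omega>" "p' \<in> \<Omega>" "hyp_dist p p' \<le> 1" and
      d: "hyp_dist (f2 B) p \<le> R2" "hyp_dist (f2 B') p' \<le> R2" for A B A' B' p p'
  proof -
    have h: "p \<in> hyp_space" "p' \<in> hyp_space" "f2 B \<in> hyp_space" "f2 B' \<in> hyp_space"
      using p f2_hyp AB by (auto simp: \<Omega>_iff)
    have "hyp_dist (f2 B) (f2 B') \<le> hyp_dist (f2 B) p + hyp_dist p (f2 B')" using h by (intro hyp_dist_triangle)
    also have "hyp_dist p (f2 B') \<le> hyp_dist p p' + hyp_dist p' (f2 B')" using h by (intro hyp_dist_triangle)
    finally have "hyp_dist (f2 B) (f2 B') \<le> 2 * R2 + 1" using d p by (simp add: hyp_dist_commute)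
    then have "hyp_dist (f1 A) (f1 A') \<le> C" by (rule C[OF AB])
    then show ?thesis
      using far[OF AB(1) p(1) d(1)] far[OF AB(2) p(2) d(2)] M1 f1_hyp AB
      by (intro same_side_of_axis) (auto simp: \<tau>1_def)
  qed
  \<comment> \<open>The side of the axis in the plane assigned to a point of space. By
    \<open>side\<close> it depends neither on the nearby orbit point nor on steps of length at most
    1, so it is constant on the connected set \<Omega>.\<close>
  define pos where "pos p \<longleftrightarrow> (\<exists>A B. (A, B) \<in> P \<and> hyp_dist (f2 B) p \<le> R2 \<and> fst (f1 A) > 0)" for p
  have pos_step: "pos p'" if "pos p" and p: "p \<in> \<Omega>" "p' \<in> \<Omega>" "hyp_dist p p' \<le> 1" for p p'
  proof -
    obtain A B where AB: "(A, B) \<in> P" "hyp_dist (f2 B) p \<le> R2" "fst (f1 A) > 0" using \<open>pos p\<close> by (auto simp: pos_def)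
    obtain A' B' where AB': "(A', B') \<in> P" "hyp_dist (f2 B') p' \<le> R2" using near2[of p'] p by (auto simp: \<Omega>_iff)
    have "fst (f1 A) * fst (f1 A') > 0" by (rule side[OF AB(1) AB'(1) p AB(2) AB'(2)])
    then have "fst (f1 A') > 0" using AB(3) by (simp add: zero_less_mult_iff)
    with AB' show ?thesis by (auto simp: pos_def)
  qed
  have pos_const: "pos p = pos p'" if "p \<in> \<Omega>" "p' \<in> \<Omega>" for p p'
  proof (rule connected_local_const[OF connected_outside_axis[OF M3], folded \<Omega>_def])
    show "\<forall>a\<in>\<Omega>. \<forall>\<^sub>F b in at a within \<Omega>. pos a = pos b"
    proof
      fix a assume a: "a \<in> \<Omega>"
      then have "\<forall>\<^sub>F q in at a. q \<in> hyp_space \<longrightarrow> hyp_dist a q \<le> 1"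
        by (intro eventually_hyp_dist_le_1) (simp add: \<Omega>_iff)
      then have "\<forall>\<^sub>F q in at a within \<Omega>. q \<in> hyp_space \<longrightarrow> hyp_dist a q \<le> 1"
        by (rule filter_leD[OF at_le, rotated]) simp
      moreover have "\<forall>\<^sub>F q in at a within \<Omega>. q \<in> \<Omega>" by (simp add: eventually_at_filter)
      ultimately show "\<forall>\<^sub>F b in at a within \<Omega>. pos a = pos b"
      proof eventually_elim
        case (elim q)
        then have "hyp_dist a q \<le> 1" "hyp_dist q a \<le> 1" by (auto simp: \<Omega>_iff hyp_dist_commute)
        then show ?case using pos_step a elim by blast
      qed
    qed
  qed (use that in auto)
  have point: "\<exists>A B. (A, B) \<in> P \<and> f2 B \<in> \<Omega> \<and> fst (f1 A) * e > 0" if e: "\<bar>e\<bar> = 1" for e :: real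
  proof -
    \<comment> \<open>At ratio W every orbit point within R1 still has ratio above |M4| + M1: above
      M4, so its partner lies in \<Omega>, and above M1, so it keeps the sign e.\<close>
    define W where "W = 2 * cosh R1 * (\<bar>M4\<bar> + M1 + 1) + M1 + 1"
    have c0: "cosh R1 > 0" "M1 > 0" using cosh_real_ge_1[of R1] M1(2) by linarith+
    have W: "W > 0" "W > M1" "W > 2 * cosh R1 * (\<bar>M4\<bar> + M1 + 1)" using c0 by (auto simp: W_def intro!: add_pos_pos mult_nonneg_nonneg add_nonneg_pos)
    define q :: "real \<times> real" where "q = (e * W, 1)"
    have q: "q \<in> hyp_space" "\<tau>1 q = W" using W e by (simp_all add: q_def hyp_space_def \<tau>1_def abs_mult)
    obtain A B where AB: "(A, B) \<in> P" "hyp_dist (f1 A) q \<le> R1" using near1[OF q(1)] by blast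
    have big: "\<tau>1 (f1 A) > \<bar>M4\<bar> + M1"
    proof (rule ccontr)
      assume "\<not> \<tau>1 (f1 A) > \<bar>M4\<bar> + M1"
      moreover have "\<tau>1 q \<le> 2 * cosh R1 * (\<tau>1 (f1 A) + 1)"
        unfolding \<tau>1_def using q AB f1_hyp[OF AB(1)] by (intro axis_ratio_le) (auto simp: hyp_dist_commute)
      moreover have "2 * cosh R1 * (\<tau>1 (f1 A) + 1) \<le> 2 * cosh R1 * (\<bar>M4\<bar> + M1 + 1)"
        using calculation(1) c0 by (intro mult_left_mono) auto
      ultimately show False using W(3) q(2) by linarith
    qed
    have "fst (f1 A) * fst q > 0"
      using AB q f1_hyp[OF AB(1)] big W M1 c0 by (intro same_side_of_axis[of _ _ R1]) (auto simp: \<tau>1_def)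
    then have "fst (f1 A) * e * W > 0" by (simp add: q_def mult.assoc)
    then have "fst (f1 A) * e > 0" using W(1) by (simp add: zero_less_mult_iff)
    moreover have "\<tau>2 (f2 B) > M3" using M4[OF AB(1)] big c0 by fastforce
    ultimately show ?thesis using AB f2_hyp[OF AB(1)] by (auto simp: \<Omega>_iff)
  qed
  have R20: "R2 \<ge> 0"
  proof -
    obtain A B where "(A, B) \<in> P" "hyp_dist (f2 B) (0, 1) \<le> R2" using near2[OF hyp_space_origin] by blast
    with hyp_dist_nonneg[OF f2_hyp hyp_space_origin] show ?thesis by fastforce
  qed
  have self: "hyp_dist q q = 0" for q :: "complex \<times> real" by (simp add: hyp_dist_def)
  obtain Ap Bp where p: "(Ap, Bp) \<in> P" "f2 Bp \<in> \<Omega>" "fst (f1 Ap) * 1 > 0" using point[of 1] by auto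
  obtain An Bn where n: "(An, Bn) \<in> P" "f2 Bn \<in> \<Omega>" "fst (f1 An) * (- 1) > 0" using point[of "- 1"] by auto
  \<comment> \<open>The orbit points on the two sides have partners in \<Omega>. Carrying the
    positive side from one partner to the other contradicts the negative sign there.\<close>
  have "pos (f2 Bp)" unfolding pos_def using p R20 by (intro exI[of _ Ap] exI[of _ Bp]) (simp add: self)
  then have "pos (f2 Bn)" using pos_const[OF p(2) n(2)] by simp
  then obtain A B where AB: "(A, B) \<in> P" "hyp_dist (f2 B) (f2 Bn) \<le> R2" "fst (f1 A) > 0" by (auto simp: pos_def)
  have "fst (f1 A) * fst (f1 An) > 0"
    using side[OF AB(1) n(1) n(2) n(2) _ AB(2)] R20 by (simp add: self)
  then show False using AB(3) n(3) by (simp add: zero_less_mult_iff)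
qed

section \<open>Subgroups of PSL(2,K) and their limit sets\<close>

lemma PSL2_mult:
  assumes "det A = 1" "det B = 1"
  shows "{A, - A} \<otimes>\<^bsub>PSL2\<^esub> {B, - B} = {A ** B, - (A ** B)}"
  by (auto simp: PSL2_def FactGroup_def set_mult_def SL2_def uminus_mat_mul)

lemma PSL2_one: "\<one>\<^bsub>PSL2\<^esub> = {mat 1, - mat 1}"
  by (simp add: PSL2_def FactGroup_def)

lemma PSL2_inv:
  fixes A :: "'a::field ^ 2 ^ 2"
  assumes "det A = 1"
  shows "inv\<^bsub>PSL2\<^esub> {A, - A} = {minv A, - minv A}"
  using assms
  by (intro group.inv_equality[OF group_PSL2])
    (auto simp: carrier_PSL2 PSL2_mult PSL2_one minv_mult)

lemma coset_eq:
  assumes "g \<in> carrier PSL2" "A \<in> g"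
  shows "det A = 1" "g = {A, - A}"
  using assms by (auto simp: carrier_PSL2 det_uminus_2)

lemma in_Union_iff:
  assumes "\<Gamma> \<subseteq> carrier PSL2"
  shows "A \<in> \<Union>\<Gamma> \<longleftrightarrow> {A, - A} \<in> \<Gamma>"
  using assms coset_eq(2) by blast

lemma det_of_in_Union: "\<Gamma> \<subseteq> carrier PSL2 \<Longrightarrow> A \<in> \<Union>\<Gamma> \<Longrightarrow> det A = 1"
  using coset_eq(1) by blast

lemma norm_matrix_mult_le:
  fixes A B :: "'a::real_normed_field ^ 2 ^ 2"
  shows "norm (A ** B) \<le> norm A * norm B"
  using frob_mult_le[of A B]
  by (simp add: frob_eq_norm power_mult_distrib[symmetric] power2_le_iff_abs_le)

lemma discrete_subgroup_separated:
  fixes \<Gamma> :: "('a::{real_normed_field,euclidean_space} ^ 2 ^ 2) set set"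
  assumes "discrete_subgroup \<Gamma>"
  shows "\<exists>e>0. \<forall>A \<in> \<Union>\<Gamma>. dist A (mat 1) < e \<longrightarrow> A = mat 1"
proof -
  have sub: "subgroup \<Gamma> PSL2" and disc: "subtopology PSL2_topology \<Gamma> = discrete_topology \<Gamma>"
    using assms by (auto simp: discrete_subgroup_def)
  have car: "\<Gamma> \<subseteq> carrier PSL2" using sub by (rule subgroup.subset)
  have one: "{mat 1, - mat 1} \<in> \<Gamma>" using subgroup.one_closed[OF sub] by (simp add: PSL2_one)
  have "openin (subtopology PSL2_topology \<Gamma>) {{mat 1, - mat 1}}" using one by (simp add: disc)
  then obtain U where U: "openin PSL2_topology U" "{{mat 1, - mat 1}} = U \<inter> \<Gamma>"
    by (auto simp: openin_subtopology)
  have Uc: "U \<subseteq> carrier PSL2" and open_U: "openin (top_of_set (carrier SL2)) (\<Union>U)"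
    using U(1) by (auto simp: openin_PSL2_topology)
  have "mat 1 \<in> \<Union>U" using U(2) by blast
  then obtain e where e: "e > 0" "\<And>A. A \<in> carrier SL2 \<Longrightarrow> dist A (mat 1) < e \<Longrightarrow> A \<in> \<Union>U"
    using open_U unfolding openin_euclidean_subtopology_iff by blast
  \<comment> \<open>The neighbourhood in the quotient only gives A = 1 or A = - 1; the cap 1 on the
    radius excludes - 1, which is at distance at least 2.\<close>
  have "A = mat 1" if A: "A \<in> \<Union>\<Gamma>" "dist A (mat 1) < min e 1" for A
  proof -
    have "A \<in> \<Union>U" using A det_of_in_Union[OF car A(1)] by (intro e(2)) (auto simp: SL2_def)
    then have "{A, - A} \<in> U" using in_Union_iff[OF Uc] by simp
    moreover have "{A, - A} \<in> \<Gamma>" using A in_Union_iff[OF car] by simp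
    ultimately have "{A, - A} \<in> U \<inter> \<Gamma>" by (rule IntI)
    then have "{A, - A} = {mat 1, - mat 1}" unfolding U(2)[symmetric] by (rule singletonD)
    then consider "A = mat 1" | "A = - mat 1" by (auto simp: doubleton_eq_iff)
    then show ?thesis
    proof cases
      case 2
      have "norm (- 2 :: 'a) \<le> norm ((A - mat 1) $ 1 $ 1)" by (simp add: 2 mat_def)
      also have "\<dots> \<le> norm (A - mat 1)" by (rule order_trans[OF Finite_Cartesian_Product.norm_nth_le Finite_Cartesian_Product.norm_nth_le])
      finally show ?thesis using A(2) by (simp add: dist_norm)
    qed
  qed
  with e(1) show ?thesis by (intro exI[of _ "min e 1"]) auto
qed

text \<open>Isolation of the identity spreads to norm balls: A^-1 B is within |A| * dist A B of the
  identity, so elements of bounded norm are uniformly separated, and infinitely many of them would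
  have a Cauchy subsequence.\<close>

lemma discrete_matrix_group_Union:
  fixes \<Gamma> :: "('a::{real_normed_field,euclidean_space} ^ 2 ^ 2) set set"
  assumes "discrete_subgroup \<Gamma>"
  shows "discrete_matrix_group (\<Union>\<Gamma>)"
proof -
  have sub: "subgroup \<Gamma> PSL2" using assms by (auto simp: discrete_subgroup_def)
  have car: "\<Gamma> \<subseteq> carrier PSL2" using sub by (rule subgroup.subset)
  note iff = in_Union_iff[OF car] and det = det_of_in_Union[OF car]
  have mult: "A ** B \<in> \<Union>\<Gamma>" if "A \<in> \<Union>\<Gamma>" "B \<in> \<Union>\<Gamma>" for A B
    using subgroup.m_closed[OF sub, of "{A, - A}" "{B, - B}"] that det by (simp only: iff PSL2_mult)
  have minv: "minv A \<in> \<Union>\<Gamma>" if "A \<in> \<Union>\<Gamma>" for A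
    using subgroup.m_inv_closed[OF sub, of "{A, - A}"] that det by (simp only: iff PSL2_inv)
  obtain e where e: "e > 0" "\<And>A. A \<in> \<Union>\<Gamma> \<Longrightarrow> dist A (mat 1) < e \<Longrightarrow> A = mat 1"
    using discrete_subgroup_separated[OF assms] by blast
  have sep: "A = B" if "A \<in> \<Union>\<Gamma>" "B \<in> \<Union>\<Gamma>" "norm A * dist A B < e" for A B
  proof -
    have "minv A ** B - mat 1 = minv A ** (B - A)"
      using matrix_mul_distrib(1)[of "minv A" "B - A" A] minv_mult(2)[OF det[OF that(1)]] by (simp add: algebra_simps)
    then have "dist (minv A ** B) (mat 1) \<le> norm (minv A) * norm (B - A)"
      by (simp add: dist_norm norm_matrix_mult_le)
    also have "norm (minv A) = norm A" using frob_minv[of A] by (simp add: frob_eq_norm power2_eq_iff_nonneg)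
    finally have "minv A ** B = mat 1" using that by (intro e(2) mult minv) (auto simp: dist_norm norm_minus_commute)
    then have "A ** (minv A ** B) = A" by simp
    moreover have "A ** (minv A ** B) = B" by (simp add: matrix_mul_assoc minv_mult(1)[OF det[OF that(1)]])
    ultimately show ?thesis by simp
  qed
  have "finite {A \<in> \<Union>\<Gamma>. frob A \<le> r}" for r
  proof (rule ccontr)
    let ?S = "{A \<in> \<Union>\<Gamma>. frob A \<le> r}"
    assume "infinite ?S"
    then obtain f :: "nat \<Rightarrow> 'a ^ 2 ^ 2" where f: "inj f" "range f \<subseteq> ?S"
      using infinite_countable_subset by blast
    have fn: "f n \<in> \<Union>\<Gamma>" "norm (f n) \<le> sqrt r" for n
      using f(2) by (auto simp: frob_eq_norm intro!: real_le_rsqrt)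
    have "bounded (range f)" using fn by (auto simp: bounded_iff)
    then obtain L s where s: "strict_mono s" and lim: "(f \<circ> s) \<longlonglongrightarrow> L"
      using bounded_imp_convergent_subsequence by blast
    have c: "sqrt r + 1 > 0" using fn(2)[of 0] norm_ge_zero[of "f 0"] by linarith
    have "Cauchy (f \<circ> s)" using lim by (rule LIMSEQ_imp_Cauchy)
    then obtain N where N: "\<And>m n. m \<ge> N \<Longrightarrow> n \<ge> N \<Longrightarrow> dist ((f \<circ> s) m) ((f \<circ> s) n) < e / (sqrt r + 1)"
      using e(1) c unfolding Cauchy_def by (meson divide_pos_pos)
    have "dist (f (s N)) (f (s (Suc N))) < e / (sqrt r + 1)" using N[of N "Suc N"] by simp
    then have "(sqrt r + 1) * dist (f (s N)) (f (s (Suc N))) < e" using c by (simp add: pos_less_divide_eq mult.commute)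
    moreover have "norm (f (s N)) * dist (f (s N)) (f (s (Suc N))) \<le> (sqrt r + 1) * dist (f (s N)) (f (s (Suc N)))"
      using fn(2)[of "s N"] by (intro mult_right_mono) auto
    ultimately have "f (s N) = f (s (Suc N))" using sep[OF fn(1) fn(1)] by simp
    then have "s N = s (Suc N)" using f(1) by (simp add: inj_eq)
    then show False using s by (metis lessI nat_neq_iff strict_mono_less)
  qed
  moreover have "mat 1 \<in> \<Union>\<Gamma>"
    using subgroup.one_closed[OF sub] by (simp only: iff PSL2_one)
  ultimately show ?thesis using det mult minv by unfold_locales auto
qed

lemma orbit_eq:
  fixes \<Gamma> :: "('a::real_normed_field ^ 2 ^ 2) set set"
  assumes "\<Gamma> \<subseteq> carrier PSL2"
  shows "(\<lambda>g. act g p) ` \<Gamma> = (\<lambda>A. mat_act A p) ` \<Union>\<Gamma>"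
proof -
  have act: "act g p = mat_act A p" if "g \<in> \<Gamma>" "A \<in> g" for g A
    using coset_eq(2)[of g A] that assms act_coset by blast
  have ne: "\<exists>A. A \<in> g" if "g \<in> \<Gamma>" for g using that assms by (auto simp: carrier_PSL2)
  show ?thesis
  proof (intro equalityI subsetI)
    fix x assume "x \<in> (\<lambda>g. act g p) ` \<Gamma>"
    then obtain g where g: "g \<in> \<Gamma>" "x = act g p" by blast
    moreover obtain A where "A \<in> g" using ne[OF g(1)] by blast
    ultimately show "x \<in> (\<lambda>A. mat_act A p) ` \<Union>\<Gamma>" using act by blast
  next
    fix x assume "x \<in> (\<lambda>A. mat_act A p) ` \<Union>\<Gamma>"
    then obtain g A where "g \<in> \<Gamma>" "A \<in> g" "x = mat_act A p" by blast
    then show "x \<in> (\<lambda>g. act g p) ` \<Gamma>" using act[of g A] by (intro image_eqI[of _ _ g]) simp_all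
  qed
qed

section \<open>Limit sets, their hulls and cocompactness\<close>

lemma ideal_boundary_hyp_space: "ideal_boundary (hyp_space :: ('a::real_normed_field \<times> real) set) = UNIV"
proof -
  have "(x, 0) \<in> closure (hyp_space :: ('a \<times> real) set)" for x
    unfolding closure_sequential
  proof (intro exI conjI allI)
    show "(x, inverse (real (Suc n))) \<in> hyp_space" for n by (simp add: hyp_space_def)
    show "(\<lambda>n. (x, inverse (real (Suc n)))) \<longlonglongrightarrow> (x, 0)"
      by (intro tendsto_Pair tendsto_const LIMSEQ_inverse_real_of_nat)
  qed
  moreover have "\<not> bounded (hyp_space :: ('a \<times> real) set)"
  proof
    assume "bounded (hyp_space :: ('a \<times> real) set)"
    then obtain B where B: "\<And>p. p \<in> (hyp_space :: ('a \<times> real) set) \<Longrightarrow> norm p \<le> B" by (auto simp: bounded_iff)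
    have "norm ((0::'a), \<bar>B\<bar> + 1) \<le> B" by (intro B) (simp add: hyp_space_def)
    then show False by (simp add: norm_Pair)
  qed
  ultimately show ?thesis
    by (auto simp: ideal_boundary_def image_iff)
qed

lemma limit_hull_subset: "limit_hull \<Gamma> \<subseteq> hyp_space"
proof -
  have "hyp_convex hyp_space" by (auto simp: hyp_convex_def geodesic_segment_def)
  then show ?thesis by (auto simp: limit_hull_def ideal_boundary_hyp_space)
qed

lemma hyp_convex_limit_hull: "hyp_convex (limit_hull \<Gamma>)"
  unfolding hyp_convex_def
proof (intro conjI ballI)
  show "limit_hull \<Gamma> \<subseteq> hyp_space" by (rule limit_hull_subset)
  fix p q assume "p \<in> limit_hull \<Gamma>" "q \<in> limit_hull \<Gamma>"
  then show "geodesic_segment p q \<subseteq> limit_hull \<Gamma>"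
    unfolding limit_hull_def hyp_convex_def by blast
qed

lemma chord_midpoint_in_limit_hull:
  fixes \<Gamma> :: "('a::{real_normed_field,euclidean_space} ^ 2 ^ 2) set set"
  assumes "Some x \<in> limit_set \<Gamma>" "Some y \<in> limit_set \<Gamma>" "x \<noteq> y"
  shows "((x + y) /\<^sub>R 2, norm (x - y) / 2) \<in> limit_hull \<Gamma>"
  unfolding limit_hull_def using assms chord_midpoint_in_hyp_convex by blast

text \<open>Both facts are read off from the hull being the union of the translates of K: this union
  is invariant, and K lies within bounded distance of q.\<close>

lemma limit_hull_cocompact:
  fixes \<Gamma> :: "('a::{real_normed_field,euclidean_space} ^ 2 ^ 2) set set"
  assumes cc: "convex_cocompact \<Gamma>" and q: "q \<in> limit_hull \<Gamma>"
  shows "A \<in> \<Union>\<Gamma> \<Longrightarrow> mat_act A q \<in> limit_hull \<Gamma>"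
    and "\<exists>R. \<forall>p\<in>limit_hull \<Gamma>. \<exists>A\<in>\<Union>\<Gamma>. hyp_dist (mat_act A q) p \<le> R"
proof -
  have disc: "discrete_subgroup \<Gamma>" using cc by (simp add: convex_cocompact_def)
  have car: "\<Gamma> \<subseteq> carrier PSL2" using disc by (auto simp: discrete_subgroup_def dest: subgroup.subset)
  interpret discrete_matrix_group "\<Union>\<Gamma>" using disc by (rule discrete_matrix_group_Union)
  obtain K where K: "compact K" "K \<subseteq> limit_hull \<Gamma>" "limit_hull \<Gamma> = (\<Union>g\<in>\<Gamma>. act g ` K)"
    using cc by (auto simp: convex_cocompact_def)
  have Kh: "K \<subseteq> hyp_space" using K limit_hull_subset by blast
  have hull: "p \<in> limit_hull \<Gamma> \<longleftrightarrow> (\<exists>A\<in>\<Union>\<Gamma>. \<exists>k\<in>K. p = mat_act A k)" for p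
  proof -
    have "p \<in> limit_hull \<Gamma> \<longleftrightarrow> (\<exists>k\<in>K. p \<in> (\<lambda>g. act g k) ` \<Gamma>)" unfolding K(3) by auto
    then show ?thesis unfolding orbit_eq[OF car] by auto
  qed
  show "mat_act A q \<in> limit_hull \<Gamma>" if A: "A \<in> \<Union>\<Gamma>"
  proof -
    obtain B k where B: "B \<in> \<Union>\<Gamma>" "k \<in> K" "q = mat_act B k" using q hull by blast
    have "k \<in> hyp_space" using B Kh by blast
    then have "mat_act A q = mat_act (A ** B) k"
      unfolding B(3) by (rule mat_act_mult[OF det_one[OF A] det_one[OF B(1)], symmetric])
    moreover have "A ** B \<in> \<Union>\<Gamma>" using A B by (intro mult_in)
    ultimately show ?thesis using B(2) hull by blast
  qed
  have qh: "q \<in> hyp_space" using q limit_hull_subset by blast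
  have "continuous_on K (\<lambda>k. 1 + (dist q k)\<^sup>2 / (2 * snd q * snd k))"
    using qh Kh by (intro continuous_intros) (auto simp: hyp_space_def)
  then have "bounded ((\<lambda>k. 1 + (dist q k)\<^sup>2 / (2 * snd q * snd k)) ` K)"
    using K(1) compact_continuous_image compact_imp_bounded by blast
  then obtain b where b: "\<And>k. k \<in> K \<Longrightarrow> \<bar>1 + (dist q k)\<^sup>2 / (2 * snd q * snd k)\<bar> \<le> b"
    by (auto simp: bounded_iff)
  have R: "hyp_dist q k \<le> 2 * b" if k: "k \<in> K" for k
  proof -
    have kh: "k \<in> hyp_space" using k Kh by blast
    have "hyp_dist q k \<le> exp (hyp_dist q k)" using exp_ge_add_one_self[of "hyp_dist q k"] by linarith
    also have "\<dots> \<le> 2 * cosh (hyp_dist q k)" by (simp add: cosh_def)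
    also have "cosh (hyp_dist q k) \<le> b" using b[OF k] by (simp add: cosh_hyp_dist[OF qh kh])
    finally show ?thesis by simp
  qed
  have "\<exists>A\<in>\<Union>\<Gamma>. hyp_dist (mat_act A q) p \<le> 2 * b" if p: "p \<in> limit_hull \<Gamma>" for p
  proof -
    obtain A k where A: "A \<in> \<Union>\<Gamma>" "k \<in> K" "p = mat_act A k" using p hull by blast
    have "k \<in> hyp_space" using A Kh by blast
    then have "hyp_dist (mat_act A q) p = hyp_dist q k"
      using qh unfolding A(3) by (intro hyp_dist_mat_act det_one A(1)) auto
    with R[OF A(2)] A(1) show ?thesis by force
  qed
  then show "\<exists>R. \<forall>p\<in>limit_hull \<Gamma>. \<exists>A\<in>\<Union>\<Gamma>. hyp_dist (mat_act A q) p \<le> R" by blast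
qed

lemma exponent_below_dimension:
  fixes \<Gamma> :: "('a::{real_normed_field,euclidean_space} ^ 2 ^ 2) set set"
  assumes cc: "convex_cocompact \<Gamma>" and ne: "non_elementary \<Gamma>" and gap: "limit_set \<Gamma> \<noteq> UNIV"
  shows "\<exists>s. 0 < s \<and> s < real DIM('a) \<and> (\<lambda>A. exp (- s * hyp_dist (mat_act A (0, 1)) (0, 1))) summable_on \<Union>\<Gamma>"
proof -
  have disc: "discrete_subgroup \<Gamma>" using cc by (simp add: convex_cocompact_def)
  have car: "\<Gamma> \<subseteq> carrier PSL2" using disc by (auto simp: discrete_subgroup_def dest: subgroup.subset)
  interpret discrete_matrix_group "\<Union>\<Gamma>" using disc by (rule discrete_matrix_group_Union)
  have lim: "limit_set \<Gamma> = ideal_boundary ((\<lambda>A. mat_act A (0, 1)) ` \<Union>\<Gamma>)"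
    unfolding limit_set_def orbit_eq[OF car] ..
  obtain \<xi> where \<xi>: "\<xi> \<notin> limit_set \<Gamma>" using gap by blast
  have sum: "(\<lambda>A. exp (- real DIM('a) * displacement A)) summable_on \<Union>\<Gamma>"
  proof (cases \<xi>)
    case None
    with \<xi> have "bounded ((\<lambda>A. mat_act A (0, 1)) ` \<Union>\<Gamma>)" by (auto simp: lim ideal_boundary_def split: if_splits)
    then show ?thesis by (intro summable_at_dimension disjI1)
  next
    case (Some x)
    with \<xi> have "(x, 0) \<notin> closure ((\<lambda>A. mat_act A (0, 1)) ` \<Union>\<Gamma>)" by (auto simp: lim ideal_boundary_def)
    then show ?thesis by (intro summable_at_dimension disjI2)
  qed
  \<comment> \<open>Of three limit points at most one is infinity; two finite ones supply a point of
    the hull to serve as base point.\<close>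
  have "\<exists>x y. x \<noteq> y \<and> Some x \<in> limit_set \<Gamma> \<and> Some y \<in> limit_set \<Gamma>"
  proof (rule ccontr)
    assume no: "\<not> ?thesis"
    have "\<exists>z. limit_set \<Gamma> \<subseteq> {None, z}"
    proof (cases "\<exists>x. Some x \<in> limit_set \<Gamma>")
      case True
      then obtain x where "Some x \<in> limit_set \<Gamma>" by blast
      with no have "limit_set \<Gamma> \<subseteq> {None, Some x}" by (metis insertCI not_Some_eq subsetI)
      then show ?thesis by blast
    next
      case False
      then have "limit_set \<Gamma> \<subseteq> {None, None}" by (metis insertCI not_Some_eq subsetI)
      then show ?thesis by blast
    qed
    then obtain z where z: "limit_set \<Gamma> \<subseteq> {None, z}" by blast
    then have "finite (limit_set \<Gamma>)" by (rule finite_subset) simp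
    moreover have "card (limit_set \<Gamma>) \<le> card {None, z}" using z by (intro card_mono) auto
    moreover have "card {None, z} \<le> 2" by (simp add: card_insert_if)
    ultimately show False using ne by (simp add: non_elementary_def)
  qed
  then obtain q where q: "q \<in> limit_hull \<Gamma>" using chord_midpoint_in_limit_hull by blast
  obtain R where R: "\<And>p. p \<in> limit_hull \<Gamma> \<Longrightarrow> \<exists>A\<in>\<Union>\<Gamma>. hyp_dist (mat_act A q) p \<le> R"
    using limit_hull_cocompact(2)[OF cc q] by blast
  show ?thesis
    by (rule summable_below_of_cocompact_convex[OF hyp_convex_limit_hull q limit_hull_cocompact(1)[OF cc q] R _ sum]) simp_all
qed

text \<open>Every point (z, t) is the top of the half circle from z - t to z + t. If all boundary
  points are limit points, the hull is therefore the whole space.\<close>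

lemma cocompact_of_full_limit_set:
  fixes \<Gamma> :: "('a::{real_normed_field,euclidean_space} ^ 2 ^ 2) set set"
  assumes cc: "convex_cocompact \<Gamma>" and full: "limit_set \<Gamma> = UNIV"
  shows "\<exists>R. \<forall>p\<in>hyp_space. \<exists>A\<in>\<Union>\<Gamma>. hyp_dist (mat_act A (0, 1)) p \<le> R"
proof -
  have "p \<in> limit_hull \<Gamma>" if p: "p \<in> hyp_space" for p :: "'a \<times> real"
  proof -
    obtain z t where zt: "p = (z, t)" "t > 0" using p by (auto simp: hyp_space_def)
    have "((z + of_real t + (z - of_real t)) /\<^sub>R 2, norm (z + of_real t - (z - of_real t)) / 2) \<in> limit_hull \<Gamma>"
      using zt full by (intro chord_midpoint_in_limit_hull) (auto simp: eq_diff_eq add_eq_0_iff2)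
    moreover have "(z + of_real t + (z - of_real t)) /\<^sub>R 2 = z"
      by (simp add: scaleR_2[symmetric])
    moreover have "norm (z + of_real t - (z - of_real t)) / 2 = t"
      using zt by (simp add: mult_2[symmetric] norm_mult)
    ultimately show ?thesis by (simp add: zt)
  qed
  moreover from this have "(0, 1) \<in> limit_hull \<Gamma>" by simp
  ultimately show ?thesis using limit_hull_cocompact(2)[OF cc] by meson
qed

lemma summable_on_cosets:
  fixes \<Gamma> :: "('a::real_normed_field ^ 2 ^ 2) set set" and f :: "'a \<times> real \<Rightarrow> real"
  assumes car: "\<Gamma> \<subseteq> carrier PSL2" and sum: "(\<lambda>A. f (mat_act A p)) summable_on \<Union>\<Gamma>"
  shows "(\<lambda>g. f (act g p)) summable_on \<Gamma>"
proof -
  define rep where "rep g = (SOME A. A \<in> g)" for g :: "('a ^ 2 ^ 2) set"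
  have "\<exists>A. A \<in> g" if "g \<in> \<Gamma>" for g using that car by (auto simp: carrier_PSL2)
  then have rep: "rep g \<in> g" if "g \<in> \<Gamma>" for g using that unfolding rep_def by (meson someI_ex)
  then have eq: "g = {rep g, - rep g}" if "g \<in> \<Gamma>" for g using coset_eq(2) that car by blast
  have inj: "inj_on rep \<Gamma>" by (rule inj_onI) (metis eq)
  have "(\<lambda>A. f (mat_act A p)) summable_on rep ` \<Gamma>"
    using rep by (intro summable_on_subset[OF sum]) auto
  then have "(\<lambda>g. f (mat_act (rep g) p)) summable_on \<Gamma>"
    by (simp add: summable_on_reindex[OF inj] o_def)
  moreover have "act g p = mat_act (rep g) p" if "g \<in> \<Gamma>" for g
    using eq[OF that] act_coset by metis
  ultimately show ?thesis by (simp cong: summable_on_cong)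
qed

lemma act_in_hyp_space:
  assumes "g \<in> carrier PSL2" "q \<in> hyp_space"
  shows "act g q \<in> hyp_space"
  using assms by (auto simp: carrier_PSL2 act_coset mat_act_in_hyp_space)

lemma summable_on_group_elements:
  fixes \<Gamma> :: "('a::{real_normed_field,euclidean_space} ^ 2 ^ 2) set set"
  assumes disc: "discrete_subgroup \<Gamma>" and q: "q \<in> hyp_space" and "s \<ge> 0"
    and sum: "(\<lambda>A. exp (- s * hyp_dist (mat_act A (0, 1)) (0, 1))) summable_on \<Union>\<Gamma>"
  shows "(\<lambda>g. exp (- s * hyp_dist (act g q) q)) summable_on \<Gamma>"
proof (rule summable_on_cosets)
  interpret discrete_matrix_group "\<Union>\<Gamma>" using disc by (rule discrete_matrix_group_Union)
  show "\<Gamma> \<subseteq> carrier PSL2" using disc by (auto simp: discrete_subgroup_def dest: subgroup.subset)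
  show "(\<lambda>A. exp (- s * hyp_dist (mat_act A q) q)) summable_on \<Union>\<Gamma>"
    by (rule summable_change_base[OF hyp_space_origin q \<open>s \<ge> 0\<close> sum])
qed

text \<open>Finiteness over norm balls holds because a matrix has at most two partners: the lifts of
  the image coset in one direction and, by injectivity, those of the preimage coset in the
  other.\<close>

lemma matrix_pair_group_of_hom:
  fixes \<Gamma> :: "('a::{real_normed_field,euclidean_space} ^ 2 ^ 2) set set"
    and \<rho> :: "('a ^ 2 ^ 2) set \<Rightarrow> ('b::{real_normed_field,euclidean_space} ^ 2 ^ 2) set"
  assumes disc: "discrete_subgroup \<Gamma>" "discrete_subgroup (\<rho> ` \<Gamma>)"
    and hom: "\<rho> \<in> hom (PSL2\<lparr>carrier := \<Gamma>\<rparr>) PSL2" and inj: "inj_on \<rho> \<Gamma>"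
  shows "matrix_pair_group {(A, B). {A, - A} \<in> \<Gamma> \<and> \<rho> {A, - A} = {B, - B}}"
proof -
  have sub: "subgroup \<Gamma> PSL2" "subgroup (\<rho> ` \<Gamma>) PSL2" using disc by (auto simp: discrete_subgroup_def)
  have car: "\<Gamma> \<subseteq> carrier PSL2" "\<rho> ` \<Gamma> \<subseteq> carrier PSL2" using sub by (auto dest: subgroup.subset)
  interpret G: discrete_matrix_group "\<Union>\<Gamma>" using disc(1) by (rule discrete_matrix_group_Union)
  interpret H: discrete_matrix_group "\<Union>(\<rho> ` \<Gamma>)" using disc(2) by (rule discrete_matrix_group_Union)
  let ?P = "{(A, B). {A, - A} \<in> \<Gamma> \<and> \<rho> {A, - A} = {B, - B}}"
  have inG: "A \<in> \<Union>\<Gamma>" and inH: "B \<in> \<Union>(\<rho> ` \<Gamma>)" if "(A, B) \<in> ?P" for A B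
    using that by auto
  have detA: "det A = 1" and detB: "det B = 1" if "(A, B) \<in> ?P" for A B
    using G.det_one[OF inG[OF that]] H.det_one[OF inH[OF that]] by auto
  interpret hom: group_hom "PSL2\<lparr>carrier := \<Gamma>\<rparr>" PSL2 \<rho>
    using hom by (intro group_hom.intro group_hom_axioms.intro group_PSL2 subgroup.subgroup_is_group sub)
  have \<rho>_mult: "\<rho> (g \<otimes>\<^bsub>PSL2\<^esub> h) = \<rho> g \<otimes>\<^bsub>PSL2\<^esub> \<rho> h" if "g \<in> \<Gamma>" "h \<in> \<Gamma>" for g h
    using hom.hom_mult[of g h] that by simp
  show ?thesis
  proof
    show "det A = 1" "det B = 1" if "(A, B) \<in> ?P" for A B using detA[OF that] detB[OF that] by auto
    show mult: "(A ** A', B ** B') \<in> ?P" if 1: "(A, B) \<in> ?P" and 2: "(A', B') \<in> ?P" for A B A' B'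
    proof -
      have "{A, - A} \<in> \<Gamma>" "{A', - A'} \<in> \<Gamma>" "\<rho> {A, - A} = {B, - B}" "\<rho> {A', - A'} = {B', - B'}"
        using 1 2 by auto
      then show ?thesis
        using subgroup.m_closed[OF sub(1), of "{A, - A}" "{A', - A'}"] \<rho>_mult[of "{A, - A}" "{A', - A'}"]
        by (simp add: PSL2_mult detA[OF 1] detA[OF 2] detB[OF 1] detB[OF 2])
    qed
    show "(mat 1, mat 1) \<in> ?P"
      using subgroup.one_closed[OF sub(1)] hom.hom_one by (simp add: PSL2_one)
    show "(minv A, minv B) \<in> ?P" if 1: "(A, B) \<in> ?P" for A B
    proof -
      have A: "{A, - A} \<in> \<Gamma>" "\<rho> {A, - A} = {B, - B}" using 1 by auto
      have i: "inv\<^bsub>PSL2\<^esub> {A, - A} \<in> \<Gamma>" using subgroup.m_inv_closed[OF sub(1) A(1)] .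
      have "\<rho> (inv\<^bsub>PSL2\<^esub> {A, - A}) = inv\<^bsub>PSL2\<^esub> (\<rho> {A, - A})"
        using hom.hom_inv[of "{A, - A}"] A(1) group.m_inv_consistent[OF group_PSL2 sub(1) A(1)] by simp
      with i show ?thesis by (simp add: A(2) PSL2_inv detA[OF 1] detB[OF 1])
    qed
    have fib1: "finite {B. \<rho> {A, - A} = {B, - B}}" for A
    proof (cases "\<exists>B. \<rho> {A, - A} = {B, - B}")
      case True
      then obtain B where "\<rho> {A, - A} = {B, - B}" by blast
      then have "{B. \<rho> {A, - A} = {B, - B}} \<subseteq> {B, - B}" by auto
      then show ?thesis by (rule finite_subset) simp
    qed simp
    show "finite {(A, B) \<in> ?P. frob A \<le> r}" for r
    proof (rule finite_subset)
      show "{(A, B) \<in> ?P. frob A \<le> r} \<subseteq> (SIGMA A : {A \<in> \<Union>\<Gamma>. frob A \<le> r}. {B. \<rho> {A, - A} = {B, - B}})"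
        using inG by auto
      show "finite (SIGMA A : {A \<in> \<Union>\<Gamma>. frob A \<le> r}. {B. \<rho> {A, - A} = {B, - B}})"
        by (intro finite_SigmaI G.finite_frob fib1)
    qed
    have fib2: "finite {A. {A, - A} \<in> \<Gamma> \<and> \<rho> {A, - A} = {B, - B}}" for B
    proof (cases "\<exists>A. {A, - A} \<in> \<Gamma> \<and> \<rho> {A, - A} = {B, - B}")
      case True
      then obtain A where A: "{A, - A} \<in> \<Gamma>" "\<rho> {A, - A} = {B, - B}" by blast
      have "A' \<in> {A, - A}" if "{A', - A'} \<in> \<Gamma>" "\<rho> {A', - A'} = {B, - B}" for A'
        using inj_onD[OF inj, of "{A', - A'}" "{A, - A}"] A that by auto
      then have "{A. {A, - A} \<in> \<Gamma> \<and> \<rho> {A, - A} = {B, - B}} \<subseteq> {A, - A}" by blast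
      then show ?thesis by (rule finite_subset) simp
    next
      case False
      then have "{A. {A, - A} \<in> \<Gamma> \<and> \<rho> {A, - A} = {B, - B}} = {}" by blast
      then show ?thesis by (simp only: finite.emptyI)
    qed
    show "finite {(A, B) \<in> ?P. frob B \<le> r}" for r
    proof (rule finite_surj)
      show "finite (SIGMA B : {B \<in> \<Union>(\<rho> ` \<Gamma>). frob B \<le> r}. {A. {A, - A} \<in> \<Gamma> \<and> \<rho> {A, - A} = {B, - B}})"
        by (intro finite_SigmaI H.finite_frob fib2)
      show "{(A, B) \<in> ?P. frob B \<le> r} \<subseteq> prod.swap ` (SIGMA B : {B \<in> \<Union>(\<rho> ` \<Gamma>). frob B \<le> r}. {A. {A, - A} \<in> \<Gamma> \<and> \<rho> {A, - A} = {B, - B}})"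
        using inH by force
    qed
  qed
qed

section \<open>The critical exponent on the product\<close>

text \<open>By the Cauchy-Schwarz inequality, \<open>s * sqrt (x\<^sup>2 + y\<^sup>2)\<close> dominates a convex combination of
  \<open>s1 * x\<close> and \<open>s2 * y\<close>.\<close>

lemma exp_l2_norm_le:
  fixes s1 s2 x y :: real
  assumes "s1 > 0" "s2 > 0" "x \<ge> 0" "y \<ge> 0"
  shows "exp (- (1 / sqrt (1 / s1\<^sup>2 + 1 / s2\<^sup>2)) * sqrt (x\<^sup>2 + y\<^sup>2)) \<le> exp (- s1 * x) + exp (- s2 * y)"
proof -
  define S where "S = 1 / s1\<^sup>2 + 1 / s2\<^sup>2"
  have S: "S > 0" using assms by (simp add: S_def add_pos_pos)
  \<comment> \<open>Both x >= m / s1 and y >= m / s2, so pairing (x, y) with (1 / s1, 1 / s2) bounds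
    m; and exp (- m) is one of the two terms on the right.\<close>
  define m where "m = min (s1 * x) (s2 * y)"
  have m: "m * (1 / s1) \<le> x" "m * (1 / s2) \<le> y"
    using assms by (simp_all add: m_def field_simps min_def)
  have "m * S = (m * (1 / s1)) * (1 / s1) + (m * (1 / s2)) * (1 / s2)"
    by (simp add: S_def power2_eq_square algebra_simps)
  also have "\<dots> \<le> x * (1 / s1) + y * (1 / s2)"
    using m assms by (intro add_mono mult_right_mono) auto
  also have "\<dots> = inner (x, y) (1 / s1, 1 / s2)" by simp
  also have "\<dots> \<le> norm (x, y) * norm (1 / s1, 1 / s2)" by (rule norm_cauchy_schwarz)
  also have "\<dots> = sqrt (x\<^sup>2 + y\<^sup>2) * sqrt S" by (simp add: norm_Pair S_def power_divide)
  finally have "m * sqrt S * sqrt S \<le> sqrt (x\<^sup>2 + y\<^sup>2) * sqrt S" using S by (simp add: mult.assoc)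
  then have "m * sqrt S \<le> sqrt (x\<^sup>2 + y\<^sup>2)" using S by simp
  then have "m \<le> (1 / sqrt S) * sqrt (x\<^sup>2 + y\<^sup>2)" using S by (simp add: field_simps)
  then have "exp (- (1 / sqrt S) * sqrt (x\<^sup>2 + y\<^sup>2)) \<le> exp (- m)" by simp
  also have "\<dots> \<le> exp (- s1 * x) + exp (- s2 * y)" by (auto simp: m_def min_def)
  finally show ?thesis by (simp add: S_def)
qed

text \<open>The gain from an exponent s below a leaves room to take the other exponent slightly
  above its dimension b, where convergence is always available.\<close>

lemma exists_near_with_reciprocal_squares:
  fixes a b s :: real
  assumes "0 < s" "s < a" "b > 0"
  shows "\<exists>s'>b. 1 / s\<^sup>2 + 1 / s'\<^sup>2 > 1 / a\<^sup>2 + 1 / b\<^sup>2"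
proof -
  have "((\<lambda>s'. 1 / s\<^sup>2 + 1 / s'\<^sup>2) \<longlongrightarrow> 1 / s\<^sup>2 + 1 / b\<^sup>2) (at_right b)"
    using assms by (intro tendsto_intros) auto
  moreover have "1 / a\<^sup>2 < 1 / s\<^sup>2"
    using assms by (intro divide_strict_left_mono power_strict_mono mult_pos_pos) auto
  ultimately have "\<forall>\<^sub>F s' in at_right b. 1 / a\<^sup>2 + 1 / b\<^sup>2 < 1 / s\<^sup>2 + 1 / s'\<^sup>2"
    by (intro order_tendstoD(1)) auto
  then have "\<forall>\<^sub>F s' in at_right b. s' > b \<and> 1 / a\<^sup>2 + 1 / b\<^sup>2 < 1 / s\<^sup>2 + 1 / s'\<^sup>2"
    using eventually_at_right_less by (rule eventually_elim2) auto
  then show ?thesis using eventually_happens'[OF trivial_limit_at_right_real] by blast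
qed

theorem corollary1p9:
  fixes \<Gamma>\<^sub>0 :: "(real ^ 2 ^ 2) set set"
    and \<rho>\<^sub>0 :: "(real ^ 2 ^ 2) set \<Rightarrow> (complex ^ 2 ^ 2) set"
    and p :: "(real \<times> real) \<times> (complex \<times> real)"
  assumes "subgroup \<Gamma>\<^sub>0 PSL2R"
    and "non_elementary \<Gamma>\<^sub>0"
    and "convex_cocompact \<Gamma>\<^sub>0"
    and "\<rho>\<^sub>0 \<in> hom (PSL2R\<lparr>carrier := \<Gamma>\<^sub>0\<rparr>) PSL2C"
    and "inj_on \<rho>\<^sub>0 \<Gamma>\<^sub>0"
    and "non_elementary (\<rho>\<^sub>0 ` \<Gamma>\<^sub>0)"
    and "convex_cocompact (\<rho>\<^sub>0 ` \<Gamma>\<^sub>0)"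
    and "zariski_dense (\<rho>\<^sub>0 ` \<Gamma>\<^sub>0)"
    and "p \<in> H2 \<times> H3"
  shows "critical_exponent p {(\<gamma>, \<rho>\<^sub>0 \<gamma>) |\<gamma>. \<gamma> \<in> \<Gamma>\<^sub>0} < ereal (2 / sqrt 5)"
proof -
  have disc: "discrete_subgroup \<Gamma>\<^sub>0" "discrete_subgroup (\<rho>\<^sub>0 ` \<Gamma>\<^sub>0)"
    using assms(3,7) by (auto simp: convex_cocompact_def)
  have car: "\<Gamma>\<^sub>0 \<subseteq> carrier PSL2" "\<rho>\<^sub>0 ` \<Gamma>\<^sub>0 \<subseteq> carrier PSL2"
    using disc by (auto simp: discrete_subgroup_def dest: subgroup.subset)
  interpret G: discrete_matrix_group "\<Union>\<Gamma>\<^sub>0" using disc(1) by (rule discrete_matrix_group_Union)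
  interpret H: discrete_matrix_group "\<Union>(\<rho>\<^sub>0 ` \<Gamma>\<^sub>0)" using disc(2) by (rule discrete_matrix_group_Union)
  let ?S1 = "\<lambda>s. (\<lambda>A. exp (- s * hyp_dist (mat_act A (0, 1)) (0, 1))) summable_on \<Union>\<Gamma>\<^sub>0"
  let ?S2 = "\<lambda>s. (\<lambda>A. exp (- s * hyp_dist (mat_act A (0, 1)) (0, 1))) summable_on \<Union>(\<rho>\<^sub>0 ` \<Gamma>\<^sub>0)"
  have "\<not> (limit_set \<Gamma>\<^sub>0 = UNIV \<and> limit_set (\<rho>\<^sub>0 ` \<Gamma>\<^sub>0) = UNIV)"
  proof
    assume full: "limit_set \<Gamma>\<^sub>0 = UNIV \<and> limit_set (\<rho>\<^sub>0 ` \<Gamma>\<^sub>0) = UNIV"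
    obtain R1 where R1: "\<And>q. q \<in> hyp_space \<Longrightarrow> \<exists>A\<in>\<Union>\<Gamma>\<^sub>0. hyp_dist (mat_act A (0, 1)) q \<le> R1"
      using cocompact_of_full_limit_set[OF assms(3)] full by blast
    obtain R2 where R2: "\<And>q. q \<in> hyp_space \<Longrightarrow> \<exists>B\<in>\<Union>(\<rho>\<^sub>0 ` \<Gamma>\<^sub>0). hyp_dist (mat_act B (0, 1)) q \<le> R2"
      using cocompact_of_full_limit_set[OF assms(7)] full by blast
    let ?P = "{(A, B). {A, - A} \<in> \<Gamma>\<^sub>0 \<and> \<rho>\<^sub>0 {A, - A} = {B, - B}}"
    show False
    proof (rule no_cocompact_pair[OF matrix_pair_group_of_hom[OF disc assms(4,5)]])
      fix q :: "real \<times> real" assume "q \<in> hyp_space"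
      then obtain A where A: "A \<in> \<Union>\<Gamma>\<^sub>0" "hyp_dist (mat_act A (0, 1)) q \<le> R1" using R1 by blast
      then have AG: "{A, - A} \<in> \<Gamma>\<^sub>0" using in_Union_iff[OF car(1)] by blast
      then obtain B where "\<rho>\<^sub>0 {A, - A} = {B, - B}" using car(2) by (force simp: carrier_PSL2)
      with AG A show "\<exists>(A, B)\<in>?P. hyp_dist (mat_act A (0, 1)) q \<le> R1" by blast
    next
      fix q :: "complex \<times> real" assume "q \<in> hyp_space"
      then obtain B where B: "B \<in> \<Union>(\<rho>\<^sub>0 ` \<Gamma>\<^sub>0)" "hyp_dist (mat_act B (0, 1)) q \<le> R2" using R2 by blast
      then have "{B, - B} \<in> \<rho>\<^sub>0 ` \<Gamma>\<^sub>0" using in_Union_iff[OF car(2)] by blast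
      then obtain g where g: "g \<in> \<Gamma>\<^sub>0" "\<rho>\<^sub>0 g = {B, - B}" by force
      then obtain A where "g = {A, - A}" using car(1) by (force simp: carrier_PSL2)
      with g B show "\<exists>(A, B)\<in>?P. hyp_dist (mat_act B (0, 1)) q \<le> R2" by blast
    qed
  qed
  \<comment> \<open>The value 5/4 is 1 / 1^2 + 1 / 2^2 for the boundary dimensions 1 and 2. It is
    exceeded strictly whichever of the two limit sets has a gap.\<close>
  then have "\<exists>s1>0. \<exists>s2>0. ?S1 s1 \<and> ?S2 s2 \<and> 1 / s1\<^sup>2 + 1 / s2\<^sup>2 > 5 / 4"
  proof (cases "limit_set \<Gamma>\<^sub>0 = UNIV")
    case False
    obtain s1 where s1: "0 < s1" "s1 < 1" "?S1 s1"
      using exponent_below_dimension[OF assms(3,2) False] by auto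
    obtain s2 where s2: "s2 > 2" "1 / s1\<^sup>2 + 1 / s2\<^sup>2 > 1 / 1\<^sup>2 + 1 / 2\<^sup>2"
      using exists_near_with_reciprocal_squares[OF s1(1,2), of 2] by auto
    have "?S2 s2" using s2 by (intro H.summable_above_dimension) simp
    with s1 s2 show ?thesis by (intro exI[of _ s1] conjI exI[of _ s2]) auto
  next
    case True
    assume "\<not> (limit_set \<Gamma>\<^sub>0 = UNIV \<and> limit_set (\<rho>\<^sub>0 ` \<Gamma>\<^sub>0) = UNIV)"
    with True have "limit_set (\<rho>\<^sub>0 ` \<Gamma>\<^sub>0) \<noteq> UNIV" by blast
    then obtain s2 where s2: "0 < s2" "s2 < 2" "?S2 s2"
      using exponent_below_dimension[OF assms(7,6)] by auto
    obtain s1 where s1: "s1 > 1" "1 / s2\<^sup>2 + 1 / s1\<^sup>2 > 1 / 2\<^sup>2 + 1 / 1\<^sup>2"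
      using exists_near_with_reciprocal_squares[OF s2(1,2), of 1] by auto
    have "?S1 s1" using s1 by (intro G.summable_above_dimension) simp
    with s1 s2 show ?thesis by (intro exI[of _ s1] conjI exI[of _ s2]) auto
  qed
  then obtain s1 s2 where s: "s1 > 0" "s2 > 0" "?S1 s1" "?S2 s2" "1 / s1\<^sup>2 + 1 / s2\<^sup>2 > 5 / 4" by blast
  define s where "s = 1 / sqrt (1 / s1\<^sup>2 + 1 / s2\<^sup>2)"
  let ?d1 = "\<lambda>\<gamma>. hyp_dist (act \<gamma> (fst p)) (fst p)" and ?d2 = "\<lambda>\<gamma>. hyp_dist (act (\<rho>\<^sub>0 \<gamma>) (snd p)) (snd p)"
  have p: "fst p \<in> hyp_space" "snd p \<in> hyp_space" using assms(9) by auto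
  have "(\<lambda>\<gamma>. exp (- s1 * ?d1 \<gamma>)) summable_on \<Gamma>\<^sub>0"
    using s by (intro summable_on_group_elements disc p) auto
  moreover have "(\<lambda>g. exp (- s2 * hyp_dist (act g (snd p)) (snd p))) summable_on \<rho>\<^sub>0 ` \<Gamma>\<^sub>0"
    using s by (intro summable_on_group_elements disc p) auto
  then have "(\<lambda>\<gamma>. exp (- s2 * ?d2 \<gamma>)) summable_on \<Gamma>\<^sub>0"
    by (simp add: summable_on_reindex[OF assms(5)] o_def)
  ultimately have "(\<lambda>\<gamma>. exp (- s1 * ?d1 \<gamma>) + exp (- s2 * ?d2 \<gamma>)) summable_on \<Gamma>\<^sub>0"
    by (rule summable_on_add)
  then have "(\<lambda>\<gamma>. exp (- s * sqrt ((?d1 \<gamma>)\<^sup>2 + (?d2 \<gamma>)\<^sup>2))) summable_on \<Gamma>\<^sub>0"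
  proof (rule summable_on_comparison_test)
    fix \<gamma> assume \<gamma>: "\<gamma> \<in> \<Gamma>\<^sub>0"
    then have "\<gamma> \<in> carrier PSL2" "\<rho>\<^sub>0 \<gamma> \<in> carrier PSL2" using car by auto
    then have "?d1 \<gamma> \<ge> 0" "?d2 \<gamma> \<ge> 0" using p by (simp_all add: hyp_dist_nonneg act_in_hyp_space)
    then show "exp (- s * sqrt ((?d1 \<gamma>)\<^sup>2 + (?d2 \<gamma>)\<^sup>2)) \<le> exp (- s1 * ?d1 \<gamma>) + exp (- s2 * ?d2 \<gamma>)"
      unfolding s_def by (intro exp_l2_norm_le s)
  qed simp
  moreover have "inj_on (\<lambda>\<gamma>. (\<gamma>, \<rho>\<^sub>0 \<gamma>)) \<Gamma>\<^sub>0" by (auto simp: inj_on_def)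
  ultimately have "(\<lambda>\<gamma>. exp (- s * prod_dist (prod_act \<gamma> p) p)) summable_on (\<lambda>\<gamma>. (\<gamma>, \<rho>\<^sub>0 \<gamma>)) ` \<Gamma>\<^sub>0"
    by (subst summable_on_reindex) (simp_all add: o_def prod_dist_def prod_act_def)
  moreover have "(\<lambda>\<gamma>. (\<gamma>, \<rho>\<^sub>0 \<gamma>)) ` \<Gamma>\<^sub>0 = {(\<gamma>, \<rho>\<^sub>0 \<gamma>) |\<gamma>. \<gamma> \<in> \<Gamma>\<^sub>0}" by blast
  ultimately have "critical_exponent p {(\<gamma>, \<rho>\<^sub>0 \<gamma>) |\<gamma>. \<gamma> \<in> \<Gamma>\<^sub>0} \<le> ereal s"
    unfolding critical_exponent_def by (intro Inf_lower imageI CollectI) simp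
  also have "s < 2 / sqrt 5"
  proof -
    have "sqrt (5 / 4) < sqrt (1 / s1\<^sup>2 + 1 / s2\<^sup>2)" using s(5) by simp
    then have "s < 1 / sqrt (5 / 4)" unfolding s_def by (intro divide_strict_left_mono mult_pos_pos) auto
    also have "1 / sqrt (5 / 4) = 2 / sqrt 5" by (simp add: real_sqrt_divide)
    finally show ?thesis .
  qed
  finally show ?thesis by simp
qed

end
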